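(* Let $A\in L(\mathbb{C}^n,\mathbb{C}^n)$ with $m(A)>0$, let $n_0=[k_+(A)/m(A)]$, let $h\in\mathcal{H}_A(B^n)$, and let $v=v(z,s,t)$ be the transition mapping generated by $h$. If $F_k:[0,\infty)\to\mathcal{P}^k(\mathbb{C}^n)$, $k=2,\dots,n_0$, are polynomially bounded solutions of the coefficient equations (stated in the context) associated with $h$, then $$g(z,s):=\lim_{t\to\infty}e^{tA}\Bigl(v(z,s,t)+\sum_{k=2}^{n_0}F_k\bigl(v(z,s,t)^k,t\bigr)\Bigr)$$ exists for all $z\in B^n$, $s\ge0$, locally uniformly with respect to $z$, and $g$ is a polynomially bounded Loewner chain solution of $$\frac{\partial g}{\partial t}(z,t)=Dg(z,t)\,h(z,t)\quad\text{a.e. } t\ge0,\ z\in B^n. \qquad ( * )$$ If $F(t)$ is a polynomial bound for $F_k$, $k=2,\dots,n_0$ (i.e. $\|F_k(t)\|\le F(t)$ for $t\ge0$), then, given $\epsilon>0$, there exists a polynomial $Q_{\epsilon,A,F}$, depending only on $\epsilon$, $A$ and $F$, of the same degree as $F$, such that $$\|e^{-tA}g(z,t)\|\le\frac{Q_{\epsilon,A,F}(t)}{(1-\|z\|)^{2\frac{k_+(A)}{m(A)}+\epsilon}},\quad z\in B^n,\ t\ge0.$$ Furthermore, if $g(z,t)=e^{tA}\bigl(z+\sum_{k=2}^{\infty}G_k(z^k,t)\bigr)$ then $G_k=F_k$ for $k=2,\dots,n_0$.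
   Context: $\mathbb{C}^n$ carries the Euclidean inner product and norm, $B^n$ is the open unit ball, $m(A):=\min\{\operatorname{Re}\langle A(z),z\rangle:\|z\|=1\}$, $k_+(A):=\max\{\operatorname{Re}\lambda:\lambda\in\sigma(A)\}$, and $[\cdot]$ is the integer part. $\mathcal{N}_A$ is the set of holomorphic $h:B^n\to\mathbb{C}^n$ with $h(0)=0$, $Dh(0)=A$ and $\operatorname{Re}\langle h(z),z\rangle>0$ for $z\in B^n\setminus\{0\}$. $\mathcal{H}_A(B^n)$ is the set of $h:B^n\times[0,\infty)\to\mathbb{C}^n$ with $h(\cdot,t)\in\mathcal{N}_A$ for all $t\ge0$ and $h(z,\cdot)$ measurable on $[0,\infty)$ for all $z\in B^n$. Write $h(z,t)=Az+\sum_{k\ge2}H_k(z^k,t)$ with $H_k(\cdot,t)$ homogeneous polynomial mappings of degree $k$. The transition mapping $v(z,s,t)$ ($z\in B^n$, $0\le s\le t$) generated by $h$ is the unique solution of $\frac{\partial v}{\partial t}=-h(v,t)$ a.e. $t\ge s$, $v(z,s,s)=z$ (known to exist, with $v(\cdot,s,t)$ a univalent self-map of $B^n$ fixing $0$, and $v(z,s,\cdot)$ Lipschitz on $[s,\infty)$ locally uniformly in $z$). $\mathcal{P}^k(\mathbb{C}^n)$ is the Banach space of homogeneous polynomial mappings of degree $k$ from $\mathbb{C}^n$ to $\mathbb{C}^n$; $Q\in\mathcal{P}^k(\mathbb{C}^n)$ is identified with its symmetric $k$-linear map (and $\|Q\|$ is the norm of this multilinear map), and $Q(z^k)=Q(z,\dots,z)$,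 $Q(w,z^{k-1})=Q(w,z,\dots,z)$. Let $B_k$ be the linear operator on $\mathcal{P}^k(\mathbb{C}^n)$ given by $(B_kQ)(z^k)=kQ(Az,z^{k-1})-AQ(z^k)$. The coefficient equations are $$\frac{dF_k}{dt}(z^k,t)=B_k(F_k(z^k,t))+N_k(z^k,t)\quad\text{a.e. } t\ge0,$$ $$N_k(z^k,t)=H_k(z^k,t)+\sum_{j=2}^{k-1}jF_j\bigl(H_{k-j+1}(z^{k-j+1},t),z^{j-1},t\bigr),$$ where $F_j(\cdot,t)=F_j(t)$; solutions are locally absolutely continuous functions $F_k:[0,\infty)\to\mathcal{P}^k(\mathbb{C}^n)$. $F_k$ is polynomially bounded if there is a polynomial $P$ with $\|F_k(t)\|\le P(t)$ for $t\ge0$. A mapping $f:B^n\times[0,\infty)\to\mathbb{C}^n$ is a Loewner chain if each $f(\cdot,t)$ is univalent on $B^n$ and for all $0\le s\le t$, $f(z,s)=f(w(z,s,t),t)$ for some holomorphic self-map $w(\cdot,s,t)$ of $B^n$ fixing $0$. Solutions $f$ of $( * )$ are holomorphic in $z$, locally absolutely continuous in $t$ locally uniformly with respect to $z$, satisfy $( * )$ for almost every $t\ge0$ and all $z\in B^n$, and are normalized by $f(0,t)=0$, $Df(0,t)=e^{tA}$. A solution $f$ is polynomially bounded if for every compact $K\subset B^n$ there are a constant $C_K$ and a polynomial $P$ with $\|e^{-tA}f(z,t)\|\le C_KP(t)$ for $z\in K$, $t\ge0$. For the degree statement, the zero polynomial is regarded as a constant polynomial (degree $0$). *)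

theory Defs
  imports "HOL-Analysis.Analysis" "HOL-Computational_Algebra.Polynomial"
begin

text \<open>
  Complex n-space is \<open>complex ^ 'n\<close> with its library norm, which is the Euclidean one, and linear
  operators are square matrices acting by \<open>(*v)\<close>.  The library inner product on this type is real
  valued, hence the following sesquilinear product.
\<close>

definition cinner :: "complex ^ 'n \<Rightarrow> complex ^ 'n \<Rightarrow> complex" where
  "cinner z w = (\<Sum>i\<in>UNIV. z $ i * cnj (w $ i))"

text \<open>The minimum over the (compact, nonempty) unit sphere is written as an infimum.\<close>

definition m_low :: "complex ^ 'n ^ 'n \<Rightarrow> real" where
  "m_low A = (INF z\<in>{z. norm z = 1}. Re (cinner (A *v z) z))"

definition spectrum :: "complex ^ 'n ^ 'n \<Rightarrow> complex set" where
  "spectrum A = {\<mu>. \<exists>x. x \<noteq> 0 \<and> A *v x = \<mu> *s x}"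

definition k_plus :: "complex ^ 'n ^ 'n \<Rightarrow> real" where
  "k_plus A = Max (Re ` spectrum A)"

definition n0 :: "complex ^ 'n ^ 'n \<Rightarrow> nat" where
  "n0 A = nat \<lfloor>k_plus A / m_low A\<rfloor>"

text \<open>
  Multiplication and powers on the type of square matrices are componentwise in the library, so
  neither \<open>exp\<close> nor \<open>(^)\<close> can be used here.
\<close>

definition mexp :: "complex ^ 'n ^ 'n \<Rightarrow> complex ^ 'n ^ 'n" where
  "mexp M = (\<Sum>j. (1 / fact j) *\<^sub>R (((**) M) ^^ j) (mat 1))"

text \<open>Complex (Frechet) differentiability at every point; only used on open sets.\<close>

definition holo_on :: "(complex ^ 'n \<Rightarrow> complex ^ 'n) \<Rightarrow> (complex ^ 'n) set \<Rightarrow> bool" where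
  "holo_on f S \<longleftrightarrow> (\<forall>z\<in>S. \<exists>M. (f has_derivative (\<lambda>u. M *v u)) (at z))"

definition univalent_on :: "(complex ^ 'n \<Rightarrow> complex ^ 'n) \<Rightarrow> (complex ^ 'n) set \<Rightarrow> bool" where
  "univalent_on f S \<longleftrightarrow> holo_on f S \<and> inj_on f S"

definition class_N :: "complex ^ 'n ^ 'n \<Rightarrow> (complex ^ 'n \<Rightarrow> complex ^ 'n) set" where
  "class_N A = {h. holo_on h (ball 0 1) \<and> h 0 = 0 \<and> (h has_derivative (\<lambda>u. A *v u)) (at 0) \<and>
      (\<forall>z\<in>ball 0 1 - {0}. Re (cinner (h z) z) > 0)}"

definition class_H :: "complex ^ 'n ^ 'n \<Rightarrow> (complex ^ 'n \<Rightarrow> real \<Rightarrow> complex ^ 'n) set" where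
  "class_H A = {h. (\<forall>t\<ge>0. (\<lambda>z. h z t) \<in> class_N A) \<and>
      (\<forall>z\<in>ball 0 1. (\<lambda>t. h z t) \<in> borel_measurable (lebesgue_on {0..}))}"

text \<open>
  A homogeneous polynomial mapping of degree \<open>k\<close> is represented by its symmetric \<open>k\<close>-linear map,
  the arguments being given as a list; only the values on lists of length \<open>k\<close> matter.
  \<open>Q(z, \<dots>, z)\<close> is \<open>Q (replicate k z)\<close>, and \<open>Q(w, z, \<dots>, z)\<close> is \<open>Q (w # replicate (k - 1) z)\<close>.
\<close>

type_synonym 'n form = "(complex ^ 'n) list \<Rightarrow> complex ^ 'n"

definition hom_poly :: "nat \<Rightarrow> 'n::finite form set" where
  "hom_poly k = {Q.
     (\<forall>ws i. length ws = k \<longrightarrow> i < k \<longrightarrow> Vector_Spaces.linear (*s) (*s) (\<lambda>w. Q (ws[i := w]))) \<and>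
     (\<forall>ws vs. length ws = k \<longrightarrow> mset ws = mset vs \<longrightarrow> Q ws = Q vs)}"

definition form_norm :: "nat \<Rightarrow> 'n::finite form \<Rightarrow> real" where
  "form_norm k Q = (SUP ws\<in>{ws. length ws = k \<and> (\<forall>w\<in>set ws. norm w \<le> 1)}. norm (Q ws))"

text \<open>The part of degree at least two of a homogeneous expansion.\<close>

definition tail_sum :: "(nat \<Rightarrow> 'n::finite form) \<Rightarrow> complex ^ 'n \<Rightarrow> complex ^ 'n" where
  "tail_sum P z = (\<Sum>k. P (k + 2) (replicate (k + 2) z))"

definition tail_convergent :: "(nat \<Rightarrow> 'n::finite form) \<Rightarrow> bool" where
  "tail_convergent P \<longleftrightarrow> (\<forall>k\<ge>2. P k \<in> hom_poly k) \<and>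
     (\<forall>z\<in>ball 0 1. summable (\<lambda>k. P (k + 2) (replicate (k + 2) z)))"

definition h_expansion ::
  "complex ^ 'n ^ 'n \<Rightarrow> (complex ^ 'n \<Rightarrow> real \<Rightarrow> complex ^ 'n) \<Rightarrow> (nat \<Rightarrow> real \<Rightarrow> 'n form) \<Rightarrow> bool" where
  "h_expansion A h H \<longleftrightarrow> (\<forall>t\<ge>0. tail_convergent (\<lambda>k. H k t) \<and>
     (\<forall>z\<in>ball 0 1. h z t = A *v z + tail_sum (\<lambda>k. H k t) z))"

text \<open>
  Absolute continuity on compact subintervals of \<open>[0, \<infinity>)\<close> of a family of functions indexed by \<open>K\<close>,
  uniformly over \<open>K\<close>: \<open>d z s t\<close> is the distance between the values of the member \<open>z\<close> at \<open>s\<close> and \<open>t\<close>.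
\<close>

definition unif_loc_abs_cont :: "'i set \<Rightarrow> ('i \<Rightarrow> real \<Rightarrow> real \<Rightarrow> real) \<Rightarrow> bool" where
  "unif_loc_abs_cont K d \<longleftrightarrow> (\<forall>T\<ge>0. \<forall>\<epsilon>>0. \<exists>\<delta>>0. \<forall>(N::nat) a b.
     (\<forall>i<N. 0 \<le> a i \<and> a i \<le> b i \<and> b i \<le> T) \<longrightarrow>
     (\<forall>i<N. \<forall>j<N. i \<noteq> j \<longrightarrow> {a i<..<b i} \<inter> {a j<..<b j} = {}) \<longrightarrow>
     (\<Sum>i<N. b i - a i) < \<delta> \<longrightarrow>
     (\<forall>z\<in>K. (\<Sum>i<N. d z (a i) (b i)) < \<epsilon>))"

definition B_op :: "complex ^ 'n ^ 'n \<Rightarrow> nat \<Rightarrow> 'n form \<Rightarrow> complex ^ 'n \<Rightarrow> complex ^ 'n" where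
  "B_op A k Q z = of_nat k *s Q ((A *v z) # replicate (k - 1) z) - A *v Q (replicate k z)"

definition N_term ::
  "(nat \<Rightarrow> real \<Rightarrow> 'n::finite form) \<Rightarrow> (nat \<Rightarrow> real \<Rightarrow> 'n form) \<Rightarrow> nat \<Rightarrow> real \<Rightarrow> complex ^ 'n \<Rightarrow> complex ^ 'n"
where
  "N_term H F k t z = H k t (replicate k z) +
     (\<Sum>j=2..k - 1. of_nat j *s
        F j t (H (k - j + 1) t (replicate (k - j + 1) z) # replicate (j - 1) z))"

definition coeff_solutions ::
  "complex ^ 'n ^ 'n \<Rightarrow> (nat \<Rightarrow> real \<Rightarrow> 'n form) \<Rightarrow> (nat \<Rightarrow> real \<Rightarrow> 'n form) \<Rightarrow> bool" where
  "coeff_solutions A H F \<longleftrightarrow> (\<forall>k\<in>{2..n0 A}.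
     (\<forall>t\<ge>0. F k t \<in> hom_poly k) \<and>
     unif_loc_abs_cont {()} (\<lambda>_ s t. form_norm k (\<lambda>ws. F k t ws - F k s ws)) \<and>
     (AE t in lebesgue_on {0..}. \<forall>z.
        ((\<lambda>\<tau>. F k \<tau> (replicate k z)) has_vector_derivative
           B_op A k (F k t) z + N_term H F k t z) (at t within {0..})))"

definition coeffs_bounded_by :: "complex ^ 'n ^ 'n \<Rightarrow> (nat \<Rightarrow> real \<Rightarrow> 'n form) \<Rightarrow> real poly \<Rightarrow> bool" where
  "coeffs_bounded_by A F P \<longleftrightarrow> (\<forall>k\<in>{2..n0 A}. \<forall>t\<ge>0. form_norm k (F k t) \<le> poly P t)"

definition coeffs_poly_bounded :: "complex ^ 'n ^ 'n \<Rightarrow> (nat \<Rightarrow> real \<Rightarrow> 'n form) \<Rightarrow> bool" where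
  "coeffs_poly_bounded A F \<longleftrightarrow> (\<forall>k\<in>{2..n0 A}. \<exists>P::real poly. \<forall>t\<ge>0. form_norm k (F k t) \<le> poly P t)"

text \<open>
  The transition mapping is the solution of the initial value problem in the class in which it is
  known to exist uniquely: univalent self-maps of the ball fixing the origin, Lipschitz in time
  locally uniformly in space.
\<close>

definition transition_mapping ::
  "(complex ^ 'n \<Rightarrow> real \<Rightarrow> complex ^ 'n) \<Rightarrow> (complex ^ 'n \<Rightarrow> real \<Rightarrow> real \<Rightarrow> complex ^ 'n) \<Rightarrow> bool" where
  "transition_mapping h v \<longleftrightarrow>
     (\<forall>s\<ge>0. \<forall>z\<in>ball 0 1. v z s s = z \<and>
        (AE t in lebesgue_on {s..}.
           ((\<lambda>\<tau>. v z s \<tau>) has_vector_derivative - h (v z s t) t) (at t within {s..}))) \<and>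
     (\<forall>s\<ge>0. \<forall>t\<ge>s. univalent_on (\<lambda>z. v z s t) (ball 0 1) \<and>
        (\<lambda>z. v z s t) ` ball 0 1 \<subseteq> ball 0 1 \<and> v 0 s t = 0) \<and>
     (\<forall>s\<ge>0. \<forall>K. compact K \<and> K \<subseteq> ball 0 1 \<longrightarrow>
        (\<exists>L. \<forall>z\<in>K. L-lipschitz_on {s..} (\<lambda>t. v z s t)))"

definition loewner_chain :: "(complex ^ 'n \<Rightarrow> real \<Rightarrow> complex ^ 'n) \<Rightarrow> bool" where
  "loewner_chain f \<longleftrightarrow>
     (\<forall>t\<ge>0. univalent_on (\<lambda>z. f z t) (ball 0 1)) \<and>
     (\<forall>s t. 0 \<le> s \<and> s \<le> t \<longrightarrow>
        (\<exists>w. holo_on w (ball 0 1) \<and> w ` ball 0 1 \<subseteq> ball 0 1 \<and> w 0 = 0 \<and>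
             (\<forall>z\<in>ball 0 1. f z s = f (w z) t)))"

definition loewner_solution ::
  "complex ^ 'n ^ 'n \<Rightarrow> (complex ^ 'n \<Rightarrow> real \<Rightarrow> complex ^ 'n) \<Rightarrow>
   (complex ^ 'n \<Rightarrow> real \<Rightarrow> complex ^ 'n) \<Rightarrow> bool" where
  "loewner_solution A h f \<longleftrightarrow>
     (\<forall>t\<ge>0. holo_on (\<lambda>z. f z t) (ball 0 1) \<and> f 0 t = 0 \<and>
        ((\<lambda>z. f z t) has_derivative (\<lambda>u. mexp (t *\<^sub>R A) *v u)) (at 0)) \<and>
     (\<forall>K. compact K \<and> K \<subseteq> ball 0 1 \<longrightarrow> unif_loc_abs_cont K (\<lambda>z s t. norm (f z t - f z s))) \<and>
     (AE t in lebesgue_on {0..}. \<forall>z\<in>ball 0 1.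
        ((\<lambda>\<tau>. f z \<tau>) has_vector_derivative
           frechet_derivative (\<lambda>w. f w t) (at z) (h z t)) (at t within {0..}))"

definition poly_bounded_solution ::
  "complex ^ 'n ^ 'n \<Rightarrow> (complex ^ 'n \<Rightarrow> real \<Rightarrow> complex ^ 'n) \<Rightarrow> bool" where
  "poly_bounded_solution A f \<longleftrightarrow> (\<forall>K. compact K \<and> K \<subseteq> ball 0 1 \<longrightarrow>
     (\<exists>(C::real) (P::real poly). \<forall>z\<in>K. \<forall>t\<ge>0.
        norm (mexp ((- t) *\<^sub>R A) *v f z t) \<le> C * poly P t))"

definition g_approx ::
  "complex ^ 'n ^ 'n \<Rightarrow> (complex ^ 'n \<Rightarrow> real \<Rightarrow> real \<Rightarrow> complex ^ 'n) \<Rightarrow>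
   (nat \<Rightarrow> real \<Rightarrow> 'n form) \<Rightarrow> real \<Rightarrow> complex ^ 'n \<Rightarrow> real \<Rightarrow> complex ^ 'n" where
  "g_approx A v F t z s =
     mexp (t *\<^sub>R A) *v (v z s t + (\<Sum>k=2..n0 A. F k t (replicate k (v z s t))))"

text \<open>\<open>Lim\<close> is a definite description: it is meaningful only once the limit is known to exist.\<close>

definition g_lim ::
  "complex ^ 'n ^ 'n \<Rightarrow> (complex ^ 'n \<Rightarrow> real \<Rightarrow> real \<Rightarrow> complex ^ 'n) \<Rightarrow>
   (nat \<Rightarrow> real \<Rightarrow> 'n form) \<Rightarrow> complex ^ 'n \<Rightarrow> real \<Rightarrow> complex ^ 'n" where
  "g_lim A v F z s = Lim at_top (\<lambda>t. g_approx A v F t z s)"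

end

theory Submission
  imports Defs "HOL-Complex_Analysis.Complex_Analysis"
    "HOL-Computational_Algebra.Fundamental_Theorem_Algebra"
begin

text \<open>
  The coefficient equations say exactly that \<open>e\<^sup>t\<^sup>A(w + \<Sum>F\<^sub>k(w\<^sup>k, t))\<close>, evaluated along a trajectory
  \<open>w = v(z, s, t)\<close>, has a time derivative of order \<open>\<parallel>w\<parallel>\<close> to the power \<open>n\<^sub>0 + 1\<close>.  Trajectories decay like
  \<open>e\<^sup>-\<^sup>m\<^sup>t\<close>, the operators \<open>e\<^sup>t\<^sup>A\<close> grow at most like \<open>exp((k\<^sub>+ + \<epsilon>) t)\<close>, and \<open>k\<^sub>+ < (n\<^sub>0 + 1) m\<close>, so the
  derivative is integrable and the limit \<open>g\<close> exists near the origin with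
  \<open>e\<^sup>-\<^sup>s\<^sup>A g(w, s) = w + \<Sum>F\<^sub>k(w\<^sup>k, s)\<close> up to an error of order \<open>\<parallel>w\<parallel>\<close> to the power \<open>n\<^sub>0 + 1\<close>.  The semigroup
  property of \<open>v\<close> carries everything to the whole ball: a point \<open>z\<close> enters the small ball after the
  time \<open>(1/m) ln (4 / (1 - \<parallel>z\<parallel>)\<^sup>2)\<close>, which produces the exponent of the growth estimate.
\<close>

text \<open>\<open>e\<^sup>t\<^sup>A\<close> has to be bounded through the spectrum, because the gap
  \<open>k_plus A < (n0 A + 1) * m_low A\<close> is a statement about the spectrum; the arbitrarily
  small loss in the exponent is harmless since the gap is strict. One third of the gap pays for this
  loss, one third absorbs the polynomial bound of the \<open>F k\<close>, and one third remains as
  the rate of convergence. The weight \<open>1 + t ^ d\<close> is submultiplicative up to a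
  constant, so the starting time leaves only the factor \<open>1 + s ^ d\<close>; this is why the
  bound for \<open>g\<close> keeps the degree of the bound for the coefficients. As \<open>Q\<close>
  may depend only on \<epsilon>, \<open>A\<close> and the polynomial bound, all constants have to be
  fixed before \<open>h\<close>, \<open>v\<close> and the coefficients appear, and the estimates
  take them as parameters. The equations hold only almost everywhere. Increments are recovered from
  derivatives by a monotonicity theorem for absolutely continuous functions, and the estimates along
  trajectories are cast as the monotonicity of suitable scalar expressions.\<close>

no_notation fps_nth (infixl "$" 75)

section \<open>Matrices and the matrix exponential\<close>

lemma norm_sum_mult_le: "norm (\<Sum>i\<in>UNIV. x $ i * y $ i) \<le> norm x * norm (y :: complex ^ 'n)"
proof -
  have "norm (\<Sum>i\<in>UNIV. x $ i * y $ i) \<le> (\<Sum>i\<in>UNIV. \<bar>norm (x $ i)\<bar> * \<bar>norm (y $ i)\<bar>)"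
    by (rule order_trans[OF norm_sum]) (simp add: norm_mult)
  also have "\<dots> \<le> L2_set (\<lambda>i. norm (x $ i)) UNIV * L2_set (\<lambda>i. norm (y $ i)) UNIV"
    by (rule L2_set_mult_ineq)
  finally show ?thesis by (simp add: norm_vec_def)
qed

lemma norm_matrix_vector_le: "norm (M *v x) \<le> norm M * norm (x :: complex ^ 'n)"
  for M :: "complex ^ 'n ^ 'm"
proof -
  have "norm (M *v x) \<le> L2_set (\<lambda>i. norm (M $ i) * norm x) UNIV"
    unfolding norm_vec_def[of "M *v x"]
    by (intro L2_set_mono) (auto simp: matrix_vector_mult_def norm_sum_mult_le)
  also have "\<dots> = norm M * norm x"
    by (simp add: L2_set_left_distrib norm_vec_def[of M])
  finally show ?thesis .
qed

lemma norm_transpose [simp]: "norm (transpose M) = norm (M :: complex ^ 'n ^ 'm)"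
proof -
  have "(\<Sum>i\<in>UNIV. \<Sum>j\<in>UNIV. (norm (M $ j $ i))\<^sup>2) = (\<Sum>i\<in>UNIV. \<Sum>j\<in>UNIV. (norm (M $ i $ j))\<^sup>2)"
    by (rule sum.swap)
  then show ?thesis
    by (simp add: norm_vec_def L2_set_def transpose_def sum_nonneg)
qed

lemma norm_matrix_matrix_le: "norm (M ** N) \<le> norm M * norm (N :: complex ^ 'n ^ 'm)"
  for M :: "complex ^ 'm ^ 'k"
proof -
  have "(M ** N) $ i = transpose N *v (M $ i)" for i
    by (simp add: matrix_matrix_mult_def matrix_vector_mult_def vec_eq_iff transpose_def mult.commute)
  then have "norm ((M ** N) $ i) \<le> norm (M $ i) * norm N" for i
    using norm_matrix_vector_le[of "transpose N" "M $ i"] by (simp add: mult.commute)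
  then have "norm (M ** N) \<le> L2_set (\<lambda>i. norm (M $ i) * norm N) UNIV"
    unfolding norm_vec_def[of "M ** N"] by (intro L2_set_mono) auto
  also have "\<dots> = norm M * norm N"
    by (simp add: L2_set_left_distrib norm_vec_def[of M])
  finally show ?thesis .
qed

lemma bounded_bilinear_matrix_matrix:
  "bounded_bilinear ((**) :: complex ^ 'm ^ 'k \<Rightarrow> complex ^ 'n ^ 'm \<Rightarrow> complex ^ 'n ^ 'k)"
  by (rule bounded_bilinear.intro)
     (auto simp: matrix_add_ldistrib matrix_matrix_mult_def vec_eq_iff algebra_simps sum.distrib
        scaleR_sum_right intro!: exI[of _ 1] norm_matrix_matrix_le[unfolded matrix_matrix_mult_def])

lemma bounded_bilinear_matrix_vector:
  "bounded_bilinear ((*v) :: complex ^ 'n ^ 'm \<Rightarrow> complex ^ 'n \<Rightarrow> complex ^ 'm)"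
proof
  show "\<exists>K. \<forall>M x. norm ((M :: complex ^ 'n ^ 'm) *v x) \<le> norm M * norm x * K"
    by (intro exI[of _ 1]) (auto simp: norm_matrix_vector_le)
qed (auto simp: matrix_vector_mult_def vec_eq_iff algebra_simps sum.distrib scaleR_sum_right)

lemma norm_vscale: "norm (a *s b) = norm a * norm b" for a :: complex and b :: "complex ^ 'n"
  by (auto simp: norm_vec_def norm_mult L2_set_right_distrib)

lemma bounded_bilinear_vscale: "bounded_bilinear ((*s) :: complex \<Rightarrow> complex ^ 'n \<Rightarrow> complex ^ 'n)"
proof
  show "\<exists>K. \<forall>a b. norm (a *s b) \<le> norm (a :: complex) * norm (b :: complex ^ 'n) * K"
    by (intro exI[of _ 1]) (auto simp: norm_vscale)
qed (auto simp: vec_eq_iff algebra_simps)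

text \<open>Growth of a matrix can thus be tested on its columns, that is, on single
  vectors.\<close>

lemma norm_matrix_le_sum_axis: "norm M \<le> (\<Sum>i\<in>UNIV. norm (M *v axis i 1))" for M :: "complex ^ 'n ^ 'n"
proof -
  have "norm M = norm (transpose M)" by simp
  also have "\<dots> \<le> (\<Sum>i\<in>UNIV. norm (transpose M $ i))"
    unfolding norm_vec_def[of "transpose M"] by (rule L2_set_le_sum) auto
  also have "(\<lambda>i. transpose M $ i) = (\<lambda>i. M *v axis i 1)"
    by (simp add: fun_eq_iff vec_eq_iff matrix_vector_mult_def transpose_def axis_def if_distrib[of "\<lambda>x. _ * x"] cong: if_cong)
  finally show ?thesis .
qed

lemma has_vector_derivative_vecI:
  fixes f :: "real \<Rightarrow> 'a::real_normed_vector ^ 'n"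
  assumes "\<And>i. ((\<lambda>t. f t $ i) has_vector_derivative f' $ i) (at t within S)"
  shows "(f has_vector_derivative f') (at t within S)"
  using assms unfolding has_vector_derivative_def has_derivative_within
  by (auto intro!: vec_tendstoI bounded_linear_scaleR_left)

abbreviation mpow :: "complex ^ 'n ^ 'n \<Rightarrow> nat \<Rightarrow> complex ^ 'n ^ 'n" where
  "mpow A j \<equiv> (((**) A) ^^ j) (mat 1)"

lemma norm_mpow_le: "norm (mpow A j) \<le> norm A ^ j * norm (mat 1 :: complex ^ 'n ^ 'n)"
  for A :: "complex ^ 'n ^ 'n"
proof (induction j)
  case (Suc j)
  have "norm (mpow A (Suc j)) \<le> norm A * norm (mpow A j)"
    by (simp add: norm_matrix_matrix_le)
  also have "\<dots> \<le> norm A * (norm A ^ j * norm (mat 1 :: complex ^ 'n ^ 'n))"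
    by (intro mult_left_mono Suc) auto
  finally show ?case by (simp add: mult.assoc)
qed auto

lemma mpow_scaleR: "mpow (t *\<^sub>R A) j = t ^ j *\<^sub>R mpow A j"
  by (induction j) (simp_all add: bounded_bilinear.scaleR_left[OF bounded_bilinear_matrix_matrix] bounded_bilinear.scaleR_right[OF bounded_bilinear_matrix_matrix])

lemma summable_mexp:
  fixes A :: "complex ^ 'n ^ 'n"
  shows "summable (\<lambda>j. (1 / fact j) *\<^sub>R mpow A j)"
proof (rule summable_comparison_test')
  show "summable (\<lambda>j. norm (mat 1 :: complex ^ 'n ^ 'n) * (norm A ^ j /\<^sub>R fact j))"
    by (intro summable_mult summable_exp_generic)
  fix j
  show "norm ((1 / fact j) *\<^sub>R mpow A j) \<le> norm (mat 1 :: complex ^ 'n ^ 'n) * (norm A ^ j /\<^sub>R fact j)"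
    using norm_mpow_le[where A = A and j = j] by (simp add: divide_simps mult.commute)
qed

lemma mexp_nth: "(\<lambda>j. mpow A j $ i $ k / fact j * of_real t ^ j) sums (mexp (t *\<^sub>R A) $ i $ k)"
proof -
  have "(\<lambda>j. (1 / fact j) *\<^sub>R mpow (t *\<^sub>R A) j) sums mexp (t *\<^sub>R A)"
    unfolding mexp_def by (intro summable_sums summable_mexp)
  from bounded_linear.sums[OF bounded_linear_vec_nth bounded_linear.sums[OF bounded_linear_vec_nth this]]
  show ?thesis
    unfolding mpow_scaleR by (simp add: scaleR_conv_of_real[where 'a = complex] mult_ac)
qed

lemma mexp_0 [simp]: "mexp (0 :: complex ^ 'n ^ 'n) = mat 1"
proof -
  have "(\<lambda>j. (1 / fact j) *\<^sub>R mpow (0 :: complex ^ 'n ^ 'n) j) = (\<lambda>j. if j = 0 then mat 1 else 0)"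
    by (rule ext, case_tac j) (auto simp: matrix_matrix_mult_def vec_eq_iff)
  then have "(\<lambda>j. (1 / fact j) *\<^sub>R mpow (0 :: complex ^ 'n ^ 'n) j) sums mat 1"
    using sums_single[of 0 "\<lambda>_. mat 1 :: complex ^ 'n ^ 'n"] by simp
  then show ?thesis
    unfolding mexp_def by (rule sums_unique[symmetric])
qed

lemma summable_mexp_nth:
  fixes A :: "complex ^ 'n ^ 'n"
  shows "summable (\<lambda>j. mpow A j $ i $ k / fact j * z ^ j)"
proof (rule summable_comparison_test')
  show "summable (\<lambda>j. norm (mat 1 :: complex ^ 'n ^ 'n) * ((norm A * norm z) ^ j /\<^sub>R fact j))"
    by (intro summable_mult summable_exp_generic)
  fix j
  have "norm (mpow A j $ i $ k) \<le> norm A ^ j * norm (mat 1 :: complex ^ 'n ^ 'n)"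
    using norm_mpow_le[where A = A and j = j]
    by (rule order_trans[OF order_trans[OF Finite_Cartesian_Product.norm_nth_le Finite_Cartesian_Product.norm_nth_le]])
  then have "norm (mpow A j $ i $ k) * norm z ^ j \<le> norm A ^ j * norm (mat 1 :: complex ^ 'n ^ 'n) * norm z ^ j"
    by (intro mult_right_mono) auto
  then show "norm (mpow A j $ i $ k / fact j * z ^ j)
      \<le> norm (mat 1 :: complex ^ 'n ^ 'n) * ((norm A * norm z) ^ j /\<^sub>R fact j)"
    by (simp add: norm_mult norm_divide norm_power divide_simps power_mult_distrib mult_ac)
qed

text \<open>Each entry of \<open>mexp (t *\<^sub>R A)\<close> is an everywhere convergent scalar
  power series in \<open>t\<close>, so it can be differentiated termwise as a function of a complex
  variable and then restricted to the real line.\<close>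

lemma mexp_has_vector_derivative:
  "((\<lambda>t. mexp (t *\<^sub>R A)) has_vector_derivative A ** mexp (t *\<^sub>R A)) (at t within S)"
proof (intro has_vector_derivative_vecI)
  fix i k
  let ?c = "\<lambda>k j. mpow A j $ i $ k / fact j"
  let ?e = "\<lambda>i k z. \<Sum>j. mpow A j $ i $ k / fact j * z ^ j"
  have e: "mexp (t *\<^sub>R A) $ i $ k = ?e i k (of_real t)" for t i k
    using mexp_nth[where A = A and i = i and k = k and t = t] by (simp add: sums_iff)
  have d: "diffs (?c k) j = (\<Sum>l\<in>UNIV. A $ i $ l * (mpow A j $ l $ k / fact j))" for j
  proof -
    have "of_nat (Suc j) * (x / fact (Suc j)) = x / fact j" for x :: complex
      by (simp del: of_nat_Suc)
    then show ?thesis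
      by (simp add: diffs_def matrix_matrix_mult_def sum_divide_distrib sum_distrib_left del: of_nat_Suc fact_Suc)
  qed
  have "((\<lambda>z. ?e i k z) has_field_derivative (\<Sum>j. diffs (?c k) j * of_real t ^ j)) (at (of_real t))"
    by (rule termdiffs_strong_converges_everywhere) (rule summable_mexp_nth)
  moreover have "(\<Sum>j. diffs (?c k) j * of_real t ^ j) = (\<Sum>l\<in>UNIV. A $ i $ l * ?e l k (of_real t))"
  proof -
    have "(\<Sum>j. diffs (?c k) j * of_real t ^ j) =
        (\<Sum>j. \<Sum>l\<in>UNIV. A $ i $ l * (mpow A j $ l $ k / fact j * of_real t ^ j))"
      by (simp add: d sum_distrib_right mult.assoc)
    also have "\<dots> = (\<Sum>l\<in>UNIV. \<Sum>j. A $ i $ l * (mpow A j $ l $ k / fact j * of_real t ^ j))"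
      by (rule suminf_sum) (intro summable_mult summable_mexp_nth)
    also have "\<dots> = (\<Sum>l\<in>UNIV. A $ i $ l * ?e l k (of_real t))"
      by (intro sum.cong refl suminf_mult summable_mexp_nth)
    finally show ?thesis .
  qed
  ultimately have "((\<lambda>t. ?e i k (of_real t)) has_vector_derivative (A ** mexp (t *\<^sub>R A)) $ i $ k) (at t within S)"
    by (auto simp: matrix_matrix_mult_def e intro!: has_vector_derivative_real_field)
  then show "((\<lambda>t. mexp (t *\<^sub>R A) $ i $ k) has_vector_derivative (A ** mexp (t *\<^sub>R A)) $ i $ k) (at t within S)"
    by (simp add: e)
qed


lemma mexp_commute: "A ** mexp (t *\<^sub>R A) = mexp (t *\<^sub>R A) ** (A :: complex ^ 'n ^ 'n)"
proof -
  interpret L: bounded_linear "\<lambda>M. A ** M" 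
    by (rule bounded_bilinear.bounded_linear_right[OF bounded_bilinear_matrix_matrix])
  interpret R: bounded_linear "\<lambda>M. M ** A" 
    by (rule bounded_bilinear.bounded_linear_left[OF bounded_bilinear_matrix_matrix])
  have c: "A ** mpow A j = mpow A j ** A" for j
    by (induction j) (auto simp: matrix_mul_assoc)
  have s: "(\<lambda>j. (1 / fact j) *\<^sub>R mpow (t *\<^sub>R A) j) sums mexp (t *\<^sub>R A)"
    unfolding mexp_def by (intro summable_sums summable_mexp)
  have "(\<lambda>j. A ** ((1 / fact j) *\<^sub>R mpow (t *\<^sub>R A) j)) = (\<lambda>j. ((1 / fact j) *\<^sub>R mpow (t *\<^sub>R A) j) ** A)"
    by (simp add: L.scaleR R.scaleR mpow_scaleR c)
  then show ?thesis
    using sums_unique2[OF L.sums[OF s]] R.sums[OF s] by simp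
qed

lemma mexp_affine_has_vector_derivative:
  "((\<lambda>t. mexp ((c * t + s) *\<^sub>R A)) has_vector_derivative c *\<^sub>R (A ** mexp ((c * t + s) *\<^sub>R A))) (at t within S)"
proof -
  have "((\<lambda>t. c * t + s) has_vector_derivative c) (at t within S)"
    by (auto intro!: derivative_eq_intros simp flip: has_real_derivative_iff_has_vector_derivative)
  from vector_diff_chain_within[OF this mexp_has_vector_derivative] show ?thesis
    by (simp add: o_def)
qed

text \<open>The left side is constant in \<open>t\<close>: since \<open>A\<close> commutes with its
  exponential, the two terms of the product rule cancel. The inverse law and the addition law are
  both read off from this identity.\<close>

lemma mexp_minus_mult: "mexp ((- t) *\<^sub>R A) ** mexp ((s + t) *\<^sub>R A) = mexp (s *\<^sub>R (A :: complex ^ 'n ^ 'n))"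
proof -
  interpret bounded_bilinear "(**) :: complex ^ 'n ^ 'n \<Rightarrow> complex ^ 'n ^ 'n \<Rightarrow> complex ^ 'n ^ 'n"
    by (rule bounded_bilinear_matrix_matrix)
  let ?f = "\<lambda>t. mexp ((- t) *\<^sub>R A) ** mexp ((s + t) *\<^sub>R A)"
  have m: "((\<lambda>t. mexp ((- t) *\<^sub>R A)) has_vector_derivative - (A ** mexp ((- t) *\<^sub>R A))) (at t within UNIV)" for t
    using mexp_affine_has_vector_derivative[of "-1" 0 A t UNIV] by simp
  have p: "((\<lambda>t. mexp ((s + t) *\<^sub>R A)) has_vector_derivative (A ** mexp ((s + t) *\<^sub>R A))) (at t within UNIV)" for t
    using mexp_affine_has_vector_derivative[of 1 s A t UNIV] by (simp add: add.commute)
  have "(?f has_vector_derivative 0) (at t within UNIV)" for t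
  proof -
    have "(?f has_vector_derivative
       mexp ((- t) *\<^sub>R A) ** (A ** mexp ((s + t) *\<^sub>R A)) + (- (A ** mexp ((- t) *\<^sub>R A))) ** mexp ((s + t) *\<^sub>R A)) (at t within UNIV)"
      by (rule has_vector_derivative[OF m p])
    moreover have "A ** mexp ((- t) *\<^sub>R A) = mexp ((- t) *\<^sub>R A) ** A"
      by (rule mexp_commute)
    ultimately show ?thesis
      by (simp only: minus_left matrix_mul_assoc add.right_inverse)
  qed
  then obtain c where "\<And>x. ?f x = c"
    using has_vector_derivative_zero_constant[of UNIV ?f] by auto
  then have "?f t = ?f 0" by metis
  then show ?thesis by simp
qed

lemma mexp_minus_left: "mexp ((- t) *\<^sub>R A) ** mexp (t *\<^sub>R A) = mat 1"
  using mexp_minus_mult[of t A 0] by simp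

lemma mexp_minus_right: "mexp (t *\<^sub>R A) ** mexp ((- t) *\<^sub>R A) = mat 1"
  using mexp_minus_left[of "- t" A] by simp

lemma mexp_add: "mexp ((s + t) *\<^sub>R A) = mexp (t *\<^sub>R A) ** mexp (s *\<^sub>R A)"
proof -
  have "mexp (t *\<^sub>R A) ** mexp (s *\<^sub>R A) = (mexp (t *\<^sub>R A) ** mexp ((- t) *\<^sub>R A)) ** mexp ((s + t) *\<^sub>R A)"
    by (simp only: mexp_minus_mult[of t A s, symmetric] matrix_mul_assoc)
  then show ?thesis
    by (simp only: mexp_minus_right matrix_mul_lid)
qed


section \<open>Products of factors A - l, the spectrum, and the growth of the exponential\<close>

definition eig_shift :: "complex ^ 'n ^ 'n \<Rightarrow> complex \<Rightarrow> complex ^ 'n \<Rightarrow> complex ^ 'n" where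
  "eig_shift A l x = A *v x - l *s x"

lemma matrix_vector_mult_vscale: "A *v (c *s x) = c *s (A *v x)" for x :: "complex ^ 'n"
  by (simp add: matrix_vector_mult_def vec_eq_iff sum_distrib_left mult_ac)

lemma eig_shift_0 [simp]: "eig_shift A l 0 = 0"
  by (simp add: eig_shift_def)

lemma eig_shift_vscale: "eig_shift A l (c *s x) = c *s eig_shift A l x"
  by (simp add: eig_shift_def matrix_vector_mult_vscale vector_ssub_ldistrib mult.commute)

lemma eig_shift_add: "eig_shift A l (x + y) = eig_shift A l x + eig_shift A l y"
  by (simp add: eig_shift_def algebra_simps vector_add_ldistrib)

lemma eig_shift_commute: "eig_shift A l (eig_shift A l' x) = eig_shift A l' (eig_shift A l x)"
  by (simp add: eig_shift_def matrix_vector_mult_vscale vector_ssub_ldistrib matrix_vector_mult_diff_distrib mult.commute)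

lemma foldr_eig_shift_commute1: "foldr (eig_shift A) L (eig_shift A l x) = eig_shift A l (foldr (eig_shift A) L x)"
  by (induction L) (auto simp: eig_shift_commute)

lemma foldr_eig_shift_commute: "foldr (eig_shift A) L (foldr (eig_shift A) L' x) = foldr (eig_shift A) L' (foldr (eig_shift A) L x)"
  by (induction L) (auto simp: foldr_eig_shift_commute1)

lemma foldr_eig_shift_0 [simp]: "foldr (eig_shift A) L 0 = 0"
  by (induction L) auto

lemma foldr_eig_shift_add: "foldr (eig_shift A) L (x + y) = foldr (eig_shift A) L x + foldr (eig_shift A) L y"
  by (induction L) (auto simp: eig_shift_add)

lemma foldr_eig_shift_vscale: "foldr (eig_shift A) L (c *s x) = c *s foldr (eig_shift A) L x"
  by (induction L) (auto simp: eig_shift_vscale)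

lemma foldr_eig_shift_sum: "foldr (eig_shift A) L (\<Sum>i\<in>I. f i) = (\<Sum>i\<in>I. foldr (eig_shift A) L (f i))"
  by (induction I rule: infinite_finite_induct) (auto simp: foldr_eig_shift_add)

text \<open>This is the vector p(A) x.\<close>

definition poly_act :: "complex ^ 'n ^ 'n \<Rightarrow> complex poly \<Rightarrow> complex ^ 'n \<Rightarrow> complex ^ 'n" where
  "poly_act A p x = (\<Sum>i\<le>degree p. coeff p i *s (mpow A i *v x))"

lemma poly_act_bound: "degree p \<le> N \<Longrightarrow> poly_act A p x = (\<Sum>i\<le>N. coeff p i *s (mpow A i *v x))"
  unfolding poly_act_def by (intro sum.mono_neutral_left) (auto simp: coeff_eq_0)

lemma poly_act_linear_factor: "poly_act A ([:- l, 1:] * q) x = eig_shift A l (poly_act A q x)"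
proof -
  let ?f = "\<lambda>i. mpow A i *v x"
  define N where "N = degree q"
  have deg: "degree ([:- l, 1:] * q) \<le> Suc N"
    using degree_mult_le[of "[:- l, 1:]" q] by (simp add: N_def)
  have A: "A *v (\<Sum>i\<le>N. coeff q i *s ?f i) = (\<Sum>i\<le>N. coeff q i *s ?f (Suc i))"
    by (simp add: vec.linear_sum[OF matrix_vector_mul_linear_gen] matrix_vector_mult_vscale matrix_vector_mul_assoc)
  have "poly_act A ([:- l, 1:] * q) x = (\<Sum>i\<le>Suc N. coeff ([:- l, 1:] * q) i *s ?f i)"
    by (rule poly_act_bound[OF deg])
  also have "\<dots> = (\<Sum>i\<le>Suc N. coeff (pCons 0 q) i *s ?f i) - (\<Sum>i\<le>Suc N. (l * coeff q i) *s ?f i)"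
    by (simp add: vector_sub_rdistrib sum_subtractf[symmetric])
  also have "(\<Sum>i\<le>Suc N. (l * coeff q i) *s ?f i) = l *s poly_act A q x"
    using poly_act_bound[of q "Suc N" A x]
    by (simp only: N_def le_SucI order_refl) (simp only: vec.scale_sum_right vector_smult_assoc)
  also have "(\<Sum>i\<le>Suc N. coeff (pCons 0 q) i *s ?f i) = A *v poly_act A q x"
    unfolding sum.atMost_Suc_shift by (simp add: poly_act_def N_def[symmetric] A)
  finally show ?thesis
    by (simp add: eig_shift_def)
qed

lemma poly_act_eig_shift: "poly_act A p (eig_shift A l x) = eig_shift A l (poly_act A p x)"
proof -
  have "mpow A i *v (A *v x) = A *v (mpow A i *v x)" for i
    by (induction i) (simp_all flip: matrix_vector_mul_assoc)
  then have "mpow A i *v eig_shift A l x = eig_shift A l (mpow A i *v x)" for i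
    by (simp add: eig_shift_def matrix_vector_mult_diff_distrib matrix_vector_mult_vscale)
  moreover have "eig_shift A l (\<Sum>i\<in>I. f i) = (\<Sum>i\<in>I. eig_shift A l (f i))" for I and f :: "nat \<Rightarrow> _"
    using foldr_eig_shift_sum[of A "[l]"] by simp
  ultimately show ?thesis
    by (simp add: poly_act_def eig_shift_vscale)
qed

text \<open>A factor \<open>A - l\<close> with \<open>l\<close> outside the spectrum is injective and can be dropped.\<close>

lemma poly_act_0_imp_foldr:
  assumes "p \<noteq> 0" "poly_act A p x = 0"
  shows "\<exists>L. set L \<subseteq> spectrum A \<and> foldr (eig_shift A) L x = 0"
  using assms
proof (induction "degree p" arbitrary: p x)
  case 0
  then obtain c where "p = [:c:]" "c \<noteq> 0"
    by (metis degree_eq_zeroE pCons_0_0)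
  with 0 show ?case by (intro exI[of _ "[]"]) (auto simp: poly_act_def)
next
  case (Suc n)
  then obtain l where "poly p l = 0"
    using fundamental_theorem_of_algebra[of p] by (metis constant_degree nat.distinct(1))
  then obtain q where p: "p = [:- l, 1:] * q"
    by (metis poly_eq_0_iff_dvd dvdE)
  with Suc have "q \<noteq> 0" "n = degree q" by (auto simp: degree_mult_eq simp del: mult_pCons_left)
  moreover have "poly_act A q (eig_shift A l x) = 0"
    using Suc.prems p by (simp add: poly_act_linear_factor poly_act_eig_shift del: mult_pCons_left)
  ultimately obtain L where L: "set L \<subseteq> spectrum A" "foldr (eig_shift A) L (eig_shift A l x) = 0"
    using Suc.hyps(1) by blast
  show ?case
  proof (cases "l \<in> spectrum A")
    case True
    with L show ?thesis by (intro exI[of _ "L @ [l]"]) auto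
  next
    case False
    from L have "eig_shift A l (foldr (eig_shift A) L x) = 0" by (simp add: foldr_eig_shift_commute1)
    with False have "foldr (eig_shift A) L x = 0"
      by (auto simp: spectrum_def eig_shift_def)
    with L show ?thesis by blast
  qed
qed

text \<open>The vectors x, Ax, ..., A^N x are one more than the real dimension of the space, hence
  linearly dependent over the reals; the coefficients of a relation form \<open>p\<close>.\<close>

lemma exists_poly_act_0: "\<exists>p. p \<noteq> 0 \<and> poly_act A p x = 0"
proof -
  let ?f = "\<lambda>i. mpow A i *v x"
  define N where "N = DIM(complex ^ 'a)"
  obtain c where c: "\<exists>i\<le>N. c i \<noteq> (0::real)" "(\<Sum>i\<le>N. c i *\<^sub>R ?f i) = 0"
  proof (cases "inj_on ?f {..N}")
    case True
    then have "dependent (?f ` {..N})"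
      by (intro dependent_biggerset) (auto simp: card_image N_def)
    then obtain u where u: "\<exists>v\<in>?f ` {..N}. u v \<noteq> 0" "(\<Sum>v\<in>?f ` {..N}. u v *\<^sub>R v) = 0"
      by (subst (asm) dependent_finite) auto
    show ?thesis
      by (rule that[of "\<lambda>i. u (?f i)"]) (use u True in \<open>auto simp: sum.reindex\<close>)
  next
    \<comment> \<open>With repetitions the set of vectors is too small for the dimension count, but
      two equal vectors give a relation directly.\<close>
    case False
    then obtain i j where ij: "i \<le> N" "j \<le> N" "i \<noteq> j" "?f i = ?f j"
      by (auto simp: inj_on_def)
    have "(\<Sum>k\<le>N. (if k = i then 1 else if k = j then - 1 else 0) *\<^sub>R ?f k) =
        (\<Sum>k\<in>{i, j}. (if k = i then 1 else if k = j then - 1 else 0) *\<^sub>R ?f k)"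
      using ij by (intro sum.mono_neutral_right) auto
    also have "\<dots> = 0" using ij by simp
    finally show ?thesis
      using ij by (intro that[of "\<lambda>k. if k = i then 1 else if k = j then - 1 else 0"]) auto
  qed
  define p where "p = (\<Sum>i\<le>N. monom (complex_of_real (c i)) i)"
  have co: "coeff p i = (if i \<le> N then complex_of_real (c i) else 0)" for i
    by (simp add: p_def coeff_sum)
  have "degree p \<le> N"
    by (rule degree_le) (simp add: co)
  then have "poly_act A p x = (\<Sum>i\<le>N. c i *\<^sub>R ?f i)"
    by (simp add: poly_act_bound[of p N] co vec_eq_iff scaleR_conv_of_real[where 'a = complex])
  moreover have "p \<noteq> 0" using c(1) co by (metis coeff_0 of_real_eq_0_iff)
  ultimately show ?thesis using c(2) by auto
qed

text \<open>A substitute for the Cayley-Hamilton theorem: each basis vector is killed by some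
  product of factors A - l with l in the spectrum, and since the factors commute, the concatenation
  of these lists kills every vector.\<close>

lemma annihilating_list:
  fixes A :: "complex ^ 'n ^ 'n"
  obtains L where "set L \<subseteq> spectrum A" "\<And>x. foldr (eig_shift A) L x = 0"
proof -
  have "\<exists>L. set L \<subseteq> spectrum A \<and> (\<forall>b\<in>B. foldr (eig_shift A) L b = 0)" if "finite B" for B
    using that
  proof (induction B)
    case empty
    show ?case by (intro exI[of _ "[]"]) auto
  next
    case (insert b B)
    then obtain L where L: "set L \<subseteq> spectrum A" "\<forall>b\<in>B. foldr (eig_shift A) L b = 0" by blast
    obtain L' where L': "set L' \<subseteq> spectrum A" "foldr (eig_shift A) L' b = 0"
      using exists_poly_act_0 poly_act_0_imp_foldr by metis
    have "foldr (eig_shift A) (L @ L') x = 0" if "x \<in> insert b B" for x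
      using that L L' foldr_eig_shift_commute[of A L L' x] by auto
    with L(1) L'(1) show ?case by (intro exI[of _ "L @ L'"]) auto
  qed
  from this[of "range (\<lambda>i. axis i 1)"] obtain L where
    L: "set L \<subseteq> spectrum A" "\<And>i. foldr (eig_shift A) L (axis i 1) = 0" by auto
  have "foldr (eig_shift A) L x = 0" for x
  proof -
    have "foldr (eig_shift A) L x = foldr (eig_shift A) L (\<Sum>i\<in>UNIV. x $ i *s axis i 1)"
      by (simp add: basis_expansion)
    also have "\<dots> = 0" by (simp add: foldr_eig_shift_sum foldr_eig_shift_vscale L)
    finally show ?thesis .
  qed
  with L(1) show thesis by (rule that)
qed

text \<open>On an eigenvector with eigenvalue \<mu> an annihilating product acts as multiplication
  by the product of the numbers \<mu> - l, so \<mu> occurs in the list. Without eigenvalues the list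
  would be empty and the identity would vanish.\<close>

lemma spectrum_finite_nonempty:
  fixes A :: "complex ^ 'n ^ 'n"
  shows "finite (spectrum A)" "spectrum A \<noteq> {}"
proof -
  obtain L where L: "set L \<subseteq> spectrum A" "\<And>x. foldr (eig_shift A) L x = 0"
    using annihilating_list[of A] by blast
  have "spectrum A \<subseteq> set L"
  proof
    fix \<mu> assume "\<mu> \<in> spectrum A"
    then obtain x where x: "x \<noteq> 0" "A *v x = \<mu> *s x" by (auto simp: spectrum_def)
    have "foldr (eig_shift A) K x = (\<Prod>l\<leftarrow>K. \<mu> - l) *s x" for K
      by (induction K)
         (auto simp: eig_shift_def matrix_vector_mult_vscale x vector_smult_assoc vector_sub_rdistrib algebra_simps)
    with L(2)[of x] x(1) have "(\<Prod>l\<leftarrow>L. \<mu> - l) = 0" by simp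
    then show "\<mu> \<in> set L" by (auto simp: prod_list_zero_iff)
  qed
  then show "finite (spectrum A)" using finite_subset by blast
  show "spectrum A \<noteq> {}"
  proof
    assume "spectrum A = {}"
    with L(1) have "L = []" by auto
    with L(2)[of "axis undefined 1"] show False by simp
  qed
qed

lemma Re_le_k_plus: "l \<in> spectrum A \<Longrightarrow> Re l \<le> k_plus A"
  unfolding k_plus_def by (rule Max_ge) (auto simp: spectrum_finite_nonempty)

text \<open>Induction on the list replaces the Jordan form. \<open>foldr\<close> applies the last
  factor A - l first, so the induction hypothesis covers (A - l) x; and exp(-lt) exp(tA) x has the
  derivative exp(-lt) exp(tA) (A - l) x, which is then integrated.\<close>

lemma mexp_vector_growth:
  fixes A :: "complex ^ 'n ^ 'n"
  assumes "\<epsilon> > 0" "\<And>l. l \<in> set L \<Longrightarrow> Re l \<le> k" "foldr (eig_shift A) L x = 0"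
  shows "\<exists>C\<ge>0. \<forall>t\<ge>0. norm (mexp (t *\<^sub>R A) *v x) \<le> C * exp ((k + \<epsilon>) * t)"
  using assms(2,3)
proof (induction L arbitrary: x rule: rev_induct)
  case Nil
  then show ?case by (intro exI[of _ 0]) auto
next
  case (snoc l L)
  then obtain C where C: "C \<ge> 0" "\<And>t. t \<ge> 0 \<Longrightarrow> norm (mexp (t *\<^sub>R A) *v eig_shift A l x) \<le> C * exp ((k + \<epsilon>) * t)"
    by fastforce
  \<comment> \<open>Since \<open>b\<close> is at least \<epsilon>, integrating
    \<open>C * exp (b * s)\<close> costs only the factor 1/\<epsilon>; no power of \<open>t\<close>,
    as from a Jordan block, appears.\<close>
  define b where "b = k + \<epsilon> - Re l"
  have b: "b \<ge> \<epsilon>" "b > 0" using snoc.prems(1)[of l] assms(1) by (auto simp: b_def)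
  let ?u = "\<lambda>t. exp (- (of_real t * l)) *s (mexp (t *\<^sub>R A) *v x)"
  interpret V: bounded_bilinear "(*s) :: complex \<Rightarrow> complex ^ 'n \<Rightarrow> complex ^ 'n"
    by (rule bounded_bilinear_vscale)
  have du: "(?u has_vector_derivative exp (- (of_real t * l)) *s (mexp (t *\<^sub>R A) *v eig_shift A l x)) (at t within S)" for t S
  proof -
    have 1: "((\<lambda>t. exp (- (of_real t * l))) has_vector_derivative - l * exp (- (of_real t * l))) (at t within S)"
      by (rule has_vector_derivative_real_field) (auto intro!: derivative_eq_intros)
    have 2: "((\<lambda>t. mexp (t *\<^sub>R A) *v x) has_vector_derivative (A ** mexp (t *\<^sub>R A)) *v x) (at t within S)"
      by (rule bounded_linear.has_vector_derivative[OF bounded_bilinear.bounded_linear_left[OF bounded_bilinear_matrix_vector]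
          mexp_has_vector_derivative])
    have "exp (- (of_real t * l)) *s ((A ** mexp (t *\<^sub>R A)) *v x) + (- l * exp (- (of_real t * l))) *s (mexp (t *\<^sub>R A) *v x)
      = exp (- (of_real t * l)) *s (mexp (t *\<^sub>R A) *v eig_shift A l x)"
      unfolding eig_shift_def mexp_commute
      by (simp add: matrix_vector_mult_diff_distrib matrix_vector_mult_vscale vector_ssub_ldistrib
          matrix_vector_mul_assoc vector_smult_assoc mult.commute)
    with V.has_vector_derivative[OF 1 2] show ?thesis by simp
  qed
  have "norm (mexp (t *\<^sub>R A) *v x) \<le> (norm x + C / \<epsilon>) * exp ((k + \<epsilon>) * t)" if t: "t \<ge> 0" for t
  proof -
    let ?\<phi> = "\<lambda>t. C / b * exp (b * t)"
    have "norm (?u t - ?u 0) \<le> ?\<phi> t - ?\<phi> 0"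
    proof (cases "t = 0")
      case False
      show ?thesis
      proof (rule differentiable_bound_general[where f = ?u and \<phi> = ?\<phi> and
            f' = "\<lambda>t. exp (- (of_real t * l)) *s (mexp (t *\<^sub>R A) *v eig_shift A l x)" and \<phi>' = "\<lambda>t. C * exp (b * t)"])
        show "0 < t" using False t by simp
        show "continuous_on {0..t} ?u"
          using du by (intro continuous_on_vector_derivative) blast
        show "continuous_on {0..t} ?\<phi>" by (intro continuous_intros)
        fix s :: real assume s: "0 < s" "s < t"
        show "(?u has_vector_derivative exp (- (of_real s * l)) *s (mexp (s *\<^sub>R A) *v eig_shift A l x)) (at s)"
          using du[of s UNIV] by simp
        show "(?\<phi> has_vector_derivative C * exp (b * s)) (at s)"
          using b by (auto simp flip: has_real_derivative_iff_has_vector_derivative intro!: derivative_eq_intros)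
        have "norm (exp (- (of_real s * l)) *s (mexp (s *\<^sub>R A) *v eig_shift A l x))
            \<le> exp (- (s * Re l)) * (C * exp ((k + \<epsilon>) * s))"
          using C(2)[of s] s by (auto simp: norm_vscale)
        also have "\<dots> = C * exp (b * s)"
          by (simp add: b_def algebra_simps flip: exp_add)
        finally show "norm (exp (- (of_real s * l)) *s (mexp (s *\<^sub>R A) *v eig_shift A l x)) \<le> C * exp (b * s)" .
      qed
    qed auto
    also have "\<dots> \<le> C / \<epsilon> * exp (b * t)"
    proof -
      have "C / b * exp (b * t) \<le> C / \<epsilon> * exp (b * t)"
        using b assms(1) C(1) by (intro mult_right_mono divide_left_mono) auto
      moreover have "C / b * exp (b * 0) \<ge> 0" using b C(1) by auto
      ultimately show ?thesis by linarith
    qed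
    finally have "norm (?u t) \<le> norm x + C / \<epsilon> * exp (b * t)"
      using norm_triangle_sub[of "?u t" "?u 0"] by simp
    also have "\<dots> \<le> norm x * exp (b * t) + C / \<epsilon> * exp (b * t)"
      using b t by (auto simp: mult_le_cancel_left1)
    finally have "exp (- (t * Re l)) * norm (mexp (t *\<^sub>R A) *v x) \<le> (norm x + C / \<epsilon>) * exp (b * t)"
      by (simp add: norm_vscale algebra_simps)
    then have "exp (t * Re l) * (exp (- (t * Re l)) * norm (mexp (t *\<^sub>R A) *v x)) \<le> exp (t * Re l) * ((norm x + C / \<epsilon>) * exp (b * t))"
      by (intro mult_left_mono) auto
    moreover have "exp (t * Re l) * ((norm x + C / \<epsilon>) * exp (b * t)) = (norm x + C / \<epsilon>) * exp ((k + \<epsilon>) * t)"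
      by (simp add: b_def algebra_simps flip: exp_add)
    moreover have "exp (t * Re l) * (exp (- (t * Re l)) * y) = y" for y
      by (simp add: mult.assoc[symmetric] flip: exp_add)
    ultimately show ?thesis by simp
  qed
  with C(1) assms(1) show ?case by (intro exI[of _ "norm x + C / \<epsilon>"]) auto
qed

lemma mexp_growth:
  fixes A :: "complex ^ 'n ^ 'n"
  assumes "\<epsilon> > 0"
  obtains C where "C > 0" "\<And>t. t \<ge> 0 \<Longrightarrow> norm (mexp (t *\<^sub>R A)) \<le> C * exp ((k_plus A + \<epsilon>) * t)"
proof -
  obtain L where L: "set L \<subseteq> spectrum A" "\<And>x. foldr (eig_shift A) L x = 0"
    using annihilating_list[of A] by blast
  have "\<forall>i. \<exists>C\<ge>0. \<forall>t\<ge>0. norm (mexp (t *\<^sub>R A) *v axis i 1) \<le> C * exp ((k_plus A + \<epsilon>) * t)"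
    using mexp_vector_growth[OF assms, of L "k_plus A" A] L Re_le_k_plus by blast
  then obtain c where c: "\<And>i. c i \<ge> 0" "\<And>i t. t \<ge> 0 \<Longrightarrow> norm (mexp (t *\<^sub>R A) *v axis i 1) \<le> c i * exp ((k_plus A + \<epsilon>) * t)"
    by metis
  show thesis
  proof
    show "1 + sum c UNIV > 0" using c(1) by (simp add: add_pos_nonneg sum_nonneg)
    fix t :: real assume t: "t \<ge> 0"
    have "norm (mexp (t *\<^sub>R A)) \<le> (\<Sum>i\<in>UNIV. c i * exp ((k_plus A + \<epsilon>) * t))"
      by (rule order_trans[OF norm_matrix_le_sum_axis]) (intro sum_mono c t)
    also have "\<dots> = sum c UNIV * exp ((k_plus A + \<epsilon>) * t)"
      by (rule sum_distrib_right[symmetric])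
    also have "\<dots> \<le> (1 + sum c UNIV) * exp ((k_plus A + \<epsilon>) * t)"
      by (intro mult_right_mono) auto
    finally show "norm (mexp (t *\<^sub>R A)) \<le> (1 + sum c UNIV) * exp ((k_plus A + \<epsilon>) * t)" .
  qed
qed

section \<open>Absolute continuity\<close>

text \<open>A finite set of pairs, rather than an indexed family, fits the sums over tagged
  divisions. Pairs with equal endpoints are allowed.\<close>

definition nonoverlapping :: "real \<Rightarrow> real \<Rightarrow> (real \<times> real) set \<Rightarrow> bool" where
  "nonoverlapping a b P \<longleftrightarrow> finite P \<and> (\<forall>s t. (s, t) \<in> P \<longrightarrow> a \<le> s \<and> s \<le> t \<and> t \<le> b) \<and>
     (\<forall>s t s' t'. (s, t) \<in> P \<longrightarrow> (s', t') \<in> P \<longrightarrow> (s, t) \<noteq> (s', t') \<longrightarrow> {s<..<t} \<inter> {s'<..<t'} = {})"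

text \<open>Absolute continuity is expressed through the increments \<open>d s t\<close>, so that it passes to anything
  whose increments are dominated by sums of such \<open>d\<close>.\<close>

definition ac_dist :: "real \<Rightarrow> real \<Rightarrow> (real \<Rightarrow> real \<Rightarrow> real) \<Rightarrow> bool" where
  "ac_dist a b d \<longleftrightarrow> (\<forall>\<epsilon>>0. \<exists>\<delta>>0. \<forall>P. nonoverlapping a b P \<longrightarrow>
     (\<Sum>(s, t)\<in>P. t - s) < \<delta> \<longrightarrow> (\<Sum>(s, t)\<in>P. d s t) < \<epsilon>)"

lemma ac_distE:
  assumes "ac_dist a b d" "\<epsilon> > 0"
  obtains \<delta> where "\<delta> > 0"
    "\<And>P. nonoverlapping a b P \<Longrightarrow> (\<Sum>(s, t)\<in>P. t - s) < \<delta> \<Longrightarrow> (\<Sum>(s, t)\<in>P. d s t) < \<epsilon>"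
  using assms unfolding ac_dist_def by blast

lemma ac_distI:
  assumes "\<And>\<epsilon>. \<epsilon> > 0 \<Longrightarrow> \<exists>\<delta>>0. \<forall>P. nonoverlapping a b P \<longrightarrow>
     (\<Sum>(s, t)\<in>P. t - s) < \<delta> \<longrightarrow> (\<Sum>(s, t)\<in>P. d s t) < \<epsilon>"
  shows "ac_dist a b d"
  using assms unfolding ac_dist_def by blast

lemma ac_dist_le:
  assumes "ac_dist a b d" "\<And>s t. a \<le> s \<Longrightarrow> s \<le> t \<Longrightarrow> t \<le> b \<Longrightarrow> d' s t \<le> d s t"
  shows "ac_dist a b d'"
proof (rule ac_distI)
  fix \<epsilon> :: real assume "\<epsilon> > 0"
  with assms(1) obtain \<delta> where \<delta>: "\<delta> > 0"
    "\<And>P. nonoverlapping a b P \<Longrightarrow> (\<Sum>(s, t)\<in>P. t - s) < \<delta> \<Longrightarrow> (\<Sum>(s, t)\<in>P. d s t) < \<epsilon>"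
    using ac_distE by blast
  have "(\<Sum>(s, t)\<in>P. d' s t) \<le> (\<Sum>(s, t)\<in>P. d s t)" if "nonoverlapping a b P" for P
    using that assms(2) by (intro sum_mono) (auto simp: nonoverlapping_def)
  with \<delta> show "\<exists>\<delta>>0. \<forall>P. nonoverlapping a b P \<longrightarrow> (\<Sum>(s, t)\<in>P. t - s) < \<delta> \<longrightarrow> (\<Sum>(s, t)\<in>P. d' s t) < \<epsilon>"
    by (meson order_le_less_trans)
qed

lemma ac_dist_add:
  assumes "ac_dist a b d" "ac_dist a b d'"
  shows "ac_dist a b (\<lambda>s t. d s t + d' s t)"
proof (rule ac_distI)
  fix \<epsilon> :: real assume "\<epsilon> > 0"
  then have e: "\<epsilon> / 2 > 0" by simp
  obtain \<delta> where \<delta>: "\<delta> > 0"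
    "\<And>P. nonoverlapping a b P \<Longrightarrow> (\<Sum>(s, t)\<in>P. t - s) < \<delta> \<Longrightarrow> (\<Sum>(s, t)\<in>P. d s t) < \<epsilon> / 2"
    using ac_distE[OF assms(1) e] by blast
  obtain \<delta>' where \<delta>': "\<delta>' > 0"
    "\<And>P. nonoverlapping a b P \<Longrightarrow> (\<Sum>(s, t)\<in>P. t - s) < \<delta>' \<Longrightarrow> (\<Sum>(s, t)\<in>P. d' s t) < \<epsilon> / 2"
    using ac_distE[OF assms(2) e] by blast
  show "\<exists>\<delta>>0. \<forall>P. nonoverlapping a b P \<longrightarrow> (\<Sum>(s, t)\<in>P. t - s) < \<delta> \<longrightarrow> (\<Sum>(s, t)\<in>P. d s t + d' s t) < \<epsilon>"
  proof (intro exI[of _ "min \<delta> \<delta>'"] conjI allI impI)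
    fix P assume "nonoverlapping a b P" "(\<Sum>(s, t)\<in>P. t - s) < min \<delta> \<delta>'"
    then have "(\<Sum>(s, t)\<in>P. d s t) < \<epsilon> / 2" "(\<Sum>(s, t)\<in>P. d' s t) < \<epsilon> / 2"
      using \<delta>(2) \<delta>'(2) by auto
    then show "(\<Sum>(s, t)\<in>P. d s t + d' s t) < \<epsilon>"
      by (simp add: case_prod_unfold sum.distrib)
  qed (use \<delta>(1) \<delta>'(1) in auto)
qed

lemma ac_dist_cmult:
  assumes "ac_dist a b d" "C \<ge> 0"
  shows "ac_dist a b (\<lambda>s t. C * d s t)"
proof (cases "C = 0")
  case True
  then show ?thesis by (auto simp: ac_dist_def intro!: exI[of _ 1])
next
  case False
  with assms have C: "C > 0" by simp
  show ?thesis
  proof (rule ac_distI)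
    fix \<epsilon> :: real assume "\<epsilon> > 0"
    with C have e: "\<epsilon> / C > 0" by simp
    obtain \<delta> where \<delta>: "\<delta> > 0"
      "\<And>P. nonoverlapping a b P \<Longrightarrow> (\<Sum>(s, t)\<in>P. t - s) < \<delta> \<Longrightarrow> (\<Sum>(s, t)\<in>P. d s t) < \<epsilon> / C"
      using ac_distE[OF assms(1) e] by blast
    have "(\<Sum>(s, t)\<in>P. C * d s t) < \<epsilon>" if "nonoverlapping a b P" "(\<Sum>(s, t)\<in>P. t - s) < \<delta>" for P
      using \<delta>(2)[OF that] C by (simp add: case_prod_unfold sum_distrib_left[symmetric] field_simps)
    with \<delta>(1) show "\<exists>\<delta>>0. \<forall>P. nonoverlapping a b P \<longrightarrow> (\<Sum>(s, t)\<in>P. t - s) < \<delta> \<longrightarrow> (\<Sum>(s, t)\<in>P. C * d s t) < \<epsilon>"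
      by blast
  qed
qed

lemma ac_dist_length: "ac_dist a b (\<lambda>s t. t - s)"
  unfolding ac_dist_def by blast

lemma ac_dist_sum:
  assumes "\<And>i. i \<in> I \<Longrightarrow> ac_dist a b (d i)"
  shows "ac_dist a b (\<lambda>s t. \<Sum>i\<in>I. d i s t)"
  using assms
proof (induction I rule: infinite_finite_induct)
  case (insert i I)
  then show ?case by (simp add: ac_dist_add)
qed (auto simp: ac_dist_def intro!: exI[of _ 1])

lemma ac_dist_lipschitz:
  assumes "\<And>s t. a \<le> s \<Longrightarrow> s \<le> t \<Longrightarrow> t \<le> b \<Longrightarrow> d s t \<le> L * (t - s)"
  shows "ac_dist a b d"
proof (rule ac_dist_le[OF ac_dist_cmult[OF ac_dist_length, of "\<bar>L\<bar>"]])
  fix s t :: real assume st: "a \<le> s" "s \<le> t" "t \<le> b"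
  then have "L * (t - s) \<le> \<bar>L\<bar> * (t - s)" by (intro mult_right_mono) auto
  with assms[OF st] show "d s t \<le> \<bar>L\<bar> * (t - s)" by linarith
qed auto

text \<open>Passes from intervals indexed by natural numbers to sets of intervals by enumerating the
  set; uniformity over \<open>K\<close> is given up by fixing one member.\<close>

lemma unif_loc_abs_cont_imp_ac_dist:
  assumes "unif_loc_abs_cont K d" "z \<in> K" "0 \<le> a"
  shows "ac_dist a b (d z)"
proof (rule ac_distI)
  fix \<epsilon> :: real assume e: "\<epsilon> > 0"
  show "\<exists>\<delta>>0. \<forall>P. nonoverlapping a b P \<longrightarrow> (\<Sum>(s, t)\<in>P. t - s) < \<delta> \<longrightarrow> (\<Sum>(s, t)\<in>P. d z s t) < \<epsilon>"
  proof (cases "b \<ge> 0")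
    case False
    have "(\<Sum>(s, t)\<in>P. d z s t) < \<epsilon>" if "nonoverlapping a b P" for P
    proof -
      have "p \<notin> P" for p
        using that False assms(3) by (cases p) (force simp: nonoverlapping_def)
      then have "P = {}" by blast
      with e show ?thesis by simp
    qed
    then show ?thesis by (intro exI[of _ 1]) auto
  next
    case True
    then obtain \<delta> where \<delta>: "\<delta> > 0" "\<And>(N::nat) u v. (\<forall>i<N. 0 \<le> u i \<and> u i \<le> v i \<and> v i \<le> b) \<Longrightarrow>
       (\<forall>i<N. \<forall>j<N. i \<noteq> j \<longrightarrow> {u i<..<v i} \<inter> {u j<..<v j} = {}) \<Longrightarrow>
       (\<Sum>i<N. v i - u i) < \<delta> \<Longrightarrow> (\<forall>z\<in>K. (\<Sum>i<N. d z (u i) (v i)) < \<epsilon>)"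
      using assms(1)[unfolded unif_loc_abs_cont_def, rule_format, OF True e] by blast
    have "(\<Sum>(s, t)\<in>P. d z s t) < \<epsilon>" if P: "nonoverlapping a b P" "(\<Sum>(s, t)\<in>P. t - s) < \<delta>" for P
    proof -
      have "finite P" using P(1) by (simp add: nonoverlapping_def)
      then obtain g where g: "bij_betw g {..<card P} P"
        using ex_bij_betw_nat_finite[of P] by (auto simp: atLeast0LessThan)
      have gP: "(fst (g i), snd (g i)) \<in> P" if "i < card P" for i
        using g that by (auto simp: bij_betw_def)
      have s: "(\<Sum>i<card P. F (fst (g i)) (snd (g i))) = (\<Sum>(s, t)\<in>P. F s t)" for F :: "real \<Rightarrow> real \<Rightarrow> real"
        using sum.reindex_bij_betw[OF g, of "\<lambda>(s, t). F s t"] by (simp add: case_prod_unfold)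
      have "\<forall>z\<in>K. (\<Sum>i<card P. d z (fst (g i)) (snd (g i))) < \<epsilon>"
      proof (rule \<delta>(2); (intro allI impI)?)
        fix i assume "i < card P"
        from gP[OF this] P(1) assms(3) show "0 \<le> fst (g i) \<and> fst (g i) \<le> snd (g i) \<and> snd (g i) \<le> b"
          unfolding nonoverlapping_def by (meson order_trans)
      next
        fix i j assume ij: "i < card P" "j < card P" "i \<noteq> j"
        then have "g i \<noteq> g j" using g by (auto simp: bij_betw_def inj_on_def)
        then have "(fst (g i), snd (g i)) \<noteq> (fst (g j), snd (g j))" by simp
        with gP[OF ij(1)] gP[OF ij(2)] P(1)
        show "{fst (g i)<..<snd (g i)} \<inter> {fst (g j)<..<snd (g j)} = {}"
          unfolding nonoverlapping_def by meson
      next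
        show "(\<Sum>i<card P. snd (g i) - fst (g i)) < \<delta>"
          using P(2) s[of "\<lambda>s t. t - s"] by simp
      qed
      with assms(2) show ?thesis using s[of "d z"] by auto
    qed
    with \<delta>(1) show ?thesis by blast
  qed
qed

text \<open>Replaces the fundamental theorem of calculus for absolutely continuous functions.  In a tagged
  division fine for a suitable gauge, the intervals tagged outside \<open>N\<close> are controlled by the
  derivative, and those tagged in \<open>N\<close> lie in an open set of small measure.\<close>

lemma ac_nonincreasing:
  fixes f :: "real \<Rightarrow> real"
  assumes "a \<le> b" and ac: "ac_dist a b (\<lambda>s t. \<bar>f t - f s\<bar>)" and N: "negligible N"
    and f': "\<And>t. t \<in> {a..b} - N \<Longrightarrow> \<exists>D\<le>0. (f has_vector_derivative D) (at t within {a..b})"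
  shows "f b \<le> f a"
proof -
  have "f b - f a \<le> \<epsilon> * (b - a) + \<epsilon>" if e: "\<epsilon> > 0" for \<epsilon>
  proof -
    obtain \<delta> where \<delta>: "\<delta> > 0"
      "\<And>P. nonoverlapping a b P \<Longrightarrow> (\<Sum>(s, t)\<in>P. t - s) < \<delta> \<Longrightarrow> (\<Sum>(s, t)\<in>P. \<bar>f t - f s\<bar>) < \<epsilon>"
      using ac_distE[OF ac e] by blast
    have NL: "N \<in> lmeasurable" "measure lebesgue N = 0"
      using N by (auto simp: negligible_imp_measurable negligible_imp_measure0)
    obtain U where U: "open U" "N \<subseteq> U" and UN: "U - N \<in> lmeasurable" "emeasure lebesgue (U - N) < ennreal \<delta>"
      using sets_lebesgue_outer_open[OF fmeasurableD[OF NL(1)] \<delta>(1)] by blast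
    have UU: "(U - N) \<union> N = U" using U(2) by blast
    have UL: "U \<in> lmeasurable"
      using fmeasurable.Un[OF UN(1) NL(1)] unfolding UU .
    have "measure lebesgue U \<le> measure lebesgue (U - N) + measure lebesgue N"
      using measure_Un_le[OF fmeasurableD[OF UN(1)] fmeasurableD[OF NL(1)]] unfolding UU .
    moreover have "measure lebesgue (U - N) < \<delta>"
      using UN(2) unfolding emeasure_eq_measure2[OF UN(1)] by (subst (asm) ennreal_less_iff) auto
    ultimately have Um: "measure lebesgue U < \<delta>" using NL(2) by linarith
    \<comment> \<open>The increment over an interval around the tag \<open>t\<close> is split at
      \<open>t\<close>; on both sides the derivative contributes a nonpositive amount, which leaves
      the error term.\<close>
    have "\<exists>r>0. \<forall>y\<in>{a..b}. \<forall>x\<in>{a..b}. x \<le> t \<and> t \<le> y \<and> \<bar>x - t\<bar> < r \<and> \<bar>y - t\<bar> < r \<longrightarrow> f y - f x \<le> \<epsilon> * (y - x)"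
      if t: "t \<in> {a..b} - N" for t
    proof -
      obtain D where D: "D \<le> 0" "(f has_vector_derivative D) (at t within {a..b})"
        using f'[OF t] by blast
      then obtain r where r: "r > 0" "\<And>y. y \<in> {a..b} \<Longrightarrow> \<bar>y - t\<bar> < r \<Longrightarrow> \<bar>f y - f t - (y - t) * D\<bar> \<le> \<epsilon> * \<bar>y - t\<bar>"
        unfolding has_vector_derivative_def has_derivative_within_alt using e by fastforce
      show ?thesis
      proof (intro exI[of _ r] conjI ballI impI r(1))
        fix x y assume xy: "y \<in> {a..b}" "x \<in> {a..b}" "x \<le> t \<and> t \<le> y \<and> \<bar>x - t\<bar> < r \<and> \<bar>y - t\<bar> < r"
        have "f y - f t \<le> (y - t) * D + \<epsilon> * (y - t)" "f t - f x \<le> (t - x) * D + \<epsilon> * (t - x)"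
          using r(2)[of y] r(2)[of x] xy by (auto simp: abs_le_iff algebra_simps)
        moreover have "(y - t) * D \<le> 0" "(t - x) * D \<le> 0"
          using xy D(1) by (auto intro: mult_nonneg_nonpos)
        ultimately show "f y - f x \<le> \<epsilon> * (y - x)" by (simp add: algebra_simps)
      qed
    qed
    then obtain r where r: "\<And>t. t \<in> {a..b} - N \<Longrightarrow> r t > 0"
      "\<And>t x y. t \<in> {a..b} - N \<Longrightarrow> y \<in> {a..b} \<Longrightarrow> x \<in> {a..b} \<Longrightarrow> x \<le> t \<Longrightarrow> t \<le> y \<Longrightarrow> \<bar>x - t\<bar> < r t \<Longrightarrow> \<bar>y - t\<bar> < r t
         \<Longrightarrow> f y - f x \<le> \<epsilon> * (y - x)"
      by metis
    define \<gamma> where "\<gamma> t = (if t \<in> N then U else if t \<in> {a..b} then ball t (r t) else ball t 1)" for t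
    have "gauge \<gamma>"
      using U r(1) by (auto simp: gauge_def \<gamma>_def)
    then obtain p where p: "p tagged_division_of {a..b}" "\<gamma> fine p"
      using fine_division_exists_real by blast
    note pD = tagged_division_ofD[OF p(1)]
    have pK: "\<exists>u v. K = {u..v} \<and> u \<le> x \<and> x \<le> v \<and> a \<le> u \<and> v \<le> b \<and> Inf K = u \<and> Sup K = v"
      if xK: "(x, K) \<in> p" for x K
    proof -
      obtain u v where uv: "K = cbox u v" using pD(4)[OF xK] by blast
      have "x \<in> K" "K \<subseteq> {a..b}" using pD(2,3)[OF xK] by auto
      then show ?thesis using uv by (intro exI[of _ u] exI[of _ v]) auto
    qed
    \<comment> \<open>Degenerate intervals, whose increments vanish, are kept out of
      \<open>p1\<close>: nondegenerate ones with disjoint interiors are determined by their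
      endpoints, so passing to endpoint pairs merges no terms.\<close>
    define p1 where "p1 = {(x, K) \<in> p. x \<in> N \<and> Inf K < Sup K}"
    have p1p: "p1 \<subseteq> p" by (auto simp: p1_def)
    have fin: "finite p" "finite p1" using pD(1) p1p finite_subset by auto
    have inj: "inj_on (\<lambda>(x, K). (Inf K, Sup K)) p1" and dis:
      "\<And>x K x' K'. (x, K) \<in> p1 \<Longrightarrow> (x', K') \<in> p1 \<Longrightarrow> (x, K) \<noteq> (x', K') \<Longrightarrow> {Inf K<..<Sup K} \<inter> {Inf K'<..<Sup K'} = {}"
    proof -
      show d: "{Inf K<..<Sup K} \<inter> {Inf K'<..<Sup K'} = {}"
        if *: "(x, K) \<in> p1" "(x', K') \<in> p1" "(x, K) \<noteq> (x', K')" for x K x' K'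
      proof -
        have "interior K \<inter> interior K' = {}"
          using pD(5)[of x K x' K'] * p1p by auto
        moreover have "interior K = {Inf K<..<Sup K}" if xK: "(x, K) \<in> p1" for x K
        proof -
          obtain u v where "K = {u..v}" "Inf K = u" "Sup K = v"
            using pK[of x K] xK p1p by fast
          then show ?thesis by (simp add: interior_atLeastAtMost_real)
        qed
        ultimately show ?thesis using *(1,2) by simp
      qed
      show "inj_on (\<lambda>(x, K). (Inf K, Sup K)) p1"
      proof (rule inj_onI, clarify)
        fix x K x' K' assume *: "(x, K) \<in> p1" "(x', K') \<in> p1" "Inf K = Inf K'" "Sup K = Sup K'"
        have "{Inf K<..<Sup K} \<noteq> {}" using *(1) by (auto simp: p1_def)
        then show "x = x' \<and> K = K'" using d[of x K x' K'] * by auto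
      qed
    qed
    have injsnd: "inj_on snd p1"
      by (rule inj_on_imageI2[of "\<lambda>K. (Inf K, Sup K)"]) (use inj in \<open>simp add: o_def case_prod_unfold\<close>)
    have "(\<Sum>(x, K)\<in>p1. Sup K - Inf K) < \<delta>"
    proof -
      have tp: "p1 tagged_partial_division_of {a..b}"
        using p(1) p1p tagged_partial_division_subset tagged_division_of_def by blast
      have div: "snd ` p1 division_of \<Union>(snd ` p1)"
        by (rule partial_division_of_tagged_division[OF tp])
      have "(\<Sum>(x, K)\<in>p1. Sup K - Inf K) = (\<Sum>(x, K)\<in>p1. measure lebesgue K)"
      proof (rule sum.cong[OF refl], clarify)
        fix x K assume "(x, K) \<in> p1"
        then obtain u v where "K = {u..v}" "u \<le> v" "Inf K = u" "Sup K = v"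
          using p1p pK[of x K] by (metis order_trans subsetD)
        then show "Sup K - Inf K = measure lebesgue K" by simp
      qed
      also have "\<dots> = (\<Sum>K\<in>snd ` p1. measure lebesgue K)"
        using injsnd by (simp add: sum.reindex case_prod_unfold)
      also have "\<dots> = measure lebesgue (\<Union>(snd ` p1))"
        by (rule content_division[OF div])
      also have "\<dots> \<le> measure lebesgue U"
      proof (rule measure_mono_fmeasurable)
        show "\<Union>(snd ` p1) \<subseteq> U"
        proof
          fix y assume "y \<in> \<Union>(snd ` p1)"
          then obtain x K where xK: "(x, K) \<in> p1" "y \<in> K" by auto
          then have "K \<subseteq> \<gamma> x" "x \<in> N" using fineD[OF p(2), of x K] p1p by (auto simp: p1_def)
          with xK show "y \<in> U" by (auto simp: \<gamma>_def)
        qed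
        show "\<Union>(snd ` p1) \<in> sets lebesgue"
          using div by (metis fmeasurableD lmeasurable_division)
      qed (rule UL)
      finally show ?thesis using Um by linarith
    qed
    then have "(\<Sum>(s, t)\<in>(\<lambda>(x, K). (Inf K, Sup K)) ` p1. \<bar>f t - f s\<bar>) < \<epsilon>"
    proof (intro \<delta>(2))
      have "a \<le> Inf K \<and> Inf K \<le> Sup K \<and> Sup K \<le> b" if "(x, K) \<in> p1" for x K
        using pK[of x K] that p1p by fastforce
      then show "nonoverlapping a b ((\<lambda>(x, K). (Inf K, Sup K)) ` p1)"
        using fin dis unfolding nonoverlapping_def by (auto; metis)
      show "(\<Sum>(x, K)\<in>p1. Sup K - Inf K) < \<delta> \<Longrightarrow> (\<Sum>(s, t)\<in>(\<lambda>(x, K). (Inf K, Sup K)) ` p1. t - s) < \<delta>"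
        by (simp add: sum.reindex[OF inj[unfolded case_prod_unfold]] case_prod_unfold)
    qed
    then have "(\<Sum>(x, K)\<in>p1. \<bar>f (Sup K) - f (Inf K)\<bar>) < \<epsilon>"
      by (simp add: sum.reindex[OF inj[unfolded case_prod_unfold]] case_prod_unfold)
    moreover have "(\<Sum>(x, K)\<in>p1. f (Sup K) - f (Inf K)) \<le> (\<Sum>(x, K)\<in>p1. \<bar>f (Sup K) - f (Inf K)\<bar>)"
      by (intro sum_mono) auto
    ultimately have 1: "(\<Sum>(x, K)\<in>p1. f (Sup K) - f (Inf K)) \<le> \<epsilon>" by linarith
    have "(\<Sum>(x, K)\<in>p - p1. f (Sup K) - f (Inf K)) \<le> (\<Sum>(x, K)\<in>p - p1. \<epsilon> * measure lborel K)"
    proof (rule sum_mono, clarify)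
      fix x K assume *: "(x, K) \<in> p" "(x, K) \<notin> p1"
      then obtain u v where uv: "K = {u..v}" "u \<le> x" "x \<le> v" "a \<le> u" "v \<le> b" "Inf K = u" "Sup K = v"
        using pK by blast
      show "f (Sup K) - f (Inf K) \<le> \<epsilon> * measure lborel K"
      proof (cases "x \<in> N")
        case True
        with * uv have "u = v" by (auto simp: p1_def)
        with uv show ?thesis by simp
      next
        case False
        have "\<gamma> x = ball x (r x)" using uv False by (simp add: \<gamma>_def)
        then have "K \<subseteq> ball x (r x)" using fineD[OF p(2) *(1)] by simp
        moreover have "u \<in> K" "v \<in> K" using uv(1-3) by simp_all
        ultimately have "dist x u < r x" "dist x v < r x" by (meson mem_ball subsetD)+
        then have "\<bar>u - x\<bar> < r x" "\<bar>v - x\<bar> < r x" by (simp_all add: dist_real_def abs_minus_commute)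
        then have "f v - f u \<le> \<epsilon> * (v - u)"
          using r(2)[of x v u] uv False by auto
        with uv show ?thesis by simp
      qed
    qed
    also have "\<dots> \<le> (\<Sum>(x, K)\<in>p. \<epsilon> * measure lborel K)"
      using fin e by (intro sum_mono2) auto
    also have "\<dots> = \<epsilon> * (b - a)"
      using additive_content_tagged_division[of p a b] p(1) \<open>a \<le> b\<close>
      by (simp add: case_prod_unfold flip: sum_distrib_left)
    finally have 2: "(\<Sum>(x, K)\<in>p - p1. f (Sup K) - f (Inf K)) \<le> \<epsilon> * (b - a)" .
    have "f b - f a = (\<Sum>(x, K)\<in>p. f (Sup K) - f (Inf K))"
      using additive_tagged_division_1[OF \<open>a \<le> b\<close> p(1), of f] by simp
    also have "\<dots> = (\<Sum>(x, K)\<in>p - p1. f (Sup K) - f (Inf K)) + (\<Sum>(x, K)\<in>p1. f (Sup K) - f (Inf K))"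
      by (rule sum.subset_diff[OF p1p fin(1)])
    finally show ?thesis using 1 2 by linarith
  qed
  then have *: "f b - f a \<le> \<epsilon> * (b - a + 1)" if "\<epsilon> > 0" for \<epsilon>
    using that by (simp add: algebra_simps)
  show ?thesis
  proof (rule ccontr)
    assume "\<not> f b \<le> f a"
    then have D: "f b - f a > 0" by simp
    define B where "B = b - a + 1"
    have B: "B > 0" using \<open>a \<le> b\<close> by (simp add: B_def)
    have "f b - f a \<le> (f b - f a) / (2 * B) * B"
      using *[of "(f b - f a) / (2 * B)"] D B unfolding B_def by simp
    also have "\<dots> = (f b - f a) / 2" using B by simp
    finally show False using D by simp
  qed
qed

lemma ac_dist_C1:
  fixes f :: "real \<Rightarrow> 'a::real_normed_vector"
  assumes f: "\<And>t. t \<in> {a..b} \<Longrightarrow> (f has_vector_derivative f' t) (at t within {a..b})"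
    and cont: "continuous_on {a..b} f'"
  shows "ac_dist a b (\<lambda>s t. norm (f t - f s))"
proof -
  have "bounded (f' ` {a..b})"
    by (rule compact_imp_bounded[OF compact_continuous_image[OF cont compact_Icc]])
  then obtain L where "\<forall>y\<in>f' ` {a..b}. norm y \<le> L"
    unfolding bounded_iff ..
  then have L: "norm (f' t) \<le> L" if "t \<in> {a..b}" for t
    using that by (simp del: atLeastAtMost_iff)
  show ?thesis
  proof (rule ac_dist_lipschitz)
    fix s t assume st: "a \<le> s" "s \<le> t" "t \<le> b"
    have "norm (f t - f s) \<le> L * norm (t - s)"
    proof (rule differentiable_bound[of "{a..b}"])
      fix x assume x: "x \<in> {a..b}"
      show "(f has_derivative (\<lambda>h. h *\<^sub>R f' x)) (at x within {a..b})"
        using f[OF x] by (simp add: has_vector_derivative_def)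
      show "onorm (\<lambda>h. h *\<^sub>R f' x) \<le> L"
      proof (rule onorm_le)
        fix h :: real
        have "norm (f' x) * \<bar>h\<bar> \<le> L * \<bar>h\<bar>" using L[OF x] by (intro mult_right_mono) auto
        then show "norm (h *\<^sub>R f' x) \<le> L * norm h" by (simp add: mult.commute)
      qed
    qed (use st in auto)
    with st show "norm (f t - f s) \<le> L * (t - s)" by simp
  qed
qed

text \<open>Pairing with the unit vector \<open>c\<close> in the direction of
  \<open>f b - f a\<close> (or with 0 if this vanishes) reduces the claim to a scalar one: the
  pairing minus \<phi> is nonincreasing.\<close>

lemma ac_bound_by_derivative:
  fixes f :: "real \<Rightarrow> 'a::real_inner"
  assumes "a \<le> b" and ac: "ac_dist a b (\<lambda>s t. norm (f t - f s))" and N: "negligible N"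
    and f': "\<And>t. t \<in> {a..b} - N \<Longrightarrow> \<exists>D. norm D \<le> \<phi>' t \<and> (f has_vector_derivative D) (at t within {a..b})"
    and \<phi>: "\<And>t. t \<in> {a..b} \<Longrightarrow> (\<phi> has_vector_derivative \<phi>' t) (at t within {a..b})"
    and cont: "continuous_on {a..b} \<phi>'"
  shows "norm (f b - f a) \<le> \<phi> b - \<phi> a"
proof -
  define c where "c = (if f b = f a then 0 else (f b - f a) /\<^sub>R norm (f b - f a))"
  have c: "norm c \<le> 1" "(f b - f a) \<bullet> c = norm (f b - f a)"
    by (auto simp: c_def norm_divide dot_square_norm power2_eq_square)
  have ac\<phi>: "ac_dist a b (\<lambda>s t. norm (\<phi> t - \<phi> s))"
    by (rule ac_dist_C1[OF \<phi> cont])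
  let ?g = "\<lambda>t. f t \<bullet> c - \<phi> t"
  have "?g b \<le> ?g a"
  proof (rule ac_nonincreasing[OF \<open>a \<le> b\<close> _ N])
    show "ac_dist a b (\<lambda>s t. \<bar>f t \<bullet> c - \<phi> t - (f s \<bullet> c - \<phi> s)\<bar>)"
    proof (rule ac_dist_le[OF ac_dist_add[OF ac ac\<phi>]])
      fix s t assume st: "a \<le> s" "s \<le> t" "t \<le> b"
      have "\<bar>(f t - f s) \<bullet> c\<bar> \<le> norm (f t - f s) * 1"
        using c(1) by (intro order_trans[OF Cauchy_Schwarz_ineq2] mult_left_mono) auto
      then show "\<bar>f t \<bullet> c - \<phi> t - (f s \<bullet> c - \<phi> s)\<bar> \<le> norm (f t - f s) + norm (\<phi> t - \<phi> s)"
        by (simp add: inner_diff_left)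
    qed
    fix t assume t: "t \<in> {a..b} - N"
    obtain D where D: "norm D \<le> \<phi>' t" "(f has_vector_derivative D) (at t within {a..b})"
      using f'[OF t] by blast
    have "D \<bullet> c \<le> norm D * norm c" by (rule norm_cauchy_schwarz)
    also have "\<dots> \<le> norm D * 1" using c(1) by (intro mult_left_mono) auto
    finally have "D \<bullet> c - \<phi>' t \<le> 0" using D(1) by simp
    moreover have "(?g has_vector_derivative D \<bullet> c - \<phi>' t) (at t within {a..b})"
      using t by (intro has_vector_derivative_diff \<phi> bounded_linear.has_vector_derivative[OF bounded_linear_inner_left D(2)]) auto
    ultimately show "\<exists>D\<le>0. (?g has_vector_derivative D) (at t within {a..b})" by blast
  qed
  then show ?thesis using c(2) by (simp add: inner_diff_left)
qed

section \<open>Holomorphic mappings and the class N\<close>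

lemma Re_cinner: "Re (cinner z w) = z \<bullet> w"
  by (simp add: cinner_def inner_vec_def inner_complex_def)

lemma cinner_self: "cinner z z = of_real ((norm z)\<^sup>2)"
  unfolding cinner_def norm_vec_def L2_set_def
  by (simp add: sum_nonneg complex_norm_square[symmetric] del: of_real_power)

lemma cinner_add_left: "cinner (x + y) w = cinner x w + cinner y w"
  by (simp add: cinner_def algebra_simps sum.distrib)

lemma cinner_add_right: "cinner w (x + y) = cinner w x + cinner w y"
  by (simp add: cinner_def algebra_simps sum.distrib)

lemma cinner_vscale_left: "cinner (c *s x) w = c * cinner x w"
  by (simp add: cinner_def sum_distrib_left mult_ac)

lemma cinner_vscale_right: "cinner x (c *s w) = cnj c * cinner x w"
  by (simp add: cinner_def sum_distrib_left mult_ac)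

lemma cinner_0_left [simp]: "cinner 0 w = 0"
  by (simp add: cinner_def)

lemma norm_cinner_le: "norm (cinner z w) \<le> norm z * norm w"
proof -
  have "norm (\<chi> i. cnj (w $ i)) = norm w" by (simp add: norm_vec_def)
  then show ?thesis
    using norm_sum_mult_le[of z "\<chi> i. cnj (w $ i)"] by (simp add: cinner_def)
qed

lemma bounded_linear_cinner_left: "bounded_linear (\<lambda>z. cinner z w)"
proof
  show "\<exists>K. \<forall>x. norm (cinner x w) \<le> norm x * K"
    using norm_cinner_le by blast
  show "cinner (r *\<^sub>R x) w = r *\<^sub>R cinner x w" for r x
    by (simp add: cinner_def scaleR_sum_right)
qed (simp add: cinner_add_left)

lemma bounded_linear_vscale_left: "bounded_linear (\<lambda>c. c *s (w :: complex ^ 'n))"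
proof
  show "\<exists>K. \<forall>x. norm (x *s w) \<le> norm x * K"
    using norm_vscale by (metis order_refl)
qed (auto simp: vec_eq_iff algebra_simps)

text \<open>Transfers scalar estimates to vectors: a bound \<open>B * norm c\<close> for the pairing
  of \<open>y\<close> with a vector \<open>c\<close> is applied with \<open>c = y\<close>.\<close>

lemma norm_le_cinnerI:
  assumes "B \<ge> 0" "norm (cinner y y) \<le> B * norm y"
  shows "norm y \<le> B"
proof (cases "y = 0")
  case False
  have "norm y * norm y \<le> B * norm y"
    using assms(2) by (simp add: cinner_self power2_eq_square norm_mult)
  with False show ?thesis by simp
qed (use assms in auto)

lemma slice_has_field_derivative:
  assumes "(f has_derivative (\<lambda>u. M *v u)) (at (z + \<zeta> *s u))"
  shows "((\<lambda>\<zeta>. cinner (f (z + \<zeta> *s u)) c) has_field_derivative cinner (M *v u) c) (at \<zeta>)"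
proof -
  have "((\<lambda>\<zeta>. z + \<zeta> *s u) has_derivative (\<lambda>k. k *s u)) (at \<zeta>)"
    using bounded_linear_imp_has_derivative[OF bounded_linear_vscale_left[of u]]
    by (auto intro!: derivative_eq_intros)
  from bounded_linear.has_derivative[OF bounded_linear_cinner_left diff_chain_at[OF this assms], of c]
  show ?thesis
    unfolding has_field_derivative_def
    by (simp add: o_def matrix_vector_mult_vscale cinner_vscale_left mult.commute[of _ "cinner _ _"] cong: )
qed

text \<open>Restricting to a complex line and pairing with a fixed vector gives a function of one
  complex variable; this is how one-variable theory enters.\<close>

lemma slice_holomorphic:
  assumes "holo_on f S" "\<And>\<zeta>. \<zeta> \<in> T \<Longrightarrow> z + \<zeta> *s u \<in> S"
  shows "(\<lambda>\<zeta>. cinner (f (z + \<zeta> *s u)) c) holomorphic_on T"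
  unfolding holomorphic_on_def field_differentiable_def
proof
  fix \<zeta> assume "\<zeta> \<in> T"
  with assms obtain M where "(f has_derivative (\<lambda>u. M *v u)) (at (z + \<zeta> *s u))"
    unfolding holo_on_def by blast
  from slice_has_field_derivative[OF this] show "\<exists>f'. ((\<lambda>\<zeta>. cinner (f (z + \<zeta> *s u)) c) has_field_derivative f') (at \<zeta> within T)"
    using has_field_derivative_at_within by blast
qed

lemma holo_on_imp_continuous_on: "holo_on f S \<Longrightarrow> continuous_on S f"
  unfolding holo_on_def by (meson continuous_at_imp_continuous_on has_derivative_continuous)

lemma holo_on_subset: "holo_on f S \<Longrightarrow> T \<subseteq> S \<Longrightarrow> holo_on f T"
  unfolding holo_on_def by blast

lemma holo_on_compose:
  assumes "holo_on f S" "holo_on g T" "f ` S \<subseteq> T"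
  shows "holo_on (\<lambda>z. g (f z)) S"
  unfolding holo_on_def
proof
  fix z assume z: "z \<in> S"
  then obtain M where M: "(f has_derivative (\<lambda>u. M *v u)) (at z)"
    using assms(1) unfolding holo_on_def by blast
  obtain N where N: "(g has_derivative (\<lambda>u. N *v u)) (at (f z))"
    using assms(2,3) z unfolding holo_on_def by blast
  have "((\<lambda>z. g (f z)) has_derivative (\<lambda>u. (N ** M) *v u)) (at z)"
    using diff_chain_at[OF M N] by (simp add: o_def matrix_vector_mul_assoc)
  then show "\<exists>M. ((\<lambda>z. g (f z)) has_derivative (\<lambda>u. M *v u)) (at z)" by blast
qed

lemma holo_on_id: "holo_on (\<lambda>z. z) S"
proof -
  have "(*v) (mat 1 :: complex ^ 'a ^ 'a) = (\<lambda>u. u)" by (rule ext) simp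
  then show ?thesis unfolding holo_on_def by (intro ballI exI[of _ "mat 1"]) simp
qed

lemma holo_on_add:
  assumes "holo_on f S" "holo_on g S"
  shows "holo_on (\<lambda>z. f z + g z) S"
  unfolding holo_on_def
proof
  fix z assume "z \<in> S"
  with assms obtain M N where "(f has_derivative (\<lambda>u. M *v u)) (at z)" "(g has_derivative (\<lambda>u. N *v u)) (at z)"
    unfolding holo_on_def by blast
  from has_derivative_add[OF this] show "\<exists>M. ((\<lambda>z. f z + g z) has_derivative (\<lambda>u. M *v u)) (at z)"
    by (auto simp: matrix_vector_mult_add_rdistrib[symmetric])
qed

lemma holo_on_matrix: 
  assumes "holo_on f S" 
  shows "holo_on (\<lambda>z. M *v f z) S"
  unfolding holo_on_def
proof
  fix z assume "z \<in> S"
  with assms obtain N where N: "(f has_derivative (\<lambda>u. N *v u)) (at z)"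
    unfolding holo_on_def by blast
  have "((\<lambda>z. M *v f z) has_derivative (\<lambda>u. M *v (N *v u))) (at z)"
    by (rule bounded_linear.has_derivative[OF bounded_bilinear.bounded_linear_right[OF bounded_bilinear_matrix_vector] N])
  then show "\<exists>N. ((\<lambda>z. M *v f z) has_derivative (\<lambda>u. N *v u)) (at z)"
    by (auto simp: matrix_vector_mul_assoc)
qed

lemma holo_on_const: "holo_on (\<lambda>z. a) S"
proof -
  have "(*v) (0 :: complex ^ 'a ^ 'a) = (\<lambda>u. 0)" by (rule ext) simp
  then show ?thesis unfolding holo_on_def by (intro ballI exI[of _ 0]) simp
qed

lemma holo_on_sum: "(\<And>i. i \<in> I \<Longrightarrow> holo_on (f i) S) \<Longrightarrow> holo_on (\<lambda>z. \<Sum>i\<in>I. f i z) S"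
  by (induction I rule: infinite_finite_induct) (auto simp: holo_on_const holo_on_add)

lemma holo_on_uminus:
  assumes "holo_on f S"
  shows "holo_on (\<lambda>z. - f z) S"
  unfolding holo_on_def
proof
  fix z assume "z \<in> S"
  with assms obtain M where M: "(f has_derivative (\<lambda>u. M *v u)) (at z)"
    unfolding holo_on_def by blast
  have "- (M *v u) = (- M) *v u" for u
    by (simp add: matrix_vector_mult_def vec_eq_iff sum_negf)
  with has_derivative_minus[OF M] have "((\<lambda>z. - f z) has_derivative (\<lambda>u. (- M) *v u)) (at z)"
    by simp
  then show "\<exists>M. ((\<lambda>z. - f z) has_derivative (\<lambda>u. M *v u)) (at z)" by blast
qed

lemma holo_on_diff: "holo_on f S \<Longrightarrow> holo_on g S \<Longrightarrow> holo_on (\<lambda>z. f z - g z) S"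
  using holo_on_add[OF _ holo_on_uminus] by fastforce

text \<open>The one-variable Cauchy inequality on the slice through \<open>z\<close> in direction
  \<open>u\<close>, whose parameter disc has radius \<open>r / norm u\<close>, paired with
  \<open>D *v u\<close> itself.\<close>

lemma cauchy_derivative_bound:
  assumes f: "holo_on f S" and S: "cball z r \<subseteq> S" "r > 0"
    and M: "\<And>w. w \<in> cball z r \<Longrightarrow> norm (f w) \<le> M"
    and D: "(f has_derivative (\<lambda>u. D *v u)) (at z)"
  shows "norm (D *v u) \<le> M / r * norm u"
proof (cases "u = 0")
  case False
  have M0: "M \<ge> 0" using M[of z] S by (auto intro: order_trans[OF norm_ge_zero])
  define c where "c = D *v u"
  define R where "R = r / norm u"
  have R: "R > 0" using False S by (simp add: R_def)
  let ?\<phi> = "\<lambda>\<zeta>. cinner (f (z + \<zeta> *s u)) c"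
  have in_c: "z + \<zeta> *s u \<in> cball z r" if "\<zeta> \<in> cball 0 R" for \<zeta>
    using that False by (auto simp: dist_norm norm_vscale R_def field_simps)
  then have hol: "?\<phi> holomorphic_on cball 0 R"
    using S by (intro slice_holomorphic[OF f]) auto
  have "norm ((deriv ^^ 1) ?\<phi> 0) \<le> fact 1 * (M * norm c) / R ^ 1"
  proof (rule Cauchy_inequality)
    show "?\<phi> holomorphic_on ball 0 R" using hol by (rule holomorphic_on_subset) auto
    show "continuous_on (cball 0 R) ?\<phi>" using hol by (rule holomorphic_on_imp_continuous_on)
    fix x :: complex assume "norm (0 - x) = R"
    then have "norm (f (z + x *s u)) \<le> M" by (intro M in_c) auto
    then show "norm (?\<phi> x) \<le> M * norm c"
      by (intro order_trans[OF norm_cinner_le] mult_right_mono) auto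
  qed (rule R)
  moreover have "deriv ?\<phi> 0 = cinner (D *v u) c"
    using slice_has_field_derivative[of f D z 0 u c] D by (intro DERIV_imp_deriv) simp
  ultimately have "norm (cinner c c) \<le> M / r * norm u * norm c"
    by (simp add: c_def R_def field_simps)
  then show ?thesis
    unfolding c_def[symmetric] using M0 S by (intro norm_le_cinnerI) auto
qed simp

text \<open>On the smaller ball the Cauchy estimate with radius \<open>r' - r\<close> bounds the
  derivative, and convexity does the rest. As only a bound for \<open>f\<close> is needed, the lemma
  also serves for differences of mappings at two times.\<close>

lemma cauchy_lipschitz:
  assumes f: "holo_on f S" and S: "cball a r' \<subseteq> S" "r < r'"
    and M: "\<And>w. w \<in> cball a r' \<Longrightarrow> norm (f w) \<le> M"
    and xy: "x \<in> cball a r" "y \<in> cball a r"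
  shows "norm (f x - f y) \<le> M / (r' - r) * norm (x - y)"
proof -
  have "\<exists>D. \<forall>z\<in>cball a r. (f has_derivative (\<lambda>u. D z *v u)) (at z)"
    using f S unfolding holo_on_def by (intro bchoice ballI) (auto simp: subset_iff)
  then obtain D where D: "\<And>z. z \<in> cball a r \<Longrightarrow> (f has_derivative (\<lambda>u. D z *v u)) (at z)" by blast
  show ?thesis
  proof (rule differentiable_bound[OF convex_cball _ _ xy])
    fix z assume z: "z \<in> cball a r"
    show "(f has_derivative (\<lambda>u. D z *v u)) (at z within cball a r)"
      using D[OF z] by (rule has_derivative_at_withinI)
    have sub: "cball z (r' - r) \<subseteq> cball a r'"
    proof
      fix w assume "w \<in> cball z (r' - r)"
      with z show "w \<in> cball a r'" using dist_triangle[of a w z] by simp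
    qed
    have "norm (D z *v u) \<le> M / (r' - r) * norm u" for u
      by (rule cauchy_derivative_bound[OF f order_trans[OF sub S(1)] _ _ D[OF z]]) (use S(2) M sub in auto)
    then show "onorm (\<lambda>u. D z *v u) \<le> M / (r' - r)"
      by (rule onorm_le)
  qed
qed

lemma norm_axis_complex: "norm (axis i (c :: complex)) = norm c"
proof -
  have "axis i c = c *s axis i 1" by (simp add: vec_eq_iff axis_def)
  moreover have "norm (axis i (1 :: complex)) = 1"
    by (simp add: norm_vec_def L2_set_def axis_def if_distrib[of norm] if_distrib[of "\<lambda>x. x ^ 2"] cong: if_cong)
  ultimately show ?thesis by (simp add: norm_vscale)
qed

text \<open>The Weierstrass convergence theorem: Cauchy estimates make the derivatives uniformly
  Cauchy on a ball of half the radius, and their limit is the derivative of the limit.\<close>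

lemma holo_on_uniform_limit:
  fixes f :: "nat \<Rightarrow> complex ^ 'n \<Rightarrow> complex ^ 'n"
  assumes f: "\<forall>\<^sub>F k in sequentially. holo_on (f k) S" and S: "open S"
    and lim: "\<And>K. compact K \<Longrightarrow> K \<subseteq> S \<Longrightarrow> uniform_limit K f g sequentially"
  shows "holo_on g S"
  unfolding holo_on_def
proof
  fix z assume z: "z \<in> S"
  then obtain R where R: "R > 0" "cball z R \<subseteq> S"
    using S open_contains_cball by blast
  define r where "r = R / 2"
  have r: "r > 0" using R by (simp add: r_def)
  obtain k0 where k0: "\<And>k. k \<ge> k0 \<Longrightarrow> holo_on (f k) S"
    using f by (auto simp: eventually_sequentially)
  define F where "F k = f (k + k0)" for k
  have F: "holo_on (F k) S" for k using k0 by (simp add: F_def)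
  have sub: "cball x r \<subseteq> cball z R" if "x \<in> ball z r" for x
  proof
    fix y assume "y \<in> cball x r"
    then show "y \<in> cball z R" using that dist_triangle[of z y x] by (auto simp: r_def)
  qed
  have "\<exists>D. \<forall>x\<in>S. (F k has_derivative (\<lambda>u. D x *v u)) (at x)" for k
    using F[of k] unfolding holo_on_def by (intro bchoice)
  then obtain D where D: "\<And>k x. x \<in> S \<Longrightarrow> (F k has_derivative (\<lambda>u. D k x *v u)) (at x)" by metis
  have unif: "uniform_limit (cball z R) F g sequentially"
  proof -
    have "uniform_limit (cball z R) f g sequentially" using lim R by auto
    then show ?thesis unfolding F_def uniform_limit_iff
    proof (intro allI impI)
      fix e :: real assume "\<forall>e>0. \<forall>\<^sub>F n in sequentially. \<forall>x\<in>cball z R. dist (f n x) (g x) < e" "0 < e"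
      then have "\<forall>\<^sub>F n in sequentially. \<forall>x\<in>cball z R. dist (f n x) (g x) < e" by blast
      then show "\<forall>\<^sub>F n in sequentially. \<forall>x\<in>cball z R. dist (f (n + k0) x) (g x) < e"
        by (rule sequentially_offset)
    qed
  qed
  have C: "\<exists>N. \<forall>j\<ge>N. \<forall>k\<ge>N. \<forall>x\<in>ball z r. \<forall>u. norm ((D j x - D k x) *v u) \<le> e * norm u" if e: "e > 0" for e
  proof -
    have "e * r / 2 > 0" using e r by simp
    with unif obtain N where N: "\<And>k y. k \<ge> N \<Longrightarrow> y \<in> cball z R \<Longrightarrow> dist (F k y) (g y) < e * r / 2"
      unfolding uniform_limit_iff eventually_sequentially by meson
    show ?thesis
    proof (intro exI[of _ N] allI impI ballI)
      fix j k x u assume jk: "j \<ge> N" "k \<ge> N" and x: "x \<in> ball z r"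
      have "x \<in> cball x r" using r by simp
      then have xS: "x \<in> S" using sub[OF x] R(2) by blast
      have "((\<lambda>w. F j w - F k w) has_derivative (\<lambda>u. (D j x - D k x) *v u)) (at x)"
        using has_derivative_diff[OF D[OF xS, of j] D[OF xS, of k]]
        by (simp add: matrix_vector_mult_diff_rdistrib)
      then have "norm ((D j x - D k x) *v u) \<le> (e * r) / r * norm u"
      proof (rule cauchy_derivative_bound[OF holo_on_diff[OF F F] order_trans[OF sub[OF x] R(2)] r, rotated])
        fix w assume w: "w \<in> cball x r"
        then have "dist (F j w) (g w) < e * r / 2" "dist (F k w) (g w) < e * r / 2"
          using N jk sub[OF x] by auto
        then show "norm (F j w - F k w) \<le> e * r"
          using dist_triangle2[of "F j w" "F k w" "g w"] by (simp add: dist_norm)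
      qed
      then show "norm ((D j x - D k x) *v u) \<le> e * norm u" using r by simp
    qed
  qed
  have "Cauchy (\<lambda>k. D k x)" if x: "x \<in> ball z r" for x
  proof (rule metric_CauchyI)
    fix e :: real assume e: "e > 0"
    \<comment> \<open>The norm of a matrix is at most the sum of its \<open>CARD('n)\<close> column
      norms; the factor 2 makes the final inequality strict.\<close>
    define e' where "e' = e / (2 * real CARD('n))"
    have e': "e' > 0" using e by (simp add: e'_def)
    from C[OF this] obtain N where N: "\<And>j k u. j \<ge> N \<Longrightarrow> k \<ge> N \<Longrightarrow> norm ((D j x - D k x) *v u) \<le> e' * norm u"
      using x by blast
    have "dist (D j x) (D k x) < e" if "j \<ge> N" "k \<ge> N" for j k
    proof -
      have "dist (D j x) (D k x) \<le> (\<Sum>i\<in>UNIV. norm ((D j x - D k x) *v axis i 1))"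
        unfolding dist_norm by (rule norm_matrix_le_sum_axis)
      also have "\<dots> \<le> (\<Sum>i\<in>(UNIV::'n set). e')"
        using N[OF that] by (intro sum_mono) (metis mult.right_neutral norm_axis_complex norm_one)
      also have "\<dots> < e" using e by (simp add: e'_def)
      finally show ?thesis .
    qed
    then show "\<exists>N. \<forall>j\<ge>N. \<forall>k\<ge>N. dist (D j x) (D k x) < e" by blast
  qed
  then have "\<exists>G. \<forall>x\<in>ball z r. (\<lambda>k. D k x) \<longlonglongrightarrow> G x"
    by (intro bchoice ballI) (simp add: Cauchy_convergent_iff convergent_def)
  then obtain G where G: "\<And>x. x \<in> ball z r \<Longrightarrow> (\<lambda>k. D k x) \<longlonglongrightarrow> G x" by blast
  have "\<exists>g'. \<forall>x\<in>ball z r. (\<lambda>k. F k x) \<longlonglongrightarrow> g' x \<and> (g' has_derivative (\<lambda>u. G x *v u)) (at x within ball z r)"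
  proof (rule has_derivative_sequence[where ?x0.0 = z and l = "g z" and f' = "\<lambda>k x u. D k x *v u"])
    fix k x assume "x \<in> ball z r"
    then have "cball x r \<subseteq> cball z R" by (rule sub)
    moreover have "x \<in> cball x r" using r by simp
    ultimately have "x \<in> S" using R(2) by blast
    then show "(F k has_derivative (\<lambda>u. D k x *v u)) (at x within ball z r)"
      by (rule has_derivative_at_withinI[OF D])
  next
    fix e :: real assume "e > 0"
    from C[OF this] obtain N where N: "\<And>j k x u. j \<ge> N \<Longrightarrow> k \<ge> N \<Longrightarrow> x \<in> ball z r \<Longrightarrow> norm ((D j x - D k x) *v u) \<le> e * norm u"
      by blast
    show "\<forall>\<^sub>F k in sequentially. \<forall>x\<in>ball z r. \<forall>u. norm (D k x *v u - G x *v u) \<le> e * norm u"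
      unfolding eventually_sequentially
    proof (intro exI[of _ N] allI impI ballI)
      fix k x u assume k: "k \<ge> N" and x: "x \<in> ball z r"
      have "(\<lambda>j. norm ((D k x - D j x) *v u)) \<longlonglongrightarrow> norm ((D k x - G x) *v u)"
        by (intro tendsto_norm bounded_linear.tendsto[OF bounded_bilinear.bounded_linear_left[OF bounded_bilinear_matrix_vector]]
            tendsto_diff tendsto_const G x)
      then have "norm ((D k x - G x) *v u) \<le> e * norm u"
        by (rule tendsto_upperbound) (use N[OF k _ x] in \<open>auto simp: eventually_sequentially\<close>)
      then show "norm (D k x *v u - G x *v u) \<le> e * norm u"
        by (simp add: matrix_vector_mult_diff_rdistrib)
    qed
  next
    show "(\<lambda>k. F k z) \<longlonglongrightarrow> g z"
      using unif R(1) by (intro tendsto_uniform_limitI) auto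
  qed (use r in auto)
  then obtain g' where g': "\<And>x. x \<in> ball z r \<Longrightarrow> (\<lambda>k. F k x) \<longlonglongrightarrow> g' x"
    "\<And>x. x \<in> ball z r \<Longrightarrow> (g' has_derivative (\<lambda>u. G x *v u)) (at x within ball z r)" by blast
  have eq: "g' x = g x" if x: "x \<in> ball z r" for x
  proof (rule LIMSEQ_unique[OF g'(1)[OF x]])
    show "(\<lambda>k. F k x) \<longlonglongrightarrow> g x"
    proof (rule tendsto_uniform_limitI[OF unif])
      have "dist z x \<le> r" "r \<le> R" using x R(1) by (simp_all add: r_def)
      then show "x \<in> cball z R" by simp
    qed
  qed
  have "(g' has_derivative (\<lambda>u. G z *v u)) (at z)"
    using g'(2)[of z] r by (simp add: at_within_open[OF _ open_ball])
  then have "(g has_derivative (\<lambda>u. G z *v u)) (at z)"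
    by (rule has_derivative_transform_within_open[OF _ open_ball[of z r]]) (use r eq in auto)
  then show "\<exists>M. (g has_derivative (\<lambda>u. M *v u)) (at z)" by blast
qed

text \<open>Harnack type bounds. The Cayley transform of \<open>p\<close>, normalized at
  \<open>p 0\<close>, maps the disc into itself and 0 to 0, so the Schwarz lemma applies; inverting
  the transform gives both estimates. The conjugate of \<open>p 0\<close> appears because
  \<open>p 0\<close> need not be real.\<close>

lemma positive_real_part_bounds:
  assumes hol: "p holomorphic_on ball 0 1" and pos: "\<And>z. norm z < 1 \<Longrightarrow> Re (p z) > 0" and z: "norm z < 1"
  shows "Re (p 0) * ((1 - norm z) / (1 + norm z)) \<le> Re (p z)"
    and "norm (p z) \<le> norm (p 0) * ((1 + norm z) / (1 - norm z))"
proof -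
  let ?w = "\<lambda>z. (p z - p 0) / (p z + cnj (p 0))"
  have nz: "p z + cnj (p 0) \<noteq> 0" if "norm z < 1" for z
  proof
    assume "p z + cnj (p 0) = 0"
    then have "Re (p z + cnj (p 0)) = 0" by simp
    with pos[OF that] pos[of 0] show False by simp
  qed
  have lt: "norm (?w z) < 1" if "norm z < 1" for z
  proof -
    have "(norm (p z - p 0))\<^sup>2 < (norm (p z + cnj (p 0)))\<^sup>2"
      using mult_pos_pos[OF pos[OF that] pos[of 0]] unfolding cmod_power2 by (simp add: power2_eq_square algebra_simps)
    then have "norm (p z - p 0) < norm (p z + cnj (p 0))"
      by (rule power_less_imp_less_base) simp
    then show ?thesis using nz[OF that] by (simp add: norm_divide)
  qed
  have w: "norm (?w z) \<le> norm z"
    by (rule Schwarz_Lemma(1)[OF _ _ lt z])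
       (use nz in \<open>auto intro!: holomorphic_intros hol\<close>)
  define w where "w = ?w z"
  define x where "x = norm w"
  have x: "0 \<le> x" "x \<le> norm z" "x < 1" using w z by (auto simp: x_def w_def)
  have w1: "1 - w \<noteq> 0" using x by (auto simp: x_def)
  have "w * (p z + cnj (p 0)) = p z - p 0" using nz[OF z] by (simp add: w_def)
  then have "p z * (1 - w) = p 0 + cnj (p 0) * w" by (simp add: algebra_simps)
  then have pz: "p z = (p 0 + cnj (p 0) * w) / (1 - w)" using w1 by (simp add: field_simps)
  have n1: "norm (1 - w) \<le> 1 + x" "1 - x \<le> norm (1 - w)"
    unfolding x_def using norm_triangle_ineq4[of 1 w] norm_triangle_ineq2[of 1 w] by auto
  \<comment> \<open>Multiplying by the conjugate of \<open>1 - w\<close> leaves the Poisson kernel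
    of the disc at \<open>w\<close>.\<close>
  have "Re (p z) = Re (p 0) * ((1 - x\<^sup>2) / (norm (1 - w))\<^sup>2)"
  proof -
    have "p z = (p 0 + cnj (p 0) * w) * cnj (1 - w) / of_real ((norm (1 - w))\<^sup>2)"
      unfolding pz by (subst complex_div_cnj) simp
    then have "Re (p z) = Re ((p 0 + cnj (p 0) * w) * cnj (1 - w)) / (norm (1 - w))\<^sup>2"
      by simp
    also have "Re ((p 0 + cnj (p 0) * w) * cnj (1 - w)) = Re (p 0) * (1 - x\<^sup>2)"
      unfolding x_def cmod_power2 by (simp add: algebra_simps power2_eq_square)
    finally show ?thesis by simp
  qed
  also have "\<dots> \<ge> Re (p 0) * ((1 - x\<^sup>2) / (1 + x)\<^sup>2)"
    using pos[of 0] x n1 w1 by (intro mult_left_mono divide_left_mono power_mono) (auto simp: power_le_one)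
  also have "(1 - x\<^sup>2) / (1 + x)\<^sup>2 = (1 - x) / (1 + x)"
  proof -
    have "1 - x\<^sup>2 = (1 - x) * (1 + x)" by (simp add: power2_eq_square algebra_simps)
    then show ?thesis using x by (simp add: power2_eq_square)
  qed
  finally have "Re (p 0) * ((1 - x) / (1 + x)) \<le> Re (p z)" .
  moreover have "(1 - norm z) / (1 + norm z) \<le> (1 - x) / (1 + x)"
    using x z by (intro frac_le) auto
  ultimately show "Re (p 0) * ((1 - norm z) / (1 + norm z)) \<le> Re (p z)"
    using pos[of 0] by (smt (verit, best) mult_left_mono norm_zero)
  have "norm (p z) = norm (p 0 + cnj (p 0) * w) / norm (1 - w)" unfolding pz by (rule norm_divide)
  also have "\<dots> \<le> (norm (p 0) * (1 + x)) / (1 - x)"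
    using x n1 norm_triangle_ineq[of "p 0" "cnj (p 0) * w"]
    by (intro frac_le) (auto simp: norm_mult x_def algebra_simps)
  also have "\<dots> = norm (p 0) * ((1 + x) / (1 - x))" by simp
  also have "\<dots> \<le> norm (p 0) * ((1 + norm z) / (1 - norm z))"
    using x z by (intro mult_left_mono frac_le) auto
  finally show "norm (p z) \<le> norm (p 0) * ((1 + norm z) / (1 - norm z))" .
qed

section \<open>Growth of mappings in the class N\<close>

lemma m_low_le:
  assumes "norm u = 1"
  shows "m_low A \<le> Re (cinner (A *v u) u)"
  unfolding m_low_def
proof (rule cINF_lower)
  show "bdd_below ((\<lambda>z. Re (cinner (A *v z) z)) ` {z. norm z = 1})"
  proof (rule bdd_belowI2)
    fix z :: "complex ^ 'a" assume "z \<in> {z. norm z = 1}"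
    then have "norm (cinner (A *v z) z) \<le> norm A"
      using norm_cinner_le[of "A *v z" z] norm_matrix_vector_le[of A z] by simp
    then show "- norm A \<le> Re (cinner (A *v z) z)"
      using abs_Re_le_cmod[of "cinner (A *v z) z"] by linarith
  qed
qed (use assms in auto)

text \<open>On each complex line the pairing divided by the parameter has positive real part. Its
  value at 0 is the pairing of \<open>A *v u\<close> with \<open>u\<close>, whose real part is at
  least \<open>m_low A\<close> and whose modulus is at most \<open>norm A\<close>.\<close>

lemma class_N_cinner_bounds:
  fixes A :: "complex ^ 'n ^ 'n"
  assumes h: "h \<in> class_N A" and mA: "m_low A > 0" and z: "norm z < 1"
  shows "Re (cinner (h z) z) \<ge> m_low A * (norm z)\<^sup>2 * ((1 - norm z) / (1 + norm z))"
    and "norm (cinner (h z) z) \<le> norm A * (norm z)\<^sup>2 * ((1 + norm z) / (1 - norm z))"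
proof -
  have "m_low A * (norm z)\<^sup>2 * ((1 - norm z) / (1 + norm z)) \<le> Re (cinner (h z) z) \<and>
    norm (cinner (h z) z) \<le> norm A * (norm z)\<^sup>2 * ((1 + norm z) / (1 - norm z))"
  proof (cases "z = 0")
    case False
    define u where "u = of_real (1 / norm z) *s z"
    have u: "norm u = 1" using False by (simp add: u_def norm_vscale norm_divide)
    have zu: "z = of_real (norm z) *s u" using False by (simp add: u_def vector_smult_assoc)
    \<comment> \<open>Pairing with the fixed \<open>u\<close> keeps \<open>?q\<close> holomorphic;
      the pairing with the moving point \<zeta> u differs from it by the conjugate of
      \<zeta>.\<close>
    let ?q = "\<lambda>\<zeta>. cinner (h (0 + \<zeta> *s u)) u"
    define p where "p \<zeta> = (if \<zeta> = 0 then deriv ?q 0 else (?q \<zeta> - ?q 0) / (\<zeta> - 0))" for \<zeta>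
    have hol: "?q holomorphic_on ball 0 1"
      by (rule slice_holomorphic[of h "ball 0 1"]) (use h u in \<open>auto simp: class_N_def norm_vscale\<close>)
    have "p holomorphic_on ball 0 1"
      unfolding p_def using pole_lemma[OF hol, of 0] by simp
    have p0: "p 0 = cinner (A *v u) u"
    proof -
      have "(h has_derivative (\<lambda>u. A *v u)) (at (0 + 0 *s u))" using h by (simp add: class_N_def)
      from DERIV_imp_deriv[OF slice_has_field_derivative[OF this]] show ?thesis by (simp add: p_def)
    qed
    have q0: "?q 0 = 0" using h by (simp add: class_N_def)
    have cz: "cinner (h (\<zeta> *s u)) (\<zeta> *s u) = of_real ((norm \<zeta>)\<^sup>2) * p \<zeta>" if "\<zeta> \<noteq> 0" for \<zeta>
    proof -
      have "cnj \<zeta> = of_real ((norm \<zeta>)\<^sup>2) / \<zeta>"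
        using that by (simp add: complex_norm_square del: of_real_power)
      then show ?thesis using that q0 by (simp add: p_def cinner_vscale_right)
    qed
    have "Re (p \<zeta>) > 0" if \<zeta>: "norm \<zeta> < 1" for \<zeta>
    proof (cases "\<zeta> = 0")
      case True
      with p0 m_low_le[OF u, of A] mA show ?thesis by simp
    next
      case False
      have "\<zeta> *s u \<in> ball 0 1 - {0}" using \<zeta> u False by (auto simp: norm_vscale)
      with h have "Re (cinner (h (\<zeta> *s u)) (\<zeta> *s u)) > 0" by (simp add: class_N_def)
      then show ?thesis unfolding cz[OF False] by (simp add: zero_less_mult_iff)
    qed
    note b = positive_real_part_bounds[OF \<open>p holomorphic_on ball 0 1\<close> this, of "of_real (norm z)"]
    have c: "cinner (h z) z = of_real ((norm z)\<^sup>2) * p (of_real (norm z))"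
      using cz[of "of_real (norm z)"] zu False by simp
    have nA: "norm (p 0) \<le> norm A"
      unfolding p0 using norm_cinner_le[of "A *v u" u] norm_matrix_vector_le[of A u] u by simp
    show ?thesis
    proof
      have "m_low A * (norm z)\<^sup>2 * ((1 - norm z) / (1 + norm z)) = (norm z)\<^sup>2 * (m_low A * ((1 - norm z) / (1 + norm z)))"
        by simp
      also have "\<dots> \<le> (norm z)\<^sup>2 * (Re (p 0) * ((1 - norm z) / (1 + norm z)))"
        using z m_low_le[OF u, of A] p0 by (intro mult_left_mono mult_right_mono) auto
      also have "\<dots> \<le> (norm z)\<^sup>2 * Re (p (of_real (norm z)))"
        using b(1) z by (intro mult_left_mono) auto
      also have "\<dots> = Re (cinner (h z) z)" by (simp add: c flip: of_real_power)
      finally show "m_low A * (norm z)\<^sup>2 * ((1 - norm z) / (1 + norm z)) \<le> Re (cinner (h z) z)" .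
      have "norm (cinner (h z) z) = (norm z)\<^sup>2 * norm (p (of_real (norm z)))"
        by (simp add: c norm_mult flip: of_real_power)
      also have "\<dots> \<le> (norm z)\<^sup>2 * (norm (p 0) * ((1 + norm z) / (1 - norm z)))"
        using b(2) z by (intro mult_left_mono) auto
      also have "\<dots> \<le> (norm z)\<^sup>2 * (norm A * ((1 + norm z) / (1 - norm z)))"
        using z nA by (intro mult_left_mono mult_right_mono) auto
      finally show "norm (cinner (h z) z) \<le> norm A * (norm z)\<^sup>2 * ((1 + norm z) / (1 - norm z))"
        by (simp add: mult_ac)
    qed
  qed (use h in \<open>auto simp: class_N_def\<close>)
  then show "m_low A * (norm z)\<^sup>2 * ((1 - norm z) / (1 + norm z)) \<le> Re (cinner (h z) z)"
    "norm (cinner (h z) z) \<le> norm A * (norm z)\<^sup>2 * ((1 + norm z) / (1 - norm z))" by auto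
qed

text \<open>Restrict \<open>h\<close> to the disc \<open>w(\<zeta>) = z + \<zeta> b v\<close>, where \<open>v\<close> is the direction of \<open>h z\<close>.  On the unit circle
  \<open>\<zeta> \<langle>h(w), w\<rangle>\<close> agrees with a holomorphic function of \<open>\<zeta>\<close>, since \<open>\<zeta>\<close> times its conjugate is \<open>1\<close>; the value
  of that function at \<open>0\<close> is \<open>b \<parallel>h z\<parallel>\<close>.\<close>

lemma class_N_norm_bound:
  fixes A :: "complex ^ 'n ^ 'n"
  assumes h: "h \<in> class_N A" and mA: "m_low A > 0" and z: "norm z < 1"
  shows "norm (h z) \<le> 8 * norm A / (1 - norm z)\<^sup>2"
proof (cases "h z = 0 \<or> z = 0")
  case False
  define u where "u = of_real (1 / norm z) *s z"
  have u: "norm u = 1" using False by (simp add: u_def norm_vscale norm_divide)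
  have zu: "z = of_real (norm z) *s u" using False by (simp add: u_def vector_smult_assoc)
  define v where "v = of_real (1 / norm (h z)) *s h z"
  have v: "norm v = 1" using False by (simp add: v_def norm_vscale norm_divide)
  \<comment> \<open>With this radius the disc keeps the distance \<open>b\<close> from the unit
    sphere. The bound \<open>2 * norm A / b\<close> on the circle is divided by \<open>b\<close>
    once more, which produces the constant 8.\<close>
  define b where "b = (1 - norm z) / 2"
  have b: "b > 0" using z by (simp add: b_def)
  let ?w = "\<lambda>\<zeta>. z + \<zeta> *s (of_real b *s v)"
  have w: "norm (?w \<zeta>) \<le> 1 - b" if "norm \<zeta> \<le> 1" for \<zeta>
  proof -
    have "norm (?w \<zeta>) \<le> norm z + norm \<zeta> * b"
      using norm_triangle_ineq[of z "\<zeta> *s (of_real b *s v)"] b v by (simp add: norm_vscale norm_mult)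
    also have "\<dots> \<le> norm z + 1 * b" using that b by (intro add_left_mono mult_right_mono) auto
    also have "\<dots> = 1 - b" by (simp add: b_def field_simps)
    finally show ?thesis .
  qed
  let ?\<Phi> = "\<lambda>\<zeta>. of_real (norm z) * \<zeta> * cinner (h (?w \<zeta>)) u + of_real b * cinner (h (?w \<zeta>)) v"
  have hol: "(\<lambda>\<zeta>. cinner (h (?w \<zeta>)) c) holomorphic_on cball 0 1" for c
    by (rule slice_holomorphic[of h "ball 0 1"]) (use h b w in \<open>fastforce simp: class_N_def\<close>)+
  have hol\<Phi>: "?\<Phi> holomorphic_on cball 0 1"
    by (intro holomorphic_intros hol)
  have "norm ((deriv ^^ 0) ?\<Phi> 0) \<le> fact 0 * (2 * norm A / b) / 1 ^ 0"
  proof (rule Cauchy_inequality)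
    show "?\<Phi> holomorphic_on ball 0 1" using hol\<Phi> by (rule holomorphic_on_subset) auto
    show "continuous_on (cball 0 1) ?\<Phi>" using hol\<Phi> by (rule holomorphic_on_imp_continuous_on)
    fix \<zeta> :: complex assume "norm (0 - \<zeta>) = 1"
    then have n: "norm \<zeta> = 1" by simp
    then have "\<zeta> * cnj \<zeta> = 1" by (simp add: complex_norm_square[symmetric])
    have "\<zeta> * cinner (h (?w \<zeta>)) (?w \<zeta>) = \<zeta> * cinner (h (?w \<zeta>)) (of_real (norm z) *s u + \<zeta> *s (of_real b *s v))"
      using zu by simp
    also have "\<dots> = of_real (norm z) * \<zeta> * cinner (h (?w \<zeta>)) u + (\<zeta> * cnj \<zeta>) * (of_real b * cinner (h (?w \<zeta>)) v)"
      by (simp only: cinner_add_right cinner_vscale_right) (simp add: algebra_simps)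
    finally have "norm (?\<Phi> \<zeta>) = norm (cinner (h (?w \<zeta>)) (?w \<zeta>))"
      using \<open>\<zeta> * cnj \<zeta> = 1\<close> n by (metis mult_1 norm_mult)
    also have "\<dots> \<le> norm A * (norm (?w \<zeta>))\<^sup>2 * ((1 + norm (?w \<zeta>)) / (1 - norm (?w \<zeta>)))"
      using w[of \<zeta>] n b by (intro class_N_cinner_bounds(2)[OF h mA]) auto
    also have "\<dots> \<le> norm A * 1 * (2 / b)"
      using w[of \<zeta>] n b by (intro mult_mono frac_le) (auto simp: power_le_one)
    also have "\<dots> = 2 * norm A / b" by simp
    finally show "norm (?\<Phi> \<zeta>) \<le> 2 * norm A / b" .
  qed simp
  then have "b * norm (cinner (h z) v) \<le> 2 * norm A / b"
    using b by (simp add: norm_mult)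
  moreover have "norm (cinner (h z) v) = norm (h z)"
    using False by (simp add: v_def cinner_vscale_right cinner_self norm_mult norm_divide norm_power power2_eq_square)
  ultimately have "norm (h z) \<le> 2 * norm A / b\<^sup>2"
    using b by (simp add: field_simps power2_eq_square)
  also have "\<dots> = 8 * norm A / (1 - norm z)\<^sup>2"
    by (simp add: b_def power_divide)
  finally show ?thesis .
qed (use h in \<open>auto simp: class_N_def\<close>)

section \<open>Homogeneous polynomial mappings\<close>

abbreviation vlinear :: "(complex ^ 'n \<Rightarrow> complex ^ 'n) \<Rightarrow> bool" where
  "vlinear \<equiv> Vector_Spaces.linear (*s) (*s)"

lemma vlinearI:
  assumes "\<And>x y. f (x + y) = f x + f y" "\<And>c x. f (c *s x) = c *s f x"
  shows "vlinear f"
  by unfold_locales (simp_all add: assms)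

lemma vlinear_add: "vlinear f \<Longrightarrow> f (x + y) = f x + f y"
  unfolding Vector_Spaces.linear_def by (elim conjE) (rule module_hom.add)

lemma vlinear_scale: "vlinear f \<Longrightarrow> f (c *s x) = c *s f x"
  unfolding Vector_Spaces.linear_def by (elim conjE) (rule module_hom.scale)

lemma vlinear_0: "vlinear f \<Longrightarrow> f 0 = 0"
  using vlinear_scale[of f 0 0] by simp

lemma vlinear_diff: "vlinear f \<Longrightarrow> vlinear g \<Longrightarrow> vlinear (\<lambda>x. f x - g x)"
  by (intro vlinearI) (simp_all add: vlinear_add vlinear_scale vector_ssub_ldistrib)

lemma vlinear_sum:
  assumes "vlinear f"
  shows "f (\<Sum>i\<in>I. g i) = (\<Sum>i\<in>I. f (g i))"
  by (induction I rule: infinite_finite_induct) (simp_all add: vlinear_0[OF assms] vlinear_add[OF assms])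

lemma vlinear_expand:
  assumes "vlinear f"
  shows "f x = (\<Sum>i\<in>UNIV. x $ i *s f (axis i 1))"
proof -
  have "f x = f (\<Sum>i\<in>UNIV. x $ i *s axis i 1)" by (simp add: basis_expansion)
  then show ?thesis by (simp add: vlinear_sum[OF assms] vlinear_scale[OF assms])
qed

definition multilinear :: "nat \<Rightarrow> 'n::finite form \<Rightarrow> bool" where
  "multilinear k Q \<longleftrightarrow> (\<forall>ws i. length ws = k \<longrightarrow> i < k \<longrightarrow> vlinear (\<lambda>w. Q (ws[i := w])))"

lemma hom_poly_multilinear: "Q \<in> hom_poly k \<Longrightarrow> multilinear k Q"
  unfolding hom_poly_def multilinear_def by blast

lemma hom_poly_symmetric: "Q \<in> hom_poly k \<Longrightarrow> length ws = k \<Longrightarrow> mset ws = mset vs \<Longrightarrow> Q ws = Q vs"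
  unfolding hom_poly_def by blast

lemma hom_polyI:
  assumes "multilinear k Q" "\<And>ws vs. length ws = k \<Longrightarrow> mset ws = mset vs \<Longrightarrow> Q ws = Q vs"
  shows "Q \<in> hom_poly k"
  using assms unfolding hom_poly_def multilinear_def by blast

lemma multilinear_Cons:
  assumes "multilinear (Suc k) Q"
  shows "multilinear k (\<lambda>ws. Q (w # ws))"
  unfolding multilinear_def
proof (intro allI impI)
  fix ws :: "(complex ^ 'a) list" and i assume "length ws = k" "i < k"
  then have "vlinear (\<lambda>x. Q ((w # ws)[Suc i := x]))"
    using assms unfolding multilinear_def by (metis Suc_less_eq length_Cons)
  then show "vlinear (\<lambda>x. Q (w # ws[i := x]))" by simp
qed

lemma multilinear_hd:
  assumes "multilinear (Suc k) Q" "length ws = k"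
  shows "vlinear (\<lambda>w. Q (w # ws))"
proof -
  have "vlinear (\<lambda>x. Q ((0 # ws)[0 := x]))"
    using assms unfolding multilinear_def by (metis length_Cons zero_less_Suc)
  then show ?thesis by simp
qed

lemma hom_poly_Cons:
  assumes "Q \<in> hom_poly (Suc k)"
  shows "(\<lambda>ws. Q (w # ws)) \<in> hom_poly k"
  by (rule hom_polyI[OF multilinear_Cons[OF hom_poly_multilinear[OF assms]]])
     (rule hom_poly_symmetric[OF assms], simp_all)

lemma hom_poly_diff:
  assumes "Q \<in> hom_poly k" "Q' \<in> hom_poly k"
  shows "(\<lambda>ws. Q ws - Q' ws) \<in> hom_poly k"
proof (rule hom_polyI)
  show "multilinear k (\<lambda>ws. Q ws - Q' ws)"
    using assms[THEN hom_poly_multilinear] unfolding multilinear_def by (intro allI impI vlinear_diff) simp_all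
next
  fix ws vs :: "(complex ^ 'a) list" assume *: "length ws = k" "mset ws = mset vs"
  show "Q ws - Q' ws = Q vs - Q' vs"
    using hom_poly_symmetric[OF assms(1) *] hom_poly_symmetric[OF assms(2) *] by simp
qed

text \<open>Guarantees that the supremum in \<open>form_norm\<close> is taken over a bounded set.
  The first argument is expanded in the standard basis with coefficients of modulus at most
  1.\<close>

lemma multilinear_bounded:
  assumes "multilinear k Q"
  shows "\<exists>C. \<forall>ws. length ws = k \<and> (\<forall>w\<in>set ws. norm w \<le> 1) \<longrightarrow> norm (Q ws) \<le> C"
  using assms
proof (induction k arbitrary: Q)
  case 0
  then show ?case by (intro exI[of _ "norm (Q [])"]) auto
next
  case (Suc k)
  have "\<forall>i. \<exists>C. \<forall>ws. length ws = k \<and> (\<forall>w\<in>set ws. norm w \<le> 1) \<longrightarrow> norm (Q (axis i 1 # ws)) \<le> C"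
    using Suc.IH[OF multilinear_Cons[OF Suc.prems]] by blast
  then obtain C where C: "\<And>i ws. length ws = k \<Longrightarrow> (\<forall>w\<in>set ws. norm w \<le> 1) \<Longrightarrow> norm (Q (axis i 1 # ws)) \<le> C i"
    by metis
  show ?case
  proof (intro exI[of _ "\<Sum>i\<in>UNIV. C i"] allI impI)
    fix ws :: "(complex ^ 'a) list" assume "length ws = Suc k \<and> (\<forall>w\<in>set ws. norm w \<le> 1)"
    then obtain w vs where ws: "ws = w # vs" "length vs = k" "norm w \<le> 1" "\<forall>w\<in>set vs. norm w \<le> 1"
      by (cases ws) auto
    have "norm (Q ws) = norm (\<Sum>i\<in>UNIV. w $ i *s Q (axis i 1 # vs))"
      using vlinear_expand[OF multilinear_hd[OF Suc.prems ws(2)], of w] ws(1) by simp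
    also have "\<dots> \<le> (\<Sum>i\<in>UNIV. norm (w $ i *s Q (axis i 1 # vs)))" by (rule norm_sum)
    also have "\<dots> \<le> (\<Sum>i\<in>UNIV. C i)"
    proof (rule sum_mono)
      fix i
      have "norm (w $ i) \<le> 1" using Finite_Cartesian_Product.norm_nth_le[of w i] ws(3) by linarith
      then have "norm (w $ i) * norm (Q (axis i 1 # vs)) \<le> 1 * norm (Q (axis i 1 # vs))"
        by (rule mult_right_mono) simp
      then show "norm (w $ i *s Q (axis i 1 # vs)) \<le> C i"
        using C[OF ws(2,4), of i] by (simp add: norm_vscale)
    qed
    finally show "norm (Q ws) \<le> (\<Sum>i\<in>UNIV. C i)" .
  qed
qed

lemma multilinear_norm_bound:
  assumes "multilinear k Q" "\<And>ws. length ws = k \<Longrightarrow> (\<forall>w\<in>set ws. norm w \<le> 1) \<Longrightarrow> norm (Q ws) \<le> C"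
    "length ws = k"
  shows "norm (Q ws) \<le> C * prod_list (map norm ws)"
  using assms
proof (induction k arbitrary: Q ws)
  case (Suc k)
  then obtain w vs where ws: "ws = w # vs" "length vs = k" by (cases ws) auto
  note lin = multilinear_hd[OF Suc.prems(1) ws(2)]
  show ?case
  proof (cases "w = 0")
    case True
    then show ?thesis using vlinear_0[OF lin] ws by simp
  next
    case False
    define u where "u = of_real (1 / norm w) *s w"
    have u: "norm u = 1" "w = of_real (norm w) *s u"
      using False by (simp_all add: u_def norm_vscale norm_divide vector_smult_assoc)
    have "norm (Q (u # vs)) \<le> C * prod_list (map norm vs)"
      by (rule Suc.IH[OF multilinear_Cons[OF Suc.prems(1)] _ ws(2)]) (use u Suc.prems(2) in auto)
    moreover have "Q ws = of_real (norm w) *s Q (u # vs)"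
      using vlinear_scale[OF lin, of "of_real (norm w)" u] u(2) ws(1) by simp
    moreover have "norm w * norm (Q (u # vs)) \<le> norm w * (C * prod_list (map norm vs))"
      by (rule mult_left_mono[OF calculation(1)]) simp
    ultimately show ?thesis
      using ws(1) by (simp add: norm_vscale mult.left_commute)
  qed
qed simp

lemma form_norm_bdd:
  assumes "Q \<in> hom_poly k"
  shows "bdd_above ((\<lambda>ws. norm (Q ws)) ` {ws. length ws = k \<and> (\<forall>w\<in>set ws. norm w \<le> 1)})"
  using multilinear_bounded[OF hom_poly_multilinear[OF assms]] unfolding bdd_above_def by auto

lemma form_norm_upper:
  assumes "Q \<in> hom_poly k" "length ws = k" "\<And>w. w \<in> set ws \<Longrightarrow> norm w \<le> 1"
  shows "norm (Q ws) \<le> form_norm k Q"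
  unfolding form_norm_def by (rule cSUP_upper[OF _ form_norm_bdd[OF assms(1)]]) (use assms in auto)

lemma form_norm_nonneg:
  assumes "Q \<in> hom_poly k"
  shows "form_norm k Q \<ge> 0"
  using form_norm_upper[OF assms, of "replicate k 0"] by (auto intro: order_trans[OF norm_ge_zero])

lemma form_norm_bound:
  assumes "Q \<in> hom_poly k" "length ws = k"
  shows "norm (Q ws) \<le> form_norm k Q * prod_list (map norm ws)"
  using form_norm_upper[OF assms(1)] by (intro multilinear_norm_bound[OF hom_poly_multilinear[OF assms(1)]] assms) auto

lemma form_norm_bound_diag:
  assumes "Q \<in> hom_poly k"
  shows "norm (Q (replicate k z)) \<le> form_norm k Q * norm z ^ k"
  using form_norm_bound[OF assms, of "replicate k z"] by simp

lemma form_norm_bound_Cons: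
  assumes "Q \<in> hom_poly k" "k \<ge> 1"
  shows "norm (Q (w # replicate (k - 1) z)) \<le> form_norm k Q * (norm w * norm z ^ (k - 1))"
  using form_norm_bound[OF assms(1), of "w # replicate (k - 1) z"] assms(2) by simp

lemma hom_poly_vlinear_Cons:
  assumes "Q \<in> hom_poly k" "k \<ge> 1"
  shows "vlinear (\<lambda>w. Q (w # replicate (k - 1) z))"
  using assms multilinear_hd[of "k - 1" Q "replicate (k - 1) z"] by (simp add: hom_poly_multilinear)

lemma multilinear_scale_diag:
  assumes "multilinear k Q"
  shows "Q (replicate k (c *s z)) = c ^ k *s Q (replicate k z)"
  using assms
proof (induction k arbitrary: Q)
  case (Suc k)
  have "Q (replicate (Suc k) (c *s z)) = c *s Q (z # replicate k (c *s z))"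
    using vlinear_scale[OF multilinear_hd[OF Suc.prems, of "replicate k (c *s z)"]] by simp
  also have "\<dots> = c *s (c ^ k *s Q (z # replicate k z))"
    by (simp only: Suc.IH[OF multilinear_Cons[OF Suc.prems]])
  finally show ?case by (simp add: vector_smult_assoc)
qed simp

lemma hom_poly_scale_diag: "Q \<in> hom_poly k \<Longrightarrow> Q (replicate k (c *s z)) = c ^ k *s Q (replicate k z)"
  by (rule multilinear_scale_diag[OF hom_poly_multilinear])

text \<open>Induction on the degree: the first argument is expanded in the basis and the product
  rule applied. Symmetry moves the direction \<open>u\<close> to the front in every term, so all
  contributions coincide.\<close>

lemma hom_poly_has_derivative:
  assumes "Q \<in> hom_poly k"
  shows "((\<lambda>z. Q (replicate k z)) has_derivative (\<lambda>u. of_nat k *s Q (u # replicate (k - 1) z))) (at z)"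
  using assms
proof (induction k arbitrary: Q)
  case 0
  then show ?case by simp
next
  case (Suc k)
  note lin = multilinear_hd[OF hom_poly_multilinear[OF Suc.prems]]
  interpret V: bounded_bilinear "(*s) :: complex \<Rightarrow> complex ^ 'a \<Rightarrow> complex ^ 'a"
    by (rule bounded_bilinear_vscale)
  have eq: "Q (replicate (Suc k) z) = (\<Sum>i\<in>UNIV. z $ i *s Q (axis i 1 # replicate k z))" for z
    using vlinear_expand[OF lin, of "replicate k z" z] by simp
  have d: "((\<lambda>z. Q (replicate (Suc k) z)) has_derivative
     (\<lambda>u. \<Sum>i\<in>UNIV. z $ i *s (of_nat k *s Q (axis i 1 # u # replicate (k - 1) z)) + u $ i *s Q (axis i 1 # replicate k z))) (at z)"
    unfolding eq
    by (intro has_derivative_sum V.FDERIV bounded_linear_imp_has_derivative[OF bounded_linear_vec_nth]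
        Suc.IH[OF hom_poly_Cons[OF Suc.prems]])
  have "(\<Sum>i\<in>UNIV. z $ i *s (of_nat k *s Q (axis i 1 # u # replicate (k - 1) z)) + u $ i *s Q (axis i 1 # replicate k z))
    = of_nat (Suc k) *s Q (u # replicate k z)" for u
  proof -
    have 1: "(\<Sum>i\<in>UNIV. u $ i *s Q (axis i 1 # replicate k z)) = Q (u # replicate k z)"
      using vlinear_expand[OF lin, of "replicate k z" u] by simp
    have 2: "(\<Sum>i\<in>UNIV. z $ i *s (of_nat k *s Q (axis i 1 # u # replicate (k - 1) z))) = of_nat k *s Q (u # replicate k z)"
    proof (cases k)
      case 0
      then show ?thesis by simp
    next
      case (Suc j)
      have "(\<Sum>i\<in>UNIV. z $ i *s (of_nat k *s Q (axis i 1 # u # replicate (k - 1) z)))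
          = of_nat k *s (\<Sum>i\<in>UNIV. z $ i *s Q (axis i 1 # u # replicate j z))"
        using Suc by (simp only: vec.scale_sum_right vector_smult_assoc mult.commute diff_Suc_1)
      also have "(\<Sum>i\<in>UNIV. z $ i *s Q (axis i 1 # u # replicate j z)) = Q (z # u # replicate j z)"
        using vlinear_expand[OF lin, of "u # replicate j z" z] Suc by simp
      also have "\<dots> = Q (u # replicate k z)"
        by (rule hom_poly_symmetric[OF Suc.prems]) (use Suc in auto)
      finally show ?thesis .
    qed
    have "(\<Sum>i\<in>UNIV. z $ i *s (of_nat k *s Q (axis i 1 # u # replicate (k - 1) z)) + u $ i *s Q (axis i 1 # replicate k z))
      = of_nat k *s Q (u # replicate k z) + Q (u # replicate k z)"
      unfolding sum.distrib 1 2 ..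
    also have "\<dots> = of_nat (Suc k) *s Q (u # replicate k z)"
      by (simp add: vector_sadd_rdistrib)
    finally show ?thesis .
  qed
  with d show ?case by simp
qed

lemma hom_poly_holo_on:
  assumes "Q \<in> hom_poly k" "k \<ge> 1"
  shows "holo_on (\<lambda>z. Q (replicate k z)) S"
  unfolding holo_on_def
proof
  fix z
  let ?f = "\<lambda>u. of_nat k *s Q (u # replicate (k - 1) z)"
  have "vlinear ?f"
    by (intro vlinearI) (simp_all only: vlinear_add[OF hom_poly_vlinear_Cons[OF assms]]
        vlinear_scale[OF hom_poly_vlinear_Cons[OF assms]] vector_add_ldistrib vector_smult_assoc mult.commute)
  then have "matrix ?f *v u = ?f u" for u by (rule matrix_works)
  with hom_poly_has_derivative[OF assms(1), of z]
  have "((\<lambda>z. Q (replicate k z)) has_derivative (\<lambda>u. matrix ?f *v u)) (at z)" by simp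
  then show "\<exists>M. ((\<lambda>z. Q (replicate k z)) has_derivative (\<lambda>u. M *v u)) (at z)" by blast
qed

lemma hom_poly_lipschitz:
  assumes "Q \<in> hom_poly k" "k \<ge> 1" "norm x \<le> 1" "norm y \<le> 1"
  shows "norm (Q (replicate k x) - Q (replicate k y)) \<le> of_nat k * form_norm k Q * norm (x - y)"
proof (rule differentiable_bound[of "cball 0 1"])
  fix z :: "complex ^ 'a" assume z: "z \<in> cball 0 1"
  show "((\<lambda>z. Q (replicate k z)) has_derivative (\<lambda>u. of_nat k *s Q (u # replicate (k - 1) z))) (at z within cball 0 1)"
    by (rule has_derivative_at_withinI[OF hom_poly_has_derivative[OF assms(1)]])
  show "onorm (\<lambda>u. of_nat k *s Q (u # replicate (k - 1) z)) \<le> of_nat k * form_norm k Q"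
  proof (rule onorm_le)
    fix u
    have "norm (Q (u # replicate (k - 1) z)) \<le> form_norm k Q * (norm u * norm z ^ (k - 1))"
      by (rule form_norm_bound_Cons[OF assms(1,2)])
    also have "\<dots> \<le> form_norm k Q * (norm u * 1)"
      using z form_norm_nonneg[OF assms(1)] by (intro mult_left_mono power_le_one) auto
    finally have "of_nat k * norm (Q (u # replicate (k - 1) z)) \<le> of_nat k * (form_norm k Q * norm u)"
      by (intro mult_left_mono) auto
    then show "norm (of_nat k *s Q (u # replicate (k - 1) z)) \<le> of_nat k * form_norm k Q * norm u"
      by (simp add: norm_vscale mult.assoc)
  qed
qed (use assms in auto)

text \<open>Polarization by differentiation: if the diagonal vanishes identically, so does its
  derivative, hence also the diagonal of the form with any first argument fixed, and the degree
  drops by one.\<close>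

lemma hom_poly_polarization:
  assumes "Q \<in> hom_poly k" "\<And>z. Q (replicate k z) = 0" "length ws = k"
  shows "Q ws = 0"
  using assms
proof (induction k arbitrary: Q ws)
  case 0
  then show ?case by simp
next
  case (Suc k)
  obtain w vs where ws: "ws = w # vs" "length vs = k" using Suc.prems(3) by (cases ws) auto
  have "Q (u # replicate k z) = 0" for u z
  proof -
    have "((\<lambda>z. Q (replicate (Suc k) z)) has_derivative (\<lambda>u. of_nat (Suc k) *s Q (u # replicate k z))) (at z)"
      using hom_poly_has_derivative[OF Suc.prems(1), of z] by simp
    moreover have "((\<lambda>z. Q (replicate (Suc k) z)) has_derivative (\<lambda>u. 0)) (at z)"
      unfolding Suc.prems(2) by simp
    ultimately have "(\<lambda>u. of_nat (Suc k) *s Q (u # replicate k z)) = (\<lambda>u. 0)"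
      by (rule has_derivative_unique)
    then have "of_nat (Suc k) *s Q (u # replicate k z) = 0" by (rule fun_cong)
    then show ?thesis by (simp del: of_nat_Suc)
  qed
  then show ?case
    using Suc.IH[OF hom_poly_Cons[OF Suc.prems(1)] _ ws(2)] ws(1) by simp
qed

section \<open>Homogeneous expansions\<close>

text \<open>The formal power series expansion identifies the coefficients with derivatives at 0, to
  which the Cauchy inequality applies.\<close>

lemma powser_coeff_bound:
  fixes a :: "nat \<Rightarrow> complex"
  assumes sums: "\<And>\<zeta>. norm \<zeta> < 1 \<Longrightarrow> (\<lambda>n. a n * \<zeta> ^ n) sums \<phi> \<zeta>"
    and r: "0 < r" "r < 1" and B: "\<And>\<zeta>. norm \<zeta> = r \<Longrightarrow> norm (\<phi> \<zeta>) \<le> B"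
  shows "norm (a k) \<le> B / r ^ k"
proof -
  have hol: "\<phi> holomorphic_on ball 0 1"
    by (rule power_series_holomorphic[of 0 1 a]) (use sums in simp)
  have "\<phi> has_fps_expansion Abs_fps a"
  proof (rule has_fps_expansionI)
    have "\<forall>\<^sub>F u in nhds (0 :: complex). u \<in> ball 0 1"
      by (rule eventually_nhds_in_open) auto
    then show "\<forall>\<^sub>F u in nhds 0. (\<lambda>n. fps_nth (Abs_fps a) n * u ^ n) sums \<phi> u"
      by eventually_elim (use sums in simp)
  qed
  from fps_nth_fps_expansion[OF this, of k] have "a k = (deriv ^^ k) \<phi> 0 / fact k"
    by simp
  moreover have "norm ((deriv ^^ k) \<phi> 0) \<le> fact k * B / r ^ k"
  proof (rule Cauchy_inequality)
    show "\<phi> holomorphic_on ball 0 r" using hol by (rule holomorphic_on_subset) (use r in auto)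
    have "\<phi> holomorphic_on cball 0 r" using hol by (rule holomorphic_on_subset) (use r in auto)
    then show "continuous_on (cball 0 r) \<phi>" by (rule holomorphic_on_imp_continuous_on)
  qed (use r B in auto)
  then have "norm ((deriv ^^ k) \<phi> 0) / fact k \<le> fact k * B / r ^ k / fact k"
    by (rule divide_right_mono) simp
  ultimately show ?thesis by (simp add: norm_divide)
qed

text \<open>\<open>tail_sum\<close> starts at degree 2, so the terms of degree 0 and 1 are prepended
  to obtain a full power series in \<zeta>.\<close>

lemma expansion_slice_sums:
  assumes P: "tail_convergent P" and f: "\<And>z. z \<in> ball 0 1 \<Longrightarrow> f z = A *v z + tail_sum P z"
    and u: "norm u = 1" and \<zeta>: "norm \<zeta> < 1"
  shows "(\<lambda>n. (if n = 0 then 0 else if n = 1 then cinner (A *v u) c else cinner (P n (replicate n u)) c) * \<zeta> ^ n)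
     sums cinner (f (\<zeta> *s u)) c"
proof -
  let ?a = "\<lambda>n. (if n = 0 then 0 else if n = 1 then cinner (A *v u) c else cinner (P n (replicate n u)) c) * \<zeta> ^ n"
  have z: "\<zeta> *s u \<in> ball 0 1" using u \<zeta> by (simp add: norm_vscale)
  have "(\<lambda>k. P (k + 2) (replicate (k + 2) (\<zeta> *s u))) sums tail_sum P (\<zeta> *s u)"
    unfolding tail_sum_def using P z unfolding tail_convergent_def by (intro summable_sums) blast
  from bounded_linear.sums[OF bounded_linear_cinner_left this]
  have "(\<lambda>k. cinner (P (k + 2) (replicate (k + 2) (\<zeta> *s u))) c) sums cinner (tail_sum P (\<zeta> *s u)) c" .
  moreover have "cinner (P (k + 2) (replicate (k + 2) (\<zeta> *s u))) c = ?a (k + 2)" for k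
  proof -
    have "P (k + 2) \<in> hom_poly (k + 2)" using P by (simp add: tail_convergent_def)
    from hom_poly_scale_diag[OF this, of \<zeta> u] show ?thesis
      by (simp only: cinner_vscale_left) simp
  qed
  ultimately have "(\<lambda>k. ?a (k + 2)) sums cinner (tail_sum P (\<zeta> *s u)) c" by simp
  then have "?a sums (cinner (tail_sum P (\<zeta> *s u)) c + (\<Sum>i<2. ?a i))"
    by (subst (asm) sums_iff_shift)
  also have "cinner (tail_sum P (\<zeta> *s u)) c + (\<Sum>i<2. ?a i) = cinner (f (\<zeta> *s u)) c"
    using f[OF z] by (simp add: numeral_2_eq_2 cinner_add_left matrix_vector_mult_vscale cinner_vscale_left)
  finally show ?thesis .
qed

lemma expansion_coeff_bound:
  assumes P: "tail_convergent P" and f: "\<And>z. z \<in> ball 0 1 \<Longrightarrow> f z = A *v z + tail_sum P z"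
    and r: "0 < r" "r < 1" and M: "\<And>z. norm z = r \<Longrightarrow> norm (f z) \<le> M" and k: "k \<ge> 2"
  shows "norm (P k (replicate k z)) \<le> M * (norm z / r) ^ k"
proof -
  have Pk: "P k \<in> hom_poly k" using P k by (simp add: tail_convergent_def)
  have unit: "norm (P k (replicate k u)) \<le> M / r ^ k" if u: "norm u = 1" for u
  proof (rule norm_le_cinnerI)
    have n: "norm (of_real r *s u) = r" using u r by (simp add: norm_vscale)
    have "0 \<le> M" using M[OF n] by (rule order_trans[OF norm_ge_zero])
    then show "0 \<le> M / r ^ k" using r by simp
    define c where "c = P k (replicate k u)"
    have "norm ((\<lambda>n. if n = 0 then 0 else if n = 1 then cinner (A *v u) c else cinner (P n (replicate n u)) c) k)
        \<le> (M * norm c) / r ^ k"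
    proof (rule powser_coeff_bound[OF _ r])
      show "(\<lambda>n. (if n = 0 then 0 else if n = 1 then cinner (A *v u) c else cinner (P n (replicate n u)) c) * \<zeta> ^ n)
         sums cinner (f (\<zeta> *s u)) c" if "norm \<zeta> < 1" for \<zeta>
        by (rule expansion_slice_sums[OF P f u that])
      show "norm (cinner (f (\<zeta> *s u)) c) \<le> M * norm c" if "norm \<zeta> = r" for \<zeta>
        by (rule order_trans[OF norm_cinner_le]) (intro mult_right_mono M, use that u in \<open>simp_all add: norm_vscale\<close>)
    qed
    then have "norm (cinner c c) \<le> M * norm c / r ^ k" using k by (simp add: c_def)
    then show "norm (cinner (P k (replicate k u)) (P k (replicate k u))) \<le> M / r ^ k * norm (P k (replicate k u))"
      by (simp add: c_def)
  qed
  show ?thesis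
  proof (cases "z = 0")
    case True
    have "P k (replicate k (0 *s z)) = 0 ^ k *s P k (replicate k z)" by (rule hom_poly_scale_diag[OF Pk])
    then have "P k (replicate k z) = 0" using True k by (simp add: zero_power)
    with True k show ?thesis by (simp add: zero_power)
  next
    case False
    define u where "u = of_real (1 / norm z) *s z"
    have u: "norm u = 1" "z = of_real (norm z) *s u"
      using False by (simp_all add: u_def norm_vscale norm_divide vector_smult_assoc)
    have "norm (P k (replicate k z)) = norm z ^ k * norm (P k (replicate k u))"
      using hom_poly_scale_diag[OF Pk, of "of_real (norm z)" u] u(2) by (simp add: norm_vscale norm_power)
    also have "\<dots> \<le> norm z ^ k * (M / r ^ k)" by (intro mult_left_mono unit u) simp
    finally show ?thesis by (simp add: power_divide mult.commute)
  qed
qed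

text \<open>The bound on the sphere of radius 1/2 makes the term of degree k at most M (2 |z|)^k.
  For |z| at most 1/4 the ratio is at most 1/2, and the geometric series contributes the factor
  2.\<close>

lemma expansion_tail_bound:
  assumes P: "tail_convergent P" and f: "\<And>z. z \<in> ball 0 1 \<Longrightarrow> f z = A *v z + tail_sum P z"
    and M: "\<And>z. norm z = 1 / 2 \<Longrightarrow> norm (f z) \<le> M" and j: "j \<ge> 1" and z: "norm z \<le> 1 / 4"
  shows "norm (f z - A *v z - (\<Sum>i=2..j. P i (replicate i z))) \<le> 2 * M * (2 * norm z) ^ (j + 1)"
proof -
  have zb: "z \<in> ball 0 1" using z by simp
  let ?p = "\<lambda>k. P (k + 2) (replicate (k + 2) z)"
  have sm: "summable ?p"
    using P zb by (simp add: tail_convergent_def)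
  have nP: "norm (P k (replicate k z)) \<le> M * (2 * norm z) ^ k" if "k \<ge> 2" for k
  proof -
    have "norm (P k (replicate k z)) \<le> M * (norm z / (1 / 2)) ^ k"
      by (rule expansion_coeff_bound[OF P f _ _ M that]) auto
    then show ?thesis by (simp add: mult.commute)
  qed
  have M0: "M \<ge> 0"
  proof -
    have "norm (axis undefined (1 / 2 :: complex) :: complex ^ 'a) = 1 / 2"
      by (simp add: norm_axis_complex norm_divide)
    from M[OF this] show ?thesis by (rule order_trans[OF norm_ge_zero])
  qed
  have r: "(\<Sum>i=2..Suc m. Q i) = (\<Sum>k<m. Q (k + 2))" for m and Q :: "nat \<Rightarrow> complex ^ 'a"
    by (induction m) auto
  have j1: "Suc (j - 1) = j" using j by simp
  have "(\<Sum>i=2..j. P i (replicate i z)) = (\<Sum>k<j - 1. ?p k)"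
    using r[where m = "j - 1" and Q = "\<lambda>i. P i (replicate i z)"] unfolding j1 .
  then have "f z - A *v z - (\<Sum>i=2..j. P i (replicate i z)) = (\<Sum>k. ?p (k + (j - 1)))"
    using f[OF zb] suminf_split_initial_segment[OF sm, of "j - 1"] by (simp add: tail_sum_def)
  also have "norm \<dots> \<le> (\<Sum>k. M * (2 * norm z) ^ (j + 1) * (2 * norm z) ^ k)"
  proof (rule norm_suminf_le)
    show "summable (\<lambda>k. M * (2 * norm z) ^ (j + 1) * (2 * norm z) ^ k)"
      by (intro summable_mult summable_geometric) (use z in simp)
    show "norm (?p (k + (j - 1))) \<le> M * (2 * norm z) ^ (j + 1) * (2 * norm z) ^ k" for k
    proof -
      have e: "k + (j - 1) + 2 = (j + 1) + k" using j by simp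
      have "norm (?p (k + (j - 1))) \<le> M * (2 * norm z) ^ ((j + 1) + k)"
        unfolding e by (rule nP) (use j in simp)
      then show ?thesis by (simp only: power_add mult.assoc)
    qed
  qed
  also have "\<dots> = M * (2 * norm z) ^ (j + 1) * (1 / (1 - 2 * norm z))"
    by (subst suminf_mult) (use z in \<open>simp_all add: suminf_geometric\<close>)
  also have "\<dots> \<le> M * (2 * norm z) ^ (j + 1) * 2"
    using z M0 by (intro mult_left_mono) (auto simp: divide_simps)
  finally show ?thesis by simp
qed

text \<open>Substituting a form of degree \<open>i\<close> into one slot of a form of degree
  \<open>j\<close> gives the degree \<open>k = i + j - 1\<close>; the sum over \<open>k\<close> and
  \<open>j\<close> becomes one over \<open>j\<close> and \<open>i\<close>.\<close>

lemma sum_triangle_reindex: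
  fixes X :: "nat \<Rightarrow> nat \<Rightarrow> 'a::comm_monoid_add"
  shows "(\<Sum>k=2..K. \<Sum>j=2..k - 1. X j (k - j + 1)) = (\<Sum>j=2..K. \<Sum>i=2..K - j + 1. X j i)"
proof -
  have "(\<Sum>k=2..K. \<Sum>j=2..k - 1. X j (k - j + 1)) = (\<Sum>p\<in>(SIGMA k:{2..K}. {2..k - 1}). X (snd p) (fst p - snd p + 1))"
    by (simp add: sum.Sigma case_prod_unfold)
  also have "\<dots> = (\<Sum>p\<in>(SIGMA j:{2..K}. {2..K - j + 1}). X (fst p) (snd p))"
    by (rule sum.reindex_bij_witness[where i = "\<lambda>p. (snd p + fst p - 1, fst p)" and j = "\<lambda>p. (snd p, fst p - snd p + 1)"])
       (auto simp: mem_Sigma_iff)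
  also have "\<dots> = (\<Sum>j=2..K. \<Sum>i=2..K - j + 1. X j i)"
    by (subst sum.Sigma) (auto simp: case_prod_unfold simp del: sum.cl_ivl_Suc)
  finally show ?thesis .
qed

text \<open>The coefficient equations are designed to cancel all terms of degree at most \<open>K\<close> in the
  derivative of \<open>e\<^sup>t\<^sup>A(w + \<Sum>F\<^sub>k(w\<^sup>k, t))\<close> along a trajectory.\<close>

definition chain_rate ::
  "complex ^ 'n ^ 'n \<Rightarrow> (nat \<Rightarrow> real \<Rightarrow> 'n::finite form) \<Rightarrow> (nat \<Rightarrow> real \<Rightarrow> 'n form) \<Rightarrow> nat \<Rightarrow> real \<Rightarrow>
   complex ^ 'n \<Rightarrow> complex ^ 'n \<Rightarrow> complex ^ 'n" where
  "chain_rate A H F K t y w = A *v (w + (\<Sum>k=2..K. F k t (replicate k w))) - y +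
     (\<Sum>k=2..K. B_op A k (F k t) w + N_term H F k t w - of_nat k *s F k t (y # replicate (k - 1) w))"

text \<open>When \<open>y\<close> is the value of the field at \<open>w\<close>, \<open>T j\<close>
  is its Taylor remainder after degree \<open>j\<close>. In the slot of a form of degree
  \<open>k\<close> the field is expanded only to degree \<open>K - k + 1\<close>, since a remainder
  of order \<open>K - k + 2\<close> together with \<open>k - 1\<close> factors \<open>w\<close>
  already has order \<open>K + 1\<close>.\<close>

lemma chain_rate_eq:
  fixes A :: "complex ^ 'n ^ 'n" and y w :: "complex ^ 'n" and H :: "nat \<Rightarrow> real \<Rightarrow> 'n form"
  assumes F: "\<And>k. k \<in> {2..K} \<Longrightarrow> F k t \<in> hom_poly k"
  defines "T \<equiv> \<lambda>j. y - A *v w - (\<Sum>i=2..j. H i t (replicate i w))"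
  shows "chain_rate A H F K t y w = - T K - (\<Sum>k=2..K. of_nat k *s F k t (T (K - k + 1) # replicate (k - 1) w))"
proof -
  let ?G = "\<lambda>k x. of_nat k *s F k t (x # replicate (k - 1) w)"
  have lin: "vlinear (?G k)" if "k \<in> {2..K}" for k
  proof -
    have l: "vlinear (\<lambda>x. F k t (x # replicate (k - 1) w))"
      using that by (intro hom_poly_vlinear_Cons[OF F[OF that]]) simp
    show ?thesis
      by (intro vlinearI) (simp_all only: vlinear_add[OF l] vlinear_scale[OF l] vector_add_ldistrib vector_smult_assoc mult.commute)
  qed
  have N: "(\<Sum>k=2..K. N_term H F k t w) = (\<Sum>k=2..K. H k t (replicate k w)) +
      (\<Sum>j=2..K. \<Sum>i=2..K - j + 1. ?G j (H i t (replicate i w)))"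
    unfolding N_term_def sum.distrib
    using sum_triangle_reindex[of "\<lambda>j i. ?G j (H i t (replicate i w))" K] by simp
  have G: "?G k (T (K - k + 1)) = ?G k y - ?G k (A *v w) - (\<Sum>i=2..K - k + 1. ?G k (H i t (replicate i w)))"
    if "k \<in> {2..K}" for k
  proof -
    have d: "?G k (x - x') = ?G k x - ?G k x'" for x x'
      using vlinear_add[OF lin[OF that], of "x - x'" x'] by (simp add: algebra_simps)
    have "?G k (T (K - k + 1)) = ?G k y - ?G k (A *v w) - ?G k (\<Sum>i=2..K - k + 1. H i t (replicate i w))"
      unfolding T_def d ..
    then show ?thesis by (simp only: vlinear_sum[OF lin[OF that]])
  qed
  have AF: "A *v (w + (\<Sum>k=2..K. F k t (replicate k w))) = A *v w + (\<Sum>k=2..K. A *v F k t (replicate k w))"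
    by (simp add: matrix_vector_right_distrib vec.linear_sum[OF matrix_vector_mul_linear_gen])
  have "chain_rate A H F K t y w = A *v w - y + (\<Sum>k=2..K. A *v F k t (replicate k w)) +
      ((\<Sum>k=2..K. ?G k (A *v w)) - (\<Sum>k=2..K. A *v F k t (replicate k w)) + (\<Sum>k=2..K. N_term H F k t w) - (\<Sum>k=2..K. ?G k y))"
    unfolding chain_rate_def AF B_op_def by (simp add: sum.distrib sum_subtractf)
  also have "\<dots> = - T K - (\<Sum>k=2..K. ?G k y - ?G k (A *v w) - (\<Sum>i=2..K - k + 1. ?G k (H i t (replicate i w))))"
    unfolding N sum_subtractf T_def by (simp add: algebra_simps)
  also have "(\<Sum>k=2..K. ?G k y - ?G k (A *v w) - (\<Sum>i=2..K - k + 1. ?G k (H i t (replicate i w)))) =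
     (\<Sum>k=2..K. ?G k (T (K - k + 1)))"
    by (rule sum.cong[OF refl]) (simp only: G)
  finally show ?thesis .
qed

text \<open>The bound is affine in \<open>c\<close>, so a bound for the forms that is polynomial in
  time passes to the rate with the same degree.\<close>

lemma chain_rate_bound:
  assumes F: "\<And>k. k \<in> {2..K} \<Longrightarrow> F k t \<in> hom_poly k \<and> form_norm k (F k t) \<le> c" and c: "c \<ge> 0"
    and H: "tail_convergent (\<lambda>k. H k t)"
    and f: "\<And>z. z \<in> ball 0 1 \<Longrightarrow> f z = A *v z + tail_sum (\<lambda>k. H k t) z"
    and M: "\<And>z. norm z = 1 / 2 \<Longrightarrow> norm (f z) \<le> M" "M \<ge> 0" and K: "K \<ge> 1" and w: "norm w \<le> 1 / 4"
  shows "norm (chain_rate A H F K t (f w) w) \<le> 2 * M * 2 ^ (K + 1) * (1 + real K ^ 2 * c) * norm w ^ (K + 1)"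
proof -
  define T where "T j = f w - A *v w - (\<Sum>i=2..j. H i t (replicate i w))" for j
  have T: "norm (T j) \<le> 2 * M * (2 * norm w) ^ (j + 1)" if "j \<ge> 1" for j
    unfolding T_def by (rule expansion_tail_bound[OF H f M(1) that w])
  have term_bound: "norm (of_nat k *s F k t (T (K - k + 1) # replicate (k - 1) w)) \<le> real K * (c * (2 * M * 2 ^ (K + 1) * norm w ^ (K + 1)))"
    if k: "k \<in> {2..K}" for k
  proof -
    have Fk: "F k t \<in> hom_poly k" "form_norm k (F k t) \<le> c" using F[OF k] by auto
    have e: "(K - k + 1 + 1) + (k - 1) = K + 1" using k by simp
    have "norm (F k t (T (K - k + 1) # replicate (k - 1) w)) \<le> form_norm k (F k t) * (norm (T (K - k + 1)) * norm w ^ (k - 1))"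
      by (rule form_norm_bound_Cons[OF Fk(1)]) (use k in simp)
    also have "\<dots> \<le> c * (2 * M * (2 * norm w) ^ (K - k + 1 + 1) * norm w ^ (k - 1))"
      by (intro mult_mono mult_right_mono T Fk) (use c in auto)
    also have "2 * M * (2 * norm w) ^ (K - k + 1 + 1) * norm w ^ (k - 1) = 2 * M * 2 ^ (K - k + 1 + 1) * norm w ^ (K + 1)"
      unfolding e[symmetric] by (simp only: power_mult_distrib power_add mult_ac)
    also have "c * \<dots> \<le> c * (2 * M * 2 ^ (K + 1) * norm w ^ (K + 1))"
      by (intro mult_left_mono mult_right_mono power_increasing) (use c M(2) k in auto)
    finally have "norm (F k t (T (K - k + 1) # replicate (k - 1) w)) \<le> c * (2 * M * 2 ^ (K + 1) * norm w ^ (K + 1))" .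
    moreover have "real k \<le> real K" using k by simp
    ultimately have "real k * norm (F k t (T (K - k + 1) # replicate (k - 1) w)) \<le> real K * (c * (2 * M * 2 ^ (K + 1) * norm w ^ (K + 1)))"
      by (intro mult_mono) auto
    then show ?thesis by (simp add: norm_vscale)
  qed
  have eq: "chain_rate A H F K t (f w) w = - T K - (\<Sum>k=2..K. of_nat k *s F k t (T (K - k + 1) # replicate (k - 1) w))"
    unfolding T_def by (rule chain_rate_eq) (use F in blast)
  have "norm (chain_rate A H F K t (f w) w) \<le> norm (T K) + norm (\<Sum>k=2..K. of_nat k *s F k t (T (K - k + 1) # replicate (k - 1) w))"
    unfolding eq by (rule order_trans[OF norm_triangle_ineq4]) simp
  also have "norm (\<Sum>k=2..K. of_nat k *s F k t (T (K - k + 1) # replicate (k - 1) w))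
      \<le> (\<Sum>k=2..K. real K * (c * (2 * M * 2 ^ (K + 1) * norm w ^ (K + 1))))"
    by (rule sum_norm_le) (rule term_bound)
  also have "\<dots> \<le> real K * (real K * (c * (2 * M * 2 ^ (K + 1) * norm w ^ (K + 1))))"
  proof -
    have "real (K - 1) * X \<le> real K * X" if "X \<ge> 0" for X using that by (intro mult_right_mono) auto
    moreover have "real K * (c * (2 * M * 2 ^ (K + 1) * norm w ^ (K + 1))) \<ge> 0" using c M(2) by simp
    ultimately show ?thesis by (simp only: sum_constant card_atLeastAtMost) simp
  qed
  also have "norm (T K) \<le> 2 * M * 2 ^ (K + 1) * norm w ^ (K + 1)"
    using T[OF K] by (simp only: power_mult_distrib mult.assoc)
  finally show ?thesis by (simp add: algebra_simps power2_eq_square)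
qed

section \<open>The transition mapping\<close>

text \<open>Null sets are made explicit so that finitely or countably many of them can be
  united.\<close>

lemma AE_lebesgue_on_atLeast:
  "(AE t in lebesgue_on {s..}. P t) \<longleftrightarrow> (\<exists>N. negligible N \<and> (\<forall>t\<ge>s. t \<notin> N \<longrightarrow> P t))" for s :: real
proof -
  have "(AE t in lebesgue_on {s..}. P t) \<longleftrightarrow> (AE t in lebesgue. t \<in> {s..} \<longrightarrow> P t)"
    by (rule AE_restrict_space_iff) simp
  also have "\<dots> \<longleftrightarrow> (\<exists>N. negligible N \<and> (\<forall>t\<ge>s. t \<notin> N \<longrightarrow> P t))"
  proof
    assume "AE t in lebesgue. t \<in> {s..} \<longrightarrow> P t"
    then obtain N where "N \<in> null_sets lebesgue" "{t \<in> space lebesgue. \<not> (t \<in> {s..} \<longrightarrow> P t)} \<subseteq> N"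
      unfolding eventually_ae_filter by blast
    then show "\<exists>N. negligible N \<and> (\<forall>t\<ge>s. t \<notin> N \<longrightarrow> P t)"
      by (intro exI[of _ N]) (auto simp: negligible_iff_null_sets)
  next
    assume "\<exists>N. negligible N \<and> (\<forall>t\<ge>s. t \<notin> N \<longrightarrow> P t)"
    then obtain N where "negligible N" "\<forall>t\<ge>s. t \<notin> N \<longrightarrow> P t" by blast
    then show "AE t in lebesgue. t \<in> {s..} \<longrightarrow> P t"
      by (intro AE_I'[of N]) (auto simp: negligible_iff_null_sets)
  qed
  finally show ?thesis .
qed

lemma ac_dist_bilinear:
  assumes B: "bounded_bilinear B"
    and f: "ac_dist a b (\<lambda>s t. norm (f t - f s))" "\<And>t. t \<in> {a..b} \<Longrightarrow> norm (f t) \<le> C"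
    and g: "ac_dist a b (\<lambda>s t. norm (g t - g s))" "\<And>t. t \<in> {a..b} \<Longrightarrow> norm (g t) \<le> C'"
  shows "ac_dist a b (\<lambda>s t. norm (B (f t) (g t) - B (f s) (g s)))"
proof -
  interpret bounded_bilinear B by (rule B)
  obtain K where K: "K \<ge> 0" "\<And>x y. norm (B x y) \<le> norm x * norm y * K"
    using nonneg_bounded by blast
  have "ac_dist a b (\<lambda>s t. \<bar>C'\<bar> * K * norm (f t - f s) + \<bar>C\<bar> * K * norm (g t - g s))"
    using K(1) by (intro ac_dist_add ac_dist_cmult f g) auto
  then show ?thesis
  proof (rule ac_dist_le)
    fix s t assume st: "a \<le> s" "s \<le> t" "t \<le> b"
    have "B (f t) (g t) - B (f s) (g s) = B (f t - f s) (g t) + B (f s) (g t - g s)"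
      by (simp add: diff_left diff_right)
    then have "norm (B (f t) (g t) - B (f s) (g s)) \<le> norm (B (f t - f s) (g t)) + norm (B (f s) (g t - g s))"
      using norm_triangle_ineq by metis
    also have "\<dots> \<le> norm (f t - f s) * norm (g t) * K + norm (f s) * norm (g t - g s) * K"
      by (intro add_mono K)
    also have "\<dots> \<le> norm (f t - f s) * \<bar>C'\<bar> * K + \<bar>C\<bar> * norm (g t - g s) * K"
      using f(2)[of s] g(2)[of t] st K(1) by (intro add_mono mult_right_mono mult_left_mono) auto
    finally show "norm (B (f t) (g t) - B (f s) (g s)) \<le> \<bar>C'\<bar> * K * norm (f t - f s) + \<bar>C\<bar> * K * norm (g t - g s)"
      by (simp add: mult_ac)
  qed
qed

locale loewner_transition =
  fixes A :: "complex ^ 'n ^ 'n" and h :: "complex ^ 'n \<Rightarrow> real \<Rightarrow> complex ^ 'n"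
    and v :: "complex ^ 'n \<Rightarrow> real \<Rightarrow> real \<Rightarrow> complex ^ 'n"
  assumes mA: "m_low A > 0" and h: "h \<in> class_H A" and v: "transition_mapping h v"
begin

lemma h_class_N: "t \<ge> 0 \<Longrightarrow> (\<lambda>z. h z t) \<in> class_N A"
  using h by (simp add: class_H_def)

lemma v_refl: "s \<ge> 0 \<Longrightarrow> norm z < 1 \<Longrightarrow> v z s s = z"
  using v by (simp add: transition_mapping_def)

lemma v_ball: "0 \<le> s \<Longrightarrow> s \<le> t \<Longrightarrow> norm z < 1 \<Longrightarrow> norm (v z s t) < 1"
  using v unfolding transition_mapping_def by fastforce

lemma v_zero: "0 \<le> s \<Longrightarrow> s \<le> t \<Longrightarrow> v 0 s t = 0"
  using v unfolding transition_mapping_def by blast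

lemma v_holo: "0 \<le> s \<Longrightarrow> s \<le> t \<Longrightarrow> holo_on (\<lambda>z. v z s t) (ball 0 1)"
  using v unfolding transition_mapping_def univalent_on_def by blast

lemma v_inj: "0 \<le> s \<Longrightarrow> s \<le> t \<Longrightarrow> inj_on (\<lambda>z. v z s t) (ball 0 1)"
  using v unfolding transition_mapping_def univalent_on_def by blast

lemma v_nonzero:
  assumes "0 \<le> s" "s \<le> t" "norm z < 1" "z \<noteq> 0"
  shows "v z s t \<noteq> 0"
  using inj_onD[OF v_inj[OF assms(1,2)], of z 0] v_zero[OF assms(1,2)] assms by auto

lemma v_lipschitz:
  assumes "0 \<le> s" "norm z < 1"
  shows "\<exists>L. \<forall>t\<ge>s. \<forall>t'\<ge>s. norm (v z s t' - v z s t) \<le> L * \<bar>t' - t\<bar>"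
proof -
  have "\<exists>L. \<forall>z\<in>{z}. L-lipschitz_on {s..} (\<lambda>t. v z s t)"
  proof -
    have "\<forall>s\<ge>0. \<forall>K. compact K \<and> K \<subseteq> ball 0 1 \<longrightarrow> (\<exists>L. \<forall>z\<in>K. L-lipschitz_on {s..} (\<lambda>t. v z s t))"
      using v unfolding transition_mapping_def by (elim conjE)
    from this[rule_format, OF assms(1), of "{z}"] show ?thesis using assms(2) by simp
  qed
  then obtain L where "L-lipschitz_on {s..} (\<lambda>t. v z s t)" by blast
  then show ?thesis
    by (intro exI[of _ L]) (auto simp: lipschitz_on_def dist_norm)
qed

lemma v_ac:
  assumes "0 \<le> s" "norm z < 1" "s \<le> a"
  shows "ac_dist a b (\<lambda>t t'. norm (v z s t' - v z s t))"
proof -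
  obtain L where L: "\<And>t t'. s \<le> t \<Longrightarrow> s \<le> t' \<Longrightarrow> norm (v z s t' - v z s t) \<le> L * \<bar>t' - t\<bar>"
    using v_lipschitz[OF assms(1,2)] by blast
  show ?thesis
  proof (rule ac_dist_lipschitz)
    fix t t' assume "a \<le> t" "t \<le> t'" "t' \<le> b"
    then show "norm (v z s t' - v z s t) \<le> L * (t' - t)"
      using L[of t t'] assms(3) by simp
  qed
qed

lemma v_derivative:
  assumes "0 \<le> s" "norm z < 1"
  obtains N where "negligible N"
    "\<And>t. s \<le> t \<Longrightarrow> t \<notin> N \<Longrightarrow> ((\<lambda>\<tau>. v z s \<tau>) has_vector_derivative - h (v z s t) t) (at t within {s..})"
  using v assms unfolding transition_mapping_def AE_lebesgue_on_atLeast by (meson mem_ball_0)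

lemma v_inner_derivative_bound:
  assumes "0 \<le> s" "s \<le> t" "norm z < 1"
  shows "v z s t \<bullet> h (v z s t) t \<ge> m_low A * (norm (v z s t))\<^sup>2 * ((1 - norm (v z s t)) / (1 + norm (v z s t)))"
    and "v z s t \<bullet> h (v z s t) t \<ge> 0"
proof -
  have t: "t \<ge> 0" using assms by simp
  note b = v_ball[OF assms]
  show 1: "v z s t \<bullet> h (v z s t) t \<ge> m_low A * (norm (v z s t))\<^sup>2 * ((1 - norm (v z s t)) / (1 + norm (v z s t)))"
    using class_N_cinner_bounds(1)[OF h_class_N[OF t] mA b] by (simp add: Re_cinner inner_commute)
  have "m_low A * (norm (v z s t))\<^sup>2 * ((1 - norm (v z s t)) / (1 + norm (v z s t))) \<ge> 0"
    using mA b by (intro mult_nonneg_nonneg divide_nonneg_nonneg) auto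
  with 1 show "v z s t \<bullet> h (v z s t) t \<ge> 0" by linarith
qed

text \<open>The squared norm has the derivative -2 Re <h(v), v>, which is nonpositive.\<close>

lemma v_norm_antimono:
  assumes "0 \<le> s" "s \<le> a" "a \<le> b" "norm z < 1"
  shows "norm (v z s b) \<le> norm (v z s a)"
proof -
  obtain N where N: "negligible N"
    "\<And>t. s \<le> t \<Longrightarrow> t \<notin> N \<Longrightarrow> ((\<lambda>\<tau>. v z s \<tau>) has_vector_derivative - h (v z s t) t) (at t within {s..})"
    using v_derivative[OF assms(1,4)] by blast
  let ?f = "\<lambda>t. v z s t \<bullet> v z s t"
  have "?f b \<le> ?f a"
  proof (rule ac_nonincreasing[OF assms(3) _ N(1)])
    have "norm (v z s t) \<le> 1" if "t \<in> {a..b}" for t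
      using v_ball[of s t z] that assms by auto
    then have "ac_dist a b (\<lambda>s' t. norm (?f t - ?f s'))"
      by (intro ac_dist_bilinear[OF bounded_bilinear_inner, where C = 1 and C' = 1] v_ac assms) auto
    then show "ac_dist a b (\<lambda>s' t. \<bar>?f t - ?f s'\<bar>)" by simp
    fix t assume t: "t \<in> {a..b} - N"
    have "((\<lambda>\<tau>. v z s \<tau>) has_vector_derivative - h (v z s t) t) (at t within {a..b})"
      by (rule has_vector_derivative_within_subset[OF N(2)[of t]]) (use t assms in auto)
    from bounded_bilinear.has_vector_derivative[OF bounded_bilinear_inner this this]
    have "(?f has_vector_derivative - 2 * (v z s t \<bullet> h (v z s t) t)) (at t within {a..b})"
      by (simp add: inner_commute)
    moreover have "- 2 * (v z s t \<bullet> h (v z s t) t) \<le> 0"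
      using v_inner_derivative_bound(2)[of s t z] t assms by auto
    ultimately show "\<exists>D\<le>0. (?f has_vector_derivative D) (at t within {a..b})" by blast
  qed
  then show ?thesis by (simp add: norm_le)
qed

lemma v_norm_le: "0 \<le> s \<Longrightarrow> s \<le> t \<Longrightarrow> norm z < 1 \<Longrightarrow> norm (v z s t) \<le> norm z"
  using v_norm_antimono[of s s t z] by (simp add: v_refl)

text \<open>The function is the logarithm of the Koebe function x / (1 - x)^2. Its Lipschitz bound
  on compact subintervals of (0, 1) transfers absolute continuity from the trajectory to it.\<close>

lemma koebe_log_lipschitz:
  fixes \<alpha> \<beta> :: real
  assumes "0 < \<alpha>" "\<beta> < 1" "x \<in> {\<alpha>..\<beta>}" "y \<in> {\<alpha>..\<beta>}"
  shows "norm ((ln y - 2 * ln (1 - y)) - (ln x - 2 * ln (1 - x))) \<le> (1 / \<alpha> + 2 / (1 - \<beta>)) * norm (y - x)"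
proof (rule field_differentiable_bound[of "{\<alpha>..\<beta>}" _ "\<lambda>x. 1 / x + 2 / (1 - x)"])
  fix x assume x: "x \<in> {\<alpha>..\<beta>}"
  then show "((\<lambda>x. ln x - 2 * ln (1 - x)) has_field_derivative 1 / x + 2 / (1 - x)) (at x within {\<alpha>..\<beta>})"
    using assms by (auto intro!: derivative_eq_intros simp: divide_simps)
  have "1 / x \<le> 1 / \<alpha>" "2 / (1 - x) \<le> 2 / (1 - \<beta>)" "0 \<le> 1 / x" "0 \<le> 2 / (1 - x)"
    using x assms by (auto intro!: divide_left_mono mult_pos_pos)
  then show "norm (1 / x + 2 / (1 - x)) \<le> 1 / \<alpha> + 2 / (1 - \<beta>)" by simp
qed (use assms in auto)

text \<open>The logarithmic derivative (1 + x) / (x (1 - x)) of the Koebe function exactly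
  compensates the Harnack factor (1 - x) / (1 + x) in the lower bound for the pairing, so the
  logarithm plus \<open>m_low A * t\<close> does not increase. By injectivity the trajectory of a
  nonzero point never meets 0, and the logarithm stays finite.\<close>

lemma v_koebe_bound:
  assumes "0 \<le> s" "s \<le> T" "norm z < 1"
  shows "norm (v z s T) / (1 - norm (v z s T))\<^sup>2 \<le> exp (- (m_low A * (T - s))) * (norm z / (1 - norm z)\<^sup>2)"
proof (cases "z = 0")
  case True
  then show ?thesis using v_zero[OF assms(1,2)] by simp
next
  case False
  obtain N where N: "negligible N"
    "\<And>t. s \<le> t \<Longrightarrow> t \<notin> N \<Longrightarrow> ((\<lambda>\<tau>. v z s \<tau>) has_vector_derivative - h (v z s t) t) (at t within {s..})"
    using v_derivative[OF assms(1,3)] by blast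
  define \<alpha> where "\<alpha> = norm (v z s T)"
  have \<alpha>: "\<alpha> > 0" using v_nonzero[OF assms False] by (simp add: \<alpha>_def)
  have rng: "norm (v z s t) \<in> {\<alpha>..norm z}" if "t \<in> {s..T}" for t
    using v_norm_antimono[of s t T z] v_norm_le[of s t z] that assms by (auto simp: \<alpha>_def)
  let ?G = "\<lambda>x :: real. ln x - 2 * ln (1 - x)"
  let ?f = "\<lambda>t. ?G (norm (v z s t)) + m_low A * t"
  have "?f T \<le> ?f s"
  proof (rule ac_nonincreasing[OF assms(2) _ N(1)])
    have "ac_dist s T (\<lambda>t t'. (1 / \<alpha> + 2 / (1 - norm z)) * norm (v z s t' - v z s t) + m_low A * (t' - t))"
      using \<alpha> assms mA by (intro ac_dist_add ac_dist_cmult ac_dist_length v_ac) auto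
    then show "ac_dist s T (\<lambda>t t'. \<bar>?f t' - ?f t\<bar>)"
    proof (rule ac_dist_le)
      fix t t' assume t: "s \<le> t" "t \<le> t'" "t' \<le> T"
      have "norm (?G (norm (v z s t')) - ?G (norm (v z s t))) \<le> (1 / \<alpha> + 2 / (1 - norm z)) * norm (norm (v z s t') - norm (v z s t))"
        by (rule koebe_log_lipschitz[OF \<alpha> assms(3) rng rng]) (use t in auto)
      also have "\<dots> \<le> (1 / \<alpha> + 2 / (1 - norm z)) * norm (v z s t' - v z s t)"
        using \<alpha> assms norm_triangle_ineq3 by (intro mult_left_mono) auto
      finally have G: "\<bar>?G (norm (v z s t')) - ?G (norm (v z s t))\<bar> \<le> (1 / \<alpha> + 2 / (1 - norm z)) * norm (v z s t' - v z s t)"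
        by simp
      have "?f t' - ?f t = (?G (norm (v z s t')) - ?G (norm (v z s t))) + m_low A * (t' - t)"
        by (simp add: algebra_simps)
      moreover have "\<bar>m_low A * (t' - t)\<bar> = m_low A * (t' - t)" using t mA by simp
      ultimately show "\<bar>?f t' - ?f t\<bar> \<le> (1 / \<alpha> + 2 / (1 - norm z)) * norm (v z s t' - v z s t) + m_low A * (t' - t)"
        using G abs_triangle_ineq[of "?G (norm (v z s t')) - ?G (norm (v z s t))" "m_low A * (t' - t)"] by linarith
    qed
    fix t assume t: "t \<in> {s..T} - N"
    define \<rho> where "\<rho> = norm (v z s t)"
    have \<rho>: "0 < \<rho>" "\<rho> < 1" using rng[of t] t \<alpha> assms by (auto simp: \<rho>_def)
    have nz: "v z s t \<noteq> 0" using \<rho> by (auto simp: \<rho>_def)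
    define y where "y = v z s t \<bullet> h (v z s t) t / \<rho>"
    have dv: "((\<lambda>\<tau>. v z s \<tau>) has_vector_derivative - h (v z s t) t) (at t within {s..T})"
      by (rule has_vector_derivative_within_subset[OF N(2)[of t]]) (use t in auto)
    have "((\<lambda>\<tau>. norm (v z s \<tau>)) has_derivative (\<lambda>x. sgn (v z s t) \<bullet> (x *\<^sub>R - h (v z s t) t))) (at t within {s..T})"
      using has_derivative_compose[OF dv[unfolded has_vector_derivative_def] has_derivative_norm[OF nz]]
      by (simp add: inner_commute)
    moreover have "(\<lambda>x. sgn (v z s t) \<bullet> (x *\<^sub>R - h (v z s t) t)) = (\<lambda>x. (- y) * x)"
      by (rule ext) (simp add: y_def sgn_div_norm \<rho>_def divide_inverse mult_ac)
    ultimately have dn: "((\<lambda>\<tau>. norm (v z s \<tau>)) has_real_derivative - y) (at t within {s..T})"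
      unfolding has_field_derivative_def
      by (rule back_subst[of "\<lambda>f. ((\<lambda>\<tau>. norm (v z s \<tau>)) has_derivative f) (at t within {s..T})"])
    have "((\<lambda>\<tau>. ?f \<tau>) has_real_derivative (- y) * (1 / \<rho> + 2 / (1 - \<rho>)) + m_low A) (at t within {s..T})"
      using \<rho> by (auto intro!: derivative_eq_intros dn simp: \<rho>_def[symmetric] divide_simps algebra_simps)
    moreover have "(- y) * (1 / \<rho> + 2 / (1 - \<rho>)) + m_low A \<le> 0"
    proof -
      have "m_low A * \<rho>\<^sup>2 * ((1 - \<rho>) / (1 + \<rho>)) / \<rho> \<le> y"
        unfolding y_def using v_inner_derivative_bound(1)[of s t z] t assms \<rho>
        by (intro divide_right_mono) (auto simp: \<rho>_def)
      then have "(m_low A * \<rho>\<^sup>2 * ((1 - \<rho>) / (1 + \<rho>)) / \<rho>) * (1 / \<rho> + 2 / (1 - \<rho>)) \<le> y * (1 / \<rho> + 2 / (1 - \<rho>))"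
        using \<rho> by (intro mult_right_mono) auto
      moreover have "(m_low A * \<rho>\<^sup>2 * ((1 - \<rho>) / (1 + \<rho>)) / \<rho>) * (1 / \<rho> + 2 / (1 - \<rho>)) = m_low A"
      proof -
        have "1 / \<rho> + 2 / (1 - \<rho>) = (1 + \<rho>) / (\<rho> * (1 - \<rho>))"
          using \<rho> by (simp add: divide_simps)
        then show ?thesis using \<rho> by (simp add: power2_eq_square)
      qed
      ultimately show ?thesis by simp
    qed
    ultimately show "\<exists>D\<le>0. (?f has_vector_derivative D) (at t within {s..T})"
      unfolding has_real_derivative_iff_has_vector_derivative by blast
  qed
  then have "?G (norm (v z s T)) \<le> - (m_low A * (T - s)) + ?G (norm z)"
    using v_refl[OF assms(1,3)] by (simp add: algebra_simps)
  then have *: "exp (?G (norm (v z s T))) \<le> exp (- (m_low A * (T - s)) + ?G (norm z))"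
    by (simp only: exp_le_cancel_iff)
  have G: "exp (?G x) = x / (1 - x)\<^sup>2" if "0 < x" "x < 1" for x
    using that by (simp add: exp_diff exp_double)
  have "exp (?G (norm (v z s T))) = norm (v z s T) / (1 - norm (v z s T))\<^sup>2"
    using \<alpha> v_ball[OF assms] by (intro G) (simp_all add: \<alpha>_def)
  moreover have "exp (- (m_low A * (T - s)) + ?G (norm z)) = exp (- (m_low A * (T - s))) * (norm z / (1 - norm z)\<^sup>2)"
    unfolding exp_add by (subst G) (use False assms in auto)
  ultimately show ?thesis using * by metis
qed

lemma v_decay:
  assumes "0 \<le> s" "s \<le> t" "norm z < 1"
  shows "norm (v z s t) \<le> exp (- (m_low A * (t - s))) * (norm z / (1 - norm z)\<^sup>2)"
proof -
  have b: "norm (v z s t) < 1" by (rule v_ball[OF assms])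
  have "norm (v z s t) / 1 \<le> norm (v z s t) / (1 - norm (v z s t))\<^sup>2"
    using b by (intro divide_left_mono) (auto simp: power_le_one)
  with v_koebe_bound[OF assms] show ?thesis by simp
qed

lemma h_bound:
  assumes "t \<ge> 0" "norm z \<le> r" "r < 1"
  shows "norm (h z t) \<le> 8 * norm A / (1 - r)\<^sup>2"
proof -
  have "norm (h z t) \<le> 8 * norm A / (1 - norm z)\<^sup>2"
    using class_N_norm_bound[OF h_class_N[OF assms(1)] mA] assms by simp
  also have "\<dots> \<le> 8 * norm A / (1 - r)\<^sup>2"
    using assms by (intro divide_left_mono power_mono mult_pos_pos) auto
  finally show ?thesis .
qed

lemma h_lipschitz:
  assumes "t \<ge> 0" "norm x \<le> r" "norm y \<le> r" "r < 1"
  shows "norm (h x t - h y t) \<le> 64 * norm A / (1 - r) ^ 3 * norm (x - y)"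
proof -
  \<comment> \<open>Both \<open>1 - ?r'\<close> and \<open>?r' - r\<close> equal (1 - r)/2, so the
    constant is 8 times 4 times 2.\<close>
  let ?r' = "(1 + r) / 2"
  have "norm (h x t - h y t) \<le> (8 * norm A / (1 - ?r')\<^sup>2) / (?r' - r) * norm (x - y)"
  proof (rule cauchy_lipschitz[of "\<lambda>z. h z t" "ball 0 1" 0])
    show "holo_on (\<lambda>z. h z t) (ball 0 1)" using h_class_N[OF assms(1)] by (simp add: class_N_def)
    show "norm (h w t) \<le> 8 * norm A / (1 - ?r')\<^sup>2" if "w \<in> cball 0 ?r'" for w
      using that assms by (intro h_bound) auto
  qed (use assms in auto)
  also have "(8 * norm A / (1 - ?r')\<^sup>2) / (?r' - r) = 64 * norm A / (1 - r) ^ 3"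
  proof -
    have e: "1 - ?r' = (1 - r) / 2" "?r' - r = (1 - r) / 2" by (auto simp: field_simps)
    show ?thesis unfolding e by (simp add: power2_eq_square power3_eq_cube)
  qed
  finally show ?thesis .
qed

lemma v_move:
  assumes "0 \<le> s" "s \<le> t" "t \<le> t'" "norm z \<le> r" "r < 1"
  shows "norm (v z s t' - v z s t) \<le> 8 * norm A / (1 - r)\<^sup>2 * (t' - t)"
proof -
  have z: "norm z < 1" using assms by simp
  obtain N where N: "negligible N"
    "\<And>t. s \<le> t \<Longrightarrow> t \<notin> N \<Longrightarrow> ((\<lambda>\<tau>. v z s \<tau>) has_vector_derivative - h (v z s t) t) (at t within {s..})"
    using v_derivative[OF assms(1) z] by blast
  define M where "M = 8 * norm A / (1 - r)\<^sup>2"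
  have "norm (v z s t' - v z s t) \<le> M * t' - M * t"
  proof (rule ac_bound_by_derivative[OF assms(3) _ N(1)])
    show "ac_dist t t' (\<lambda>a b. norm (v z s b - v z s a))" by (rule v_ac[OF assms(1) z assms(2)])
    fix \<tau> assume \<tau>: "\<tau> \<in> {t..t'} - N"
    have "norm (v z s \<tau>) \<le> r" using v_norm_le[of s \<tau> z] \<tau> assms z by auto
    then have "norm (- h (v z s \<tau>) \<tau>) \<le> M" using h_bound[of \<tau> "v z s \<tau>" r] \<tau> assms by (auto simp: M_def)
    moreover have "((\<lambda>\<tau>. v z s \<tau>) has_vector_derivative - h (v z s \<tau>) \<tau>) (at \<tau> within {t..t'})"
      by (rule has_vector_derivative_within_subset[OF N(2)[of \<tau>]]) (use \<tau> assms in auto)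
    ultimately show "\<exists>D. norm D \<le> M \<and> ((\<lambda>\<tau>. v z s \<tau>) has_vector_derivative D) (at \<tau> within {t..t'})" by blast
  next
    fix \<tau> assume "\<tau> \<in> {t..t'}"
    show "((\<lambda>\<tau>. M * \<tau>) has_vector_derivative M) (at \<tau> within {t..t'})"
      by (auto intro!: derivative_eq_intros simp flip: has_real_derivative_iff_has_vector_derivative)
  qed auto
  then show ?thesis unfolding M_def[symmetric] by (simp only: right_diff_distrib)
qed

text \<open>Uniqueness by a Gronwall argument: both sides solve the same equation and agree at time
  \<open>u\<close>, and exp(-2Lt) times their squared distance does not increase. Since norms
  decrease along trajectories, one Lipschitz constant of \<open>h\<close> on the ball of radius
  \<open>norm z\<close> suffices.\<close>

lemma v_semigroup:
  assumes "0 \<le> s" "s \<le> u" "u \<le> T" "norm z < 1"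
  shows "v (v z s u) u T = v z s T"
proof -
  have u0: "0 \<le> u" using assms by simp
  have zu: "norm (v z s u) < 1" using v_ball assms by blast
  obtain N1 where N1: "negligible N1"
    "\<And>t. s \<le> t \<Longrightarrow> t \<notin> N1 \<Longrightarrow> ((\<lambda>\<tau>. v z s \<tau>) has_vector_derivative - h (v z s t) t) (at t within {s..})"
    using v_derivative[OF assms(1,4)] by blast
  obtain N2 where N2: "negligible N2"
    "\<And>t. u \<le> t \<Longrightarrow> t \<notin> N2 \<Longrightarrow> ((\<lambda>\<tau>. v (v z s u) u \<tau>) has_vector_derivative - h (v (v z s u) u t) t) (at t within {u..})"
    using v_derivative[OF u0 zu] by blast
  define L where "L = 64 * norm A / (1 - norm z) ^ 3"
  have L: "L \<ge> 0" using assms by (simp add: L_def)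
  define d where "d t = v z s t - v (v z s u) u t" for t
  let ?E = "\<lambda>t. exp (- (2 * L * t))"
  let ?f = "\<lambda>t. ?E t * (d t \<bullet> d t)"
  have nx: "norm (v z s t) \<le> norm z" "norm (v (v z s u) u t) \<le> norm z" if "t \<in> {u..T}" for t
    using v_norm_le[of s t z] v_norm_le[of u t "v z s u"] v_norm_le[of s u z] that assms u0 zu by auto
  have nd: "norm (d t) \<le> 2" if "t \<in> {u..T}" for t
    using nx[OF that] norm_triangle_ineq4[of "v z s t" "v (v z s u) u t"] assms(4) by (simp add: d_def)
  have "?f T \<le> ?f u"
  proof (rule ac_nonincreasing[OF assms(3) _ negligible_Un[OF N1(1) N2(1)]])
    have acd: "ac_dist u T (\<lambda>a b. norm (d b - d a))"
    proof (rule ac_dist_le[OF ac_dist_add[OF v_ac v_ac]])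
      fix a b :: real
      show "norm (d b - d a) \<le> norm (v z s b - v z s a) + norm (v (v z s u) u b - v (v z s u) u a)"
        unfolding d_def using norm_triangle_ineq4[of "v z s b - v z s a" "v (v z s u) u b - v (v z s u) u a"]
        by (simp add: algebra_simps)
    qed (use assms u0 zu in auto)
    have acE: "ac_dist u T (\<lambda>a b. norm (?E b - ?E a))"
    proof (rule ac_dist_C1)
      show "(?E has_vector_derivative - 2 * L * ?E t) (at t within {u..T})" for t
        by (auto intro!: derivative_eq_intros simp flip: has_real_derivative_iff_has_vector_derivative)
    qed (intro continuous_intros)
    have acdd: "ac_dist u T (\<lambda>a b. norm (d b \<bullet> d b - d a \<bullet> d a))"
      by (rule ac_dist_bilinear[OF bounded_bilinear_inner acd nd acd nd])
    have "ac_dist u T (\<lambda>a b. norm (?f b - ?f a))"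
    proof (rule ac_dist_bilinear[OF bounded_bilinear_mult acE _ acdd])
      show "norm (?E t) \<le> 1" if "t \<in> {u..T}" for t using that L u0 by simp
      show "norm (d t \<bullet> d t) \<le> 4" if "t \<in> {u..T}" for t
        using power_mono[OF nd[OF that], of 2] by (simp add: dot_square_norm)
    qed
    then show "ac_dist u T (\<lambda>a b. \<bar>?f b - ?f a\<bar>)" by simp
    fix t assume t: "t \<in> {u..T} - (N1 \<union> N2)"
    let ?y = "- h (v z s t) t + h (v (v z s u) u t) t"
    have d1: "((\<lambda>\<tau>. v z s \<tau>) has_vector_derivative - h (v z s t) t) (at t within {u..T})"
      by (rule has_vector_derivative_within_subset[OF N1(2)[of t]]) (use t assms in auto)
    have d2: "((\<lambda>\<tau>. v (v z s u) u \<tau>) has_vector_derivative - h (v (v z s u) u t) t) (at t within {u..T})"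
      by (rule has_vector_derivative_within_subset[OF N2(2)[of t]]) (use t assms in auto)
    have dd: "(d has_vector_derivative ?y) (at t within {u..T})"
      unfolding d_def using has_vector_derivative_diff[OF d1 d2] by simp
    have ddd: "((\<lambda>t. d t \<bullet> d t) has_vector_derivative 2 * (d t \<bullet> ?y)) (at t within {u..T})"
      using bounded_bilinear.has_vector_derivative[OF bounded_bilinear_inner dd dd] by (simp add: inner_commute)
    have dE: "(?E has_vector_derivative - 2 * L * ?E t) (at t within {u..T})"
      by (auto intro!: derivative_eq_intros simp flip: has_real_derivative_iff_has_vector_derivative)
    have "(?f has_vector_derivative ?E t * (2 * (d t \<bullet> ?y)) + (- 2 * L * ?E t) * (d t \<bullet> d t)) (at t within {u..T})"
      using bounded_bilinear.has_vector_derivative[OF bounded_bilinear_mult dE ddd] by simp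
    moreover have "?E t * (2 * (d t \<bullet> ?y)) + (- 2 * L * ?E t) * (d t \<bullet> d t) \<le> 0"
    proof -
      have "norm (h (v z s t) t - h (v (v z s u) u t) t) \<le> L * norm (d t)"
        unfolding L_def d_def by (rule h_lipschitz) (use t u0 nx[of t] assms in auto)
      then have ny: "norm ?y \<le> L * norm (d t)"
        by (metis norm_minus_commute uminus_add_conv_diff)
      have "d t \<bullet> ?y \<le> norm (d t) * norm ?y" by (rule norm_cauchy_schwarz)
      also have "\<dots> \<le> norm (d t) * (L * norm (d t))" by (rule mult_left_mono[OF ny]) simp
      also have "\<dots> = L * (d t \<bullet> d t)" by (simp add: dot_square_norm power2_eq_square)
      finally have "?E t * (2 * (d t \<bullet> ?y)) \<le> ?E t * (2 * (L * (d t \<bullet> d t)))"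
        by (intro mult_left_mono) auto
      then show ?thesis by (simp add: mult_ac)
    qed
    ultimately show "\<exists>D\<le>0. (?f has_vector_derivative D) (at t within {u..T})" by blast
  qed
  also have "?f u = 0" using v_refl[OF u0 zu] by (simp add: d_def)
  finally have "d T \<bullet> d T \<le> 0" by (simp add: mult_le_0_iff)
  then have "d T = 0" by (metis inner_ge_zero inner_eq_zero_iff order_antisym)
  then show ?thesis by (simp add: d_def)
qed

end

section \<open>The approximating mappings\<close>

text \<open>At a unit eigenvector the quadratic form minimized by \<open>m_low A\<close> takes the
  real part of the eigenvalue as its value.\<close>

lemma m_low_le_k_plus: "m_low A \<le> k_plus A" for A :: "complex ^ 'n ^ 'n"
proof -
  obtain l where l: "l \<in> spectrum A" using spectrum_finite_nonempty(2)[of A] by blast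
  then obtain x where x: "x \<noteq> 0" "A *v x = l *s x" by (auto simp: spectrum_def)
  define u where "u = of_real (1 / norm x) *s x"
  have u: "norm u = 1" using x by (simp add: u_def norm_vscale norm_divide)
  have "A *v u = l *s u"
    by (simp add: u_def matrix_vector_mult_vscale x vector_smult_assoc mult.commute)
  then have "Re (cinner (A *v u) u) = Re l"
    by (simp add: cinner_vscale_left cinner_self u)
  with m_low_le[OF u, of A] Re_le_k_plus[OF l] show ?thesis by simp
qed

lemma n0_ge_1:
  assumes "m_low A > 0"
  shows "n0 A \<ge> 1"
proof -
  have "1 \<le> k_plus A / m_low A" using m_low_le_k_plus[of A] assms by simp
  then have "1 \<le> \<lfloor>k_plus A / m_low A\<rfloor>" by (simp add: le_floor_iff)
  then show ?thesis unfolding n0_def by linarith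
qed

text \<open>The strict gap on which all convergence rests. The quotient is at least 1, so
  \<open>nat\<close> in \<open>n0\<close> truncates nothing.\<close>

lemma k_plus_less:
  assumes "m_low A > 0"
  shows "k_plus A < (real (n0 A) + 1) * m_low A"
proof -
  have "1 \<le> k_plus A / m_low A" using m_low_le_k_plus[of A] assms by simp
  then have "0 \<le> \<lfloor>k_plus A / m_low A\<rfloor>" by (simp add: le_floor_iff)
  then have "real (n0 A) = of_int \<lfloor>k_plus A / m_low A\<rfloor>" unfolding n0_def by simp
  then have "k_plus A / m_low A < real (n0 A) + 1" using floor_correct[of "k_plus A / m_low A"] by linarith
  then show ?thesis using assms by (simp add: divide_less_eq)
qed

lemma power_le_fact_exp: "x ^ d \<le> fact d * exp x" if "x \<ge> 0" for x :: real
proof -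
  have "(\<lambda>n. x ^ n /\<^sub>R fact n) sums exp x" by (rule exp_converges)
  then have "(\<Sum>n\<in>{d}. x ^ n /\<^sub>R fact n) \<le> exp x"
    using that by (metis (no_types, lifting) sums_unique sums_summable sum_le_suminf[of "\<lambda>n. x ^ n /\<^sub>R fact n" "{d}"]
      finite.emptyI finite.insertI scaleR_nonneg_nonneg inverse_nonnegative_iff_nonnegative fact_ge_zero zero_le_power)
  then show ?thesis by (simp add: divide_simps mult.commute)
qed

lemma power_exp_bound:
  assumes "\<eta> > 0"
  obtains C :: real where "C > 0" "\<And>\<tau>. \<tau> \<ge> 0 \<Longrightarrow> 1 + \<tau> ^ d \<le> C * exp (\<eta> * \<tau>)"
proof
  show "1 + fact d / \<eta> ^ d > 0" using assms by (simp add: add_pos_nonneg)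
  fix \<tau> :: real assume t: "\<tau> \<ge> 0"
  have "(\<eta> * \<tau>) ^ d \<le> fact d * exp (\<eta> * \<tau>)" using t assms by (intro power_le_fact_exp) simp
  then have "\<tau> ^ d \<le> fact d / \<eta> ^ d * exp (\<eta> * \<tau>)"
    using assms by (simp add: power_mult_distrib field_simps)
  moreover have "1 \<le> exp (\<eta> * \<tau>)" using t assms by simp
  moreover have "(1 + fact d / \<eta> ^ d) * exp (\<eta> * \<tau>) = exp (\<eta> * \<tau>) + fact d / \<eta> ^ d * exp (\<eta> * \<tau>)"
    by (simp add: distrib_right)
  ultimately show "1 + \<tau> ^ d \<le> (1 + fact d / \<eta> ^ d) * exp (\<eta> * \<tau>)"
    by linarith
qed

text \<open>Separates the starting time \<open>s\<close> from the elapsed time \<tau>: the factor in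
  \<open>s\<close> survives with its degree, while the factor in \<tau> is later absorbed by an
  exponential.\<close>

lemma one_plus_power_add_le:
  fixes s \<tau> :: real
  assumes "s \<ge> 0" "\<tau> \<ge> 0"
  shows "1 + (s + \<tau>) ^ d \<le> 2 ^ d * (1 + s ^ d) * (1 + \<tau> ^ d)"
proof -
  have "(s + \<tau>) ^ d \<le> (2 * max s \<tau>) ^ d" using assms by (intro power_mono) auto
  also have "\<dots> = 2 ^ d * max s \<tau> ^ d" by (rule power_mult_distrib)
  also have "max s \<tau> ^ d \<le> s ^ d + \<tau> ^ d" using assms by (cases "s \<le> \<tau>") (auto simp: max_def)
  finally have "(s + \<tau>) ^ d \<le> 2 ^ d * (s ^ d + \<tau> ^ d)" by simp
  moreover have "(1 :: real) \<le> 2 ^ d" by simp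
  moreover have "2 ^ d * (1 + s ^ d + \<tau> ^ d) = 2 ^ d + 2 ^ d * (s ^ d + \<tau> ^ d)" by (simp add: distrib_left)
  ultimately have "1 + (s + \<tau>) ^ d \<le> 2 ^ d * (1 + s ^ d + \<tau> ^ d)" by linarith
  also have "\<dots> \<le> 2 ^ d * ((1 + s ^ d) * (1 + \<tau> ^ d))"
    using assms by (intro mult_left_mono) (auto simp: algebra_simps)
  finally show ?thesis by (simp add: mult.assoc)
qed

lemma has_vector_derivative_zeroI:
  fixes r :: "real \<Rightarrow> 'a::real_normed_vector"
  assumes "\<And>\<epsilon>. \<epsilon> > 0 \<Longrightarrow> \<exists>\<delta>>0. \<forall>\<tau>\<in>S. \<bar>\<tau> - t\<bar> < \<delta> \<longrightarrow> norm (r \<tau>) \<le> \<epsilon> * \<bar>\<tau> - t\<bar>" "r t = 0"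
  shows "(r has_vector_derivative 0) (at t within S)"
  unfolding has_vector_derivative_def has_derivative_within_alt
  using assms by simp

lemma mexp_minus_mexp: "mexp ((- s) *\<^sub>R A) *v (mexp (t *\<^sub>R A) *v x) = mexp ((t - s) *\<^sub>R A) *v x"
  using mexp_add[of t "- s" A] mexp_minus_mult[of s A "t - s"] by (simp add: matrix_vector_mul_assoc)

lemma mexp_mexp_minus: "mexp (s *\<^sub>R A) *v (mexp ((- s) *\<^sub>R A) *v x) = x"
  using mexp_minus_right[of s A] by (simp add: matrix_vector_mul_assoc)

lemma ac_dist_continuous:
  assumes "ac_dist a b d" "\<epsilon> > 0"
  shows "\<exists>\<delta>>0. \<forall>s t. a \<le> s \<longrightarrow> s \<le> t \<longrightarrow> t \<le> b \<longrightarrow> t - s < \<delta> \<longrightarrow> d s t < \<epsilon>"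
proof -
  obtain \<delta> where \<delta>: "\<delta> > 0"
    "\<And>P. nonoverlapping a b P \<Longrightarrow> (\<Sum>(s, t)\<in>P. t - s) < \<delta> \<Longrightarrow> (\<Sum>(s, t)\<in>P. d s t) < \<epsilon>"
    using ac_distE[OF assms] by blast
  have "d s t < \<epsilon>" if "a \<le> s" "s \<le> t" "t \<le> b" "t - s < \<delta>" for s t
    using \<delta>(2)[of "{(s, t)}"] that by (simp add: nonoverlapping_def)
  with \<delta>(1) show ?thesis by blast
qed

locale loewner_chain_data = loewner_transition A h v
  for A :: "complex ^ 'n ^ 'n" and h v +
  fixes H F :: "nat \<Rightarrow> real \<Rightarrow> 'n form"
  assumes H: "h_expansion A h H" and F: "coeff_solutions A H F"
begin

section \<open>Differentiation of the approximations along trajectories\<close>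

lemma F_hom: "k \<in> {2..n0 A} \<Longrightarrow> t \<ge> 0 \<Longrightarrow> F k t \<in> hom_poly k"
  using F unfolding coeff_solutions_def by blast

lemma F_ac:
  assumes "k \<in> {2..n0 A}" "0 \<le> a"
  shows "ac_dist a b (\<lambda>s t. form_norm k (\<lambda>ws. F k t ws - F k s ws))"
proof -
  have "unif_loc_abs_cont {()} (\<lambda>_ s t. form_norm k (\<lambda>ws. F k t ws - F k s ws))"
    using F assms(1) unfolding coeff_solutions_def by blast
  from unif_loc_abs_cont_imp_ac_dist[OF this _ assms(2)] show ?thesis by simp
qed

lemma F_derivative:
  obtains N where "negligible N"
    "\<And>k t z. k \<in> {2..n0 A} \<Longrightarrow> t \<ge> 0 \<Longrightarrow> t \<notin> N \<Longrightarrow>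
       ((\<lambda>\<tau>. F k \<tau> (replicate k z)) has_vector_derivative B_op A k (F k t) z + N_term H F k t z) (at t within {0..})"
proof -
  have "\<exists>N. negligible N \<and> (\<forall>t\<ge>0. t \<notin> N \<longrightarrow> (\<forall>z.
       ((\<lambda>\<tau>. F k \<tau> (replicate k z)) has_vector_derivative B_op A k (F k t) z + N_term H F k t z) (at t within {0..})))"
    if "k \<in> {2..n0 A}" for k
    using F that unfolding coeff_solutions_def AE_lebesgue_on_atLeast by blast
  then obtain N where N: "\<And>k. k \<in> {2..n0 A} \<Longrightarrow> negligible (N k)"
    "\<And>k t z. k \<in> {2..n0 A} \<Longrightarrow> t \<ge> 0 \<Longrightarrow> t \<notin> N k \<Longrightarrow>
       ((\<lambda>\<tau>. F k \<tau> (replicate k z)) has_vector_derivative B_op A k (F k t) z + N_term H F k t z) (at t within {0..})"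
    by metis
  show thesis
  proof (rule that)
    show "negligible (\<Union>k\<in>{2..n0 A}. N k)" by (rule negligible_Union) (use N(1) in auto)
  qed (use N(2) in blast)
qed

lemma F_continuous:
  assumes k: "k \<in> {2..n0 A}" and t: "t \<ge> 0" and e: "\<epsilon> > 0"
  shows "\<exists>\<delta>>0. \<forall>\<tau>\<ge>0. \<bar>\<tau> - t\<bar> < \<delta> \<longrightarrow> form_norm k (\<lambda>ws. F k \<tau> ws - F k t ws) < \<epsilon>"
proof -
  obtain \<delta> where \<delta>: "\<delta> > 0" "\<And>a b. 0 \<le> a \<Longrightarrow> a \<le> b \<Longrightarrow> b \<le> t + 1 \<Longrightarrow> b - a < \<delta> \<Longrightarrow> form_norm k (\<lambda>ws. F k b ws - F k a ws) < \<epsilon>"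
    using ac_dist_continuous[OF F_ac[OF k order_refl, of "t + 1"] e] by blast
  have sym: "form_norm k (\<lambda>ws. F k b ws - F k a ws) = form_norm k (\<lambda>ws. F k a ws - F k b ws)" for a b
    unfolding form_norm_def by (simp only: norm_minus_commute)
  show ?thesis
  proof (intro exI[of _ "min \<delta> 1"] conjI allI impI)
    fix \<tau> :: real assume "\<tau> \<ge> 0" "\<bar>\<tau> - t\<bar> < min \<delta> 1"
    then show "form_norm k (\<lambda>ws. F k \<tau> ws - F k t ws) < \<epsilon>"
      using \<delta>(2)[of t \<tau>] \<delta>(2)[of \<tau> t] sym[of \<tau> t] t by (cases "t \<le> \<tau>") auto
  qed (use \<delta> in auto)
qed

text \<open>The equation for \<open>F k\<close> gives a time derivative only at each fixed point,
  while here the point moves too. The mixed second difference \<open>r\<close> is bounded, up to a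
  constant, by the change of the form in norm times the displacement of the trajectory; the former
  tends to 0 and the latter is Lipschitz, so \<open>r\<close> has derivative 0.\<close>

lemma F_along_derivative:
  assumes k: "k \<in> {2..n0 A}" and s: "0 \<le> s" "s \<le> t" and z: "norm z < 1"
    and Fd: "((\<lambda>\<tau>. F k \<tau> (replicate k (v z s t))) has_vector_derivative D) (at t within {0..})"
    and vd: "((\<lambda>\<tau>. v z s \<tau>) has_vector_derivative y) (at t within {s..})"
  shows "((\<lambda>\<tau>. F k \<tau> (replicate k (v z s \<tau>))) has_vector_derivative D + of_nat k *s F k t (y # replicate (k - 1) (v z s t)))
     (at t within {s..})"
proof -
  have t0: "t \<ge> 0" using s by simp
  note Ft = F_hom[OF k t0]
  define r where "r \<tau> = (F k \<tau> (replicate k (v z s \<tau>)) - F k t (replicate k (v z s \<tau>)))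
     - (F k \<tau> (replicate k (v z s t)) - F k t (replicate k (v z s t)))" for \<tau>
  obtain L where L: "\<And>\<tau> \<tau>'. s \<le> \<tau> \<Longrightarrow> s \<le> \<tau>' \<Longrightarrow> norm (v z s \<tau>' - v z s \<tau>) \<le> L * \<bar>\<tau>' - \<tau>\<bar>"
    using v_lipschitz[OF s(1) z] by blast
  have rb: "norm (r \<tau>) \<le> real k * form_norm k (\<lambda>ws. F k \<tau> ws - F k t ws) * (\<bar>L\<bar> * \<bar>\<tau> - t\<bar>)" if "\<tau> \<ge> s" for \<tau>
  proof -
    have Q: "(\<lambda>ws. F k \<tau> ws - F k t ws) \<in> hom_poly k"
      using that s by (intro hom_poly_diff F_hom k) auto
    have "norm (r \<tau>) \<le> real k * form_norm k (\<lambda>ws. F k \<tau> ws - F k t ws) * norm (v z s \<tau> - v z s t)"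
      unfolding r_def using v_ball[of s \<tau> z] v_ball[of s t z] that s z k by (intro hom_poly_lipschitz[OF Q]) auto
    also have "norm (v z s \<tau> - v z s t) \<le> \<bar>L\<bar> * \<bar>\<tau> - t\<bar>"
      using L[of t \<tau>] that s by (smt (verit, best) mult_right_mono)
    finally show ?thesis
      using form_norm_nonneg[OF Q] by (simp add: mult_left_mono)
  qed
  have r0: "(r has_vector_derivative 0) (at t within {s..})"
  proof (rule has_vector_derivative_zeroI)
    show "r t = 0" by (simp add: r_def)
    fix \<epsilon> :: real assume e: "\<epsilon> > 0"
    define e' where "e' = \<epsilon> / (real k * \<bar>L\<bar> + 1)"
    have pos: "real k * \<bar>L\<bar> + 1 > 0" by (simp add: add_nonneg_pos)
    then have e': "e' > 0" using e by (simp add: e'_def)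
    obtain \<delta> where \<delta>: "\<delta> > 0" "\<And>\<tau>. \<tau> \<ge> 0 \<Longrightarrow> \<bar>\<tau> - t\<bar> < \<delta> \<Longrightarrow> form_norm k (\<lambda>ws. F k \<tau> ws - F k t ws) < e'"
      using F_continuous[OF k t0 e'] by blast
    show "\<exists>\<delta>>0. \<forall>\<tau>\<in>{s..}. \<bar>\<tau> - t\<bar> < \<delta> \<longrightarrow> norm (r \<tau>) \<le> \<epsilon> * \<bar>\<tau> - t\<bar>"
    proof (intro exI[of _ \<delta>] conjI ballI impI \<delta>(1))
      fix \<tau> assume \<tau>: "\<tau> \<in> {s..}" "\<bar>\<tau> - t\<bar> < \<delta>"
      have "norm (r \<tau>) \<le> real k * form_norm k (\<lambda>ws. F k \<tau> ws - F k t ws) * (\<bar>L\<bar> * \<bar>\<tau> - t\<bar>)"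
        using rb \<tau> by simp
      also have "\<dots> \<le> real k * e' * (\<bar>L\<bar> * \<bar>\<tau> - t\<bar>)"
        using \<delta>(2)[of \<tau>] \<tau> s by (intro mult_right_mono mult_left_mono) auto
      also have "\<dots> = (real k * \<bar>L\<bar>) * e' * \<bar>\<tau> - t\<bar>" by simp
      also have "\<dots> \<le> (real k * \<bar>L\<bar> + 1) * e' * \<bar>\<tau> - t\<bar>"
        using e' by (intro mult_right_mono) auto
      also have "\<dots> = \<epsilon> * \<bar>\<tau> - t\<bar>" using pos by (simp add: e'_def)
      finally show "norm (r \<tau>) \<le> \<epsilon> * \<bar>\<tau> - t\<bar>" .
    qed
  qed
  have 1: "((\<lambda>\<tau>. F k \<tau> (replicate k (v z s t))) has_vector_derivative D) (at t within {s..})"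
    by (rule has_vector_derivative_within_subset[OF Fd]) (use s in auto)
  have 2: "((\<lambda>\<tau>. F k t (replicate k (v z s \<tau>))) has_vector_derivative of_nat k *s F k t (y # replicate (k - 1) (v z s t)))
     (at t within {s..})"
  proof -
    have "((\<lambda>\<tau>. F k t (replicate k (v z s \<tau>))) has_derivative
       (\<lambda>x. of_nat k *s F k t ((x *\<^sub>R y) # replicate (k - 1) (v z s t)))) (at t within {s..})"
      by (rule has_derivative_compose[OF vd[unfolded has_vector_derivative_def] hom_poly_has_derivative[OF Ft]])
    moreover have "F k t ((x *\<^sub>R y) # replicate (k - 1) (v z s t)) = of_real x *s F k t (y # replicate (k - 1) (v z s t))" for x
    proof -
      have "x *\<^sub>R y = of_real x *s y" by (simp add: vec_eq_iff scaleR_conv_of_real[where 'a = complex])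
      moreover have "vlinear (\<lambda>w. F k t (w # replicate (k - 1) (v z s t)))"
        by (rule hom_poly_vlinear_Cons[OF Ft]) (use k in simp)
      ultimately show ?thesis using vlinear_scale by metis
    qed
    moreover have "of_nat k *s (of_real x *s w) = x *\<^sub>R (of_nat k *s w)" for x and w :: "complex ^ 'n"
      by (simp add: vec_eq_iff scaleR_conv_of_real[where 'a = complex])
    ultimately show ?thesis by (simp add: has_vector_derivative_def)
  qed
  have eq: "F k \<tau> (replicate k (v z s \<tau>)) = F k \<tau> (replicate k (v z s t)) + (F k t (replicate k (v z s \<tau>)) - F k t (replicate k (v z s t))) + r \<tau>" for \<tau>
    by (simp add: r_def)
  have "((\<lambda>\<tau>. F k \<tau> (replicate k (v z s t)) + (F k t (replicate k (v z s \<tau>)) - F k t (replicate k (v z s t))) + r \<tau>)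
    has_vector_derivative D + (of_nat k *s F k t (y # replicate (k - 1) (v z s t)) - 0) + 0) (at t within {s..})"
    by (intro has_vector_derivative_add has_vector_derivative_diff 1 2 r0 has_vector_derivative_const)
  then show ?thesis unfolding eq[symmetric] by simp
qed

text \<open>The term of \<open>chain_rate\<close> with the leading \<open>A\<close> comes from
  differentiating \<open>mexp\<close>, the minus signs in front of \<open>y\<close> from the field
  \<open>- h\<close>.\<close>

lemma approx_derivative:
  assumes s: "0 \<le> s" and z: "norm z < 1"
  obtains N where "negligible N"
    "\<And>t. s \<le> t \<Longrightarrow> t \<notin> N \<Longrightarrow> ((\<lambda>\<tau>. g_approx A v F \<tau> z s) has_vector_derivative
       mexp (t *\<^sub>R A) *v chain_rate A H F (n0 A) t (h (v z s t) t) (v z s t)) (at t within {s..})"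
proof -
  obtain N1 where N1: "negligible N1"
    "\<And>t. s \<le> t \<Longrightarrow> t \<notin> N1 \<Longrightarrow> ((\<lambda>\<tau>. v z s \<tau>) has_vector_derivative - h (v z s t) t) (at t within {s..})"
    using v_derivative[OF s z] by blast
  obtain N2 where N2: "negligible N2"
    "\<And>k t z. k \<in> {2..n0 A} \<Longrightarrow> t \<ge> 0 \<Longrightarrow> t \<notin> N2 \<Longrightarrow>
       ((\<lambda>\<tau>. F k \<tau> (replicate k z)) has_vector_derivative B_op A k (F k t) z + N_term H F k t z) (at t within {0..})"
    using F_derivative by blast
  show thesis
  proof (rule that[OF negligible_Un[OF N1(1) N2(1)]])
    fix t assume t: "s \<le> t" "t \<notin> N1 \<union> N2"
    have t0: "t \<ge> 0" using t s by simp
    define x where "x = v z s t"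
    define y where "y = h x t"
    have vd: "((\<lambda>\<tau>. v z s \<tau>) has_vector_derivative - y) (at t within {s..})"
      using N1(2) t by (simp add: y_def x_def)
    have Fd: "((\<lambda>\<tau>. F k \<tau> (replicate k (v z s \<tau>))) has_vector_derivative
        B_op A k (F k t) x + N_term H F k t x + of_nat k *s F k t ((- y) # replicate (k - 1) x)) (at t within {s..})"
      if k: "k \<in> {2..n0 A}" for k
      using F_along_derivative[OF k s t(1) z N2(2)[OF k t0] vd] t(2) by (simp add: x_def)
    have neg: "F k t ((- y) # replicate (k - 1) x) = - F k t (y # replicate (k - 1) x)" if k: "k \<in> {2..n0 A}" for k
    proof -
      have "vlinear (\<lambda>w. F k t (w # replicate (k - 1) x))"
        by (rule hom_poly_vlinear_Cons[OF F_hom[OF k t0]]) (use k in simp)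
      from vlinear_scale[OF this, of "- 1" y] show ?thesis by simp
    qed
    let ?S = "\<lambda>\<tau>. v z s \<tau> + (\<Sum>k=2..n0 A. F k \<tau> (replicate k (v z s \<tau>)))"
    let ?R = "- y + (\<Sum>k=2..n0 A. B_op A k (F k t) x + N_term H F k t x + of_nat k *s F k t ((- y) # replicate (k - 1) x))"
    have "(?S has_vector_derivative ?R) (at t within {s..})"
      by (intro has_vector_derivative_add vd has_vector_derivative_sum Fd)
    from bounded_bilinear.has_vector_derivative[OF bounded_bilinear_matrix_vector mexp_has_vector_derivative this]
    have "((\<lambda>\<tau>. mexp (\<tau> *\<^sub>R A) *v ?S \<tau>) has_vector_derivative
       mexp (t *\<^sub>R A) *v ?R + (A ** mexp (t *\<^sub>R A)) *v ?S t) (at t within {s..})" .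
    moreover have "mexp (t *\<^sub>R A) *v ?R + (A ** mexp (t *\<^sub>R A)) *v ?S t = mexp (t *\<^sub>R A) *v (?R + A *v ?S t)"
      by (simp add: matrix_vector_right_distrib matrix_vector_mul_assoc mexp_commute)
    moreover have "?R + A *v ?S t = chain_rate A H F (n0 A) t y x"
    proof -
      have "(\<Sum>k=2..n0 A. B_op A k (F k t) x + N_term H F k t x + of_nat k *s F k t ((- y) # replicate (k - 1) x)) =
        (\<Sum>k=2..n0 A. B_op A k (F k t) x + N_term H F k t x - of_nat k *s F k t (y # replicate (k - 1) x))"
        by (rule sum.cong[OF refl]) (simp only: neg vector_smult_rneg diff_conv_add_uminus)
      then show ?thesis unfolding chain_rate_def x_def[symmetric] by simp
    qed
    ultimately show "((\<lambda>\<tau>. g_approx A v F \<tau> z s) has_vector_derivative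
       mexp (t *\<^sub>R A) *v chain_rate A H F (n0 A) t (h (v z s t) t) (v z s t)) (at t within {s..})"
      unfolding g_approx_def y_def x_def by simp
  qed
qed

text \<open>The derivative exists only almost everywhere; absolute continuity is what lets it
  control increments.\<close>

lemma approx_ac:
  assumes s: "0 \<le> s" and z: "norm z < 1" and a: "s \<le> a"
    and C: "\<And>k t. k \<in> {2..n0 A} \<Longrightarrow> t \<in> {a..b} \<Longrightarrow> form_norm k (F k t) \<le> C"
  shows "ac_dist a b (\<lambda>t t'. norm (g_approx A v F t' z s - g_approx A v F t z s))"
proof -
  let ?q = "\<lambda>k t. F k t (replicate k (v z s t))"
  have nv: "norm (v z s t) \<le> 1" if "t \<ge> a" for t
    using v_ball[of s t z] that a s z by simp
  have q_ac: "ac_dist a b (\<lambda>t t'. norm (?q k t' - ?q k t))" if k: "k \<in> {2..n0 A}" for k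
  proof -
    have "ac_dist a b (\<lambda>t t'. form_norm k (\<lambda>ws. F k t' ws - F k t ws) + real k * \<bar>C\<bar> * norm (v z s t' - v z s t))"
      by (intro ac_dist_add ac_dist_cmult F_ac[OF k] v_ac s z a) (use s a in auto)
    then show ?thesis
    proof (rule ac_dist_le)
      fix t t' assume t: "a \<le> t" "t \<le> t'" "t' \<le> b"
      have hp: "F k t \<in> hom_poly k" "F k t' \<in> hom_poly k" using F_hom[OF k] t a s by auto
      have "norm (F k t' (replicate k (v z s t')) - F k t (replicate k (v z s t'))) \<le> form_norm k (\<lambda>ws. F k t' ws - F k t ws)"
        by (rule form_norm_upper[OF hom_poly_diff[OF hp(2,1)]]) (use nv[of t'] t in auto)
      moreover have "norm (F k t (replicate k (v z s t')) - F k t (replicate k (v z s t))) \<le> real k * form_norm k (F k t) * norm (v z s t' - v z s t)"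
        by (rule hom_poly_lipschitz[OF hp(1)]) (use nv t k in auto)
      moreover have "real k * form_norm k (F k t) * norm (v z s t' - v z s t) \<le> real k * \<bar>C\<bar> * norm (v z s t' - v z s t)"
        using C[OF k, of t] t by (intro mult_right_mono mult_left_mono) auto
      moreover have "?q k t' - ?q k t = (F k t' (replicate k (v z s t')) - F k t (replicate k (v z s t'))) +
         (F k t (replicate k (v z s t')) - F k t (replicate k (v z s t)))" by simp
      ultimately show "norm (?q k t' - ?q k t) \<le> form_norm k (\<lambda>ws. F k t' ws - F k t ws) + real k * \<bar>C\<bar> * norm (v z s t' - v z s t)"
        using norm_triangle_ineq[of "F k t' (replicate k (v z s t')) - F k t (replicate k (v z s t'))"
          "F k t (replicate k (v z s t')) - F k t (replicate k (v z s t))"] by simp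
    qed
  qed
  let ?S = "\<lambda>t. v z s t + (\<Sum>k=2..n0 A. ?q k t)"
  have "ac_dist a b (\<lambda>t t'. norm (v z s t' - v z s t) + (\<Sum>k=2..n0 A. norm (?q k t' - ?q k t)))"
    by (intro ac_dist_add ac_dist_sum v_ac s z a q_ac)
  then have S_ac: "ac_dist a b (\<lambda>t t'. norm (?S t' - ?S t))"
  proof (rule ac_dist_le)
    fix t t'
    have eq: "?S t' - ?S t = (v z s t' - v z s t) + (\<Sum>k=2..n0 A. ?q k t' - ?q k t)"
      by (simp add: sum_subtractf)
    show "norm (?S t' - ?S t) \<le> norm (v z s t' - v z s t) + (\<Sum>k=2..n0 A. norm (?q k t' - ?q k t))"
      unfolding eq by (rule norm_triangle_le[OF add_left_mono[OF norm_sum]])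
  qed
  have S_bd: "norm (?S t) \<le> 1 + real (n0 A) * \<bar>C\<bar>" if t: "t \<in> {a..b}" for t
  proof -
    have "norm (?q k t) \<le> \<bar>C\<bar>" if k: "k \<in> {2..n0 A}" for k
    proof -
      have "norm (?q k t) \<le> form_norm k (F k t)"
        by (rule form_norm_upper[OF F_hom[OF k]]) (use nv[of t] t a s in auto)
      with C[OF k t] show ?thesis by linarith
    qed
    then have "norm (\<Sum>k=2..n0 A. ?q k t) \<le> (\<Sum>k=2..n0 A. \<bar>C\<bar>)" by (rule sum_norm_le)
    also have "\<dots> \<le> real (n0 A) * \<bar>C\<bar>" by (simp add: mult_right_mono)
    finally show ?thesis using nv[of t] t norm_triangle_ineq[of "v z s t" "\<Sum>k=2..n0 A. ?q k t"] by simp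
  qed
  have cont: "continuous_on {a..b} (\<lambda>t. mexp (t *\<^sub>R A))"
    by (rule continuous_on_vector_derivative) (rule mexp_has_vector_derivative)
  have E_ac: "ac_dist a b (\<lambda>t t'. norm (mexp (t' *\<^sub>R A) - mexp (t *\<^sub>R A)))"
    by (rule ac_dist_C1[OF mexp_has_vector_derivative])
       (rule bounded_bilinear.continuous_on[OF bounded_bilinear_matrix_matrix continuous_on_const cont])
  have "bounded ((\<lambda>t. mexp (t *\<^sub>R A)) ` {a..b})"
    by (rule compact_imp_bounded[OF compact_continuous_image[OF cont compact_Icc]])
  then obtain E where "\<forall>M\<in>(\<lambda>t. mexp (t *\<^sub>R A)) ` {a..b}. norm M \<le> E"
    unfolding bounded_iff ..
  then have E: "norm (mexp (t *\<^sub>R A)) \<le> E" if "t \<in> {a..b}" for t using that by (simp del: atLeastAtMost_iff)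
  show ?thesis unfolding g_approx_def
    by (rule ac_dist_bilinear[OF bounded_bilinear_matrix_vector E_ac E S_ac S_bd])
qed

text \<open>Integrates the bound \<open>E * exp (- (\<eta> * (\<tau> - s)))\<close> for the
  normalized derivative; the difference of exponentials is its exact integral and yields the Cauchy
  property in time. \<open>C\<close> involves only \<open>A\<close>, \<open>c\<close>,
  \<open>d\<close> and the growth constants, not the field or the trajectories.\<close>

lemma key_estimate:
  assumes s: "0 \<le> s" "s \<le> t1" "t1 \<le> t2" and w: "norm w \<le> 1 / 4"
    and c: "c \<ge> 0" "\<And>k t. k \<in> {2..n0 A} \<Longrightarrow> t \<ge> 0 \<Longrightarrow> form_norm k (F k t) \<le> c * (1 + t ^ d)"
    and \<eta>: "\<eta> > 0" "3 * \<eta> = (real (n0 A) + 1) * m_low A - k_plus A"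
    and C1: "\<And>\<tau>. \<tau> \<ge> 0 \<Longrightarrow> norm (mexp (\<tau> *\<^sub>R A)) \<le> C1 * exp ((k_plus A + \<eta>) * \<tau>)" "C1 > 0"
    and C2: "\<And>\<tau>. \<tau> \<ge> 0 \<Longrightarrow> 1 + \<tau> ^ d \<le> C2 * exp (\<eta> * \<tau>)" "C2 > 0"
  defines "K \<equiv> n0 A"
  defines "C \<equiv> C1 * (64 * norm A * 2 ^ (K + 1) * ((1 + real K ^ 2 * c) * (2 ^ d * C2)) * 2 ^ (K + 1))"
  shows "norm (mexp ((- s) *\<^sub>R A) *v (g_approx A v F t2 w s - g_approx A v F t1 w s))
     \<le> C / \<eta> * (1 + s ^ d) * norm w ^ (K + 1) * (exp (- (\<eta> * (t1 - s))) - exp (- (\<eta> * (t2 - s))))"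
proof -
  have w1: "norm w < 1" using w by simp
  define E where "E = C * (1 + s ^ d) * norm w ^ (K + 1)"
  obtain N where N: "negligible N"
    "\<And>t. s \<le> t \<Longrightarrow> t \<notin> N \<Longrightarrow> ((\<lambda>\<tau>. g_approx A v F \<tau> w s) has_vector_derivative
       mexp (t *\<^sub>R A) *v chain_rate A H F (n0 A) t (h (v w s t) t) (v w s t)) (at t within {s..})"
    using approx_derivative[OF s(1) w1] by blast
  let ?f = "\<lambda>\<tau>. mexp ((- s) *\<^sub>R A) *v g_approx A v F \<tau> w s"
  let ?\<phi> = "\<lambda>\<tau>. - (E / \<eta>) * exp (- (\<eta> * (\<tau> - s)))"
  have rate: "norm (mexp ((\<tau> - s) *\<^sub>R A) *v chain_rate A H F K \<tau> (h (v w s \<tau>) \<tau>) (v w s \<tau>)) \<le> E * exp (- (\<eta> * (\<tau> - s)))"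
    if \<tau>: "s \<le> \<tau>" for \<tau>
  proof -
    define T where "T = \<tau> - s"
    define x where "x = v w s \<tau>"
    have T: "T \<ge> 0" "\<tau> = s + T" "\<tau> \<ge> 0" using \<tau> s by (auto simp: T_def)
    have xw: "norm x \<le> 1 / 4" using v_norm_le[OF s(1) \<tau> w1] w by (simp add: x_def)
    \<comment> \<open>For a norm of at most 1/4 the denominator is at least 9/16, and 16/9 is at
      most 2.\<close>
    have xd: "norm x \<le> exp (- (m_low A * T)) * (2 * norm w)"
    proof -
      have "(3 / 4)\<^sup>2 \<le> (1 - norm w)\<^sup>2" using w by (intro power_mono) auto
      then have "norm w / (1 - norm w)\<^sup>2 \<le> norm w / (3 / 4)\<^sup>2"
        using w1 by (intro divide_left_mono) auto
      also have "\<dots> \<le> 2 * norm w" by (simp add: power2_eq_square)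
      finally have "exp (- (m_low A * T)) * (norm w / (1 - norm w)\<^sup>2) \<le> exp (- (m_low A * T)) * (2 * norm w)"
        by (rule mult_left_mono) simp
      with v_decay[OF s(1) \<tau> w1] show ?thesis by (simp add: x_def T_def)
    qed
    have xK: "norm x ^ (K + 1) \<le> exp (- ((real K + 1) * m_low A * T)) * (2 ^ (K + 1) * norm w ^ (K + 1))"
    proof -
      have "norm x ^ (K + 1) \<le> (exp (- (m_low A * T)) * (2 * norm w)) ^ (K + 1)"
        by (rule power_mono[OF xd]) simp
      also have "\<dots> = exp (- (m_low A * T)) ^ (K + 1) * (2 ^ (K + 1) * norm w ^ (K + 1))"
        by (simp only: power_mult_distrib)
      also have "exp (- (m_low A * T)) ^ (K + 1) = exp (- ((real K + 1) * m_low A * T))"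
        unfolding exp_of_nat_mult[symmetric] by (simp add: algebra_simps)
      finally show ?thesis .
    qed
    have td: "1 + \<tau> ^ d \<le> 2 ^ d * (1 + s ^ d) * (C2 * exp (\<eta> * T))"
      unfolding T(2) using s(1) by (intro order_trans[OF one_plus_power_add_le[OF s(1) T(1)]] mult_left_mono C2(1) T(1)) simp
    have cr: "norm (chain_rate A H F K \<tau> (h x \<tau>) x) \<le> 2 * (32 * norm A) * 2 ^ (K + 1) * (1 + real K ^ 2 * (c * (1 + \<tau> ^ d))) * norm x ^ (K + 1)"
    proof (rule chain_rate_bound)
      show "F k \<tau> \<in> hom_poly k \<and> form_norm k (F k \<tau>) \<le> c * (1 + \<tau> ^ d)" if "k \<in> {2..K}" for k
        using that F_hom c(2) T(3) by (simp add: K_def)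
      show "0 \<le> c * (1 + \<tau> ^ d)" using c(1) T(3) by simp
      show "tail_convergent (\<lambda>k. H k \<tau>)" using H T(3) by (simp add: h_expansion_def)
      show "h z \<tau> = A *v z + tail_sum (\<lambda>k. H k \<tau>) z" if "z \<in> ball 0 1" for z
        using H T(3) that by (simp add: h_expansion_def)
      show "norm (h z \<tau>) \<le> 32 * norm A" if "norm z = 1 / 2" for z
        using h_bound[OF T(3), of z "1 / 2"] that by (simp add: power2_eq_square)
      show "1 \<le> K" using n0_ge_1[OF mA] by (simp add: K_def)
    qed (use xw in auto)
    have "1 + real K ^ 2 * (c * (1 + \<tau> ^ d)) \<le> (1 + real K ^ 2 * c) * (1 + \<tau> ^ d)"
      using T(3) by (simp add: algebra_simps)
    also have "\<dots> \<le> (1 + real K ^ 2 * c) * (2 ^ d * (1 + s ^ d) * (C2 * exp (\<eta> * T)))"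
      using c(1) by (intro mult_left_mono td) simp
    finally have c1: "1 + real K ^ 2 * (c * (1 + \<tau> ^ d)) \<le> (1 + real K ^ 2 * c) * (2 ^ d * (1 + s ^ d) * (C2 * exp (\<eta> * T)))" .
    have "norm (mexp (T *\<^sub>R A) *v chain_rate A H F K \<tau> (h x \<tau>) x) \<le> norm (mexp (T *\<^sub>R A)) * norm (chain_rate A H F K \<tau> (h x \<tau>) x)"
      by (rule norm_matrix_vector_le)
    also have "\<dots> \<le> (C1 * exp ((k_plus A + \<eta>) * T)) *
      (2 * (32 * norm A) * 2 ^ (K + 1) * ((1 + real K ^ 2 * c) * (2 ^ d * (1 + s ^ d) * (C2 * exp (\<eta> * T)))) *
        (exp (- ((real K + 1) * m_low A * T)) * (2 ^ (K + 1) * norm w ^ (K + 1))))"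
      using c(1) C1(2) C2(2) s(1) T(3)
      by (intro mult_mono C1(1) T(1) order_trans[OF cr] mult_mono c1 xK order_refl) auto
    also have "\<dots> = E * (exp ((k_plus A + \<eta>) * T) * exp (\<eta> * T) * exp (- ((real K + 1) * m_low A * T)))"
      by (simp add: E_def C_def mult_ac)
    \<comment> \<open>One \<eta> is lost to the matrix exponential and one to the polynomial weight.
      The gap being 3\<eta>, the decay rate \<eta> is left.\<close>
    also have "exp ((k_plus A + \<eta>) * T) * exp (\<eta> * T) * exp (- ((real K + 1) * m_low A * T)) = exp (- (\<eta> * T))"
    proof -
      have "(k_plus A + \<eta>) * T + \<eta> * T + - ((real K + 1) * m_low A * T) = (k_plus A + 2 * \<eta> - (real K + 1) * m_low A) * T"
        by (simp add: algebra_simps)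
      also have "k_plus A + 2 * \<eta> - (real K + 1) * m_low A = - \<eta>" using \<eta>(2) by (simp add: K_def)
      finally show ?thesis by (simp flip: exp_add)
    qed
    finally show ?thesis unfolding T_def x_def .
  qed
  have "norm (?f t2 - ?f t1) \<le> ?\<phi> t2 - ?\<phi> t1"
  proof (rule ac_bound_by_derivative[OF s(3) _ N(1)])
    have bd: "form_norm k (F k t) \<le> c * (1 + t2 ^ d)" if "k \<in> {2..n0 A}" "t \<in> {t1..t2}" for k t
    proof -
      have "form_norm k (F k t) \<le> c * (1 + t ^ d)" using c(2) that s by auto
      also have "\<dots> \<le> c * (1 + t2 ^ d)" using that s c(1) by (intro mult_left_mono add_left_mono power_mono) auto
      finally show ?thesis .
    qed
    have ac: "ac_dist t1 t2 (\<lambda>t t'. norm (mexp ((- s) *\<^sub>R A)) * norm (g_approx A v F t' w s - g_approx A v F t w s))"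
      by (rule ac_dist_cmult[OF approx_ac[OF s(1) w1 s(2) bd]]) simp_all
    show "ac_dist t1 t2 (\<lambda>t t'. norm (?f t' - ?f t))"
    proof (rule ac_dist_le[OF ac])
      show "norm (?f t' - ?f t) \<le> norm (mexp ((- s) *\<^sub>R A)) * norm (g_approx A v F t' w s - g_approx A v F t w s)" for t t'
        using norm_matrix_vector_le[of "mexp ((- s) *\<^sub>R A)" "g_approx A v F t' w s - g_approx A v F t w s"]
        by (simp add: matrix_vector_mult_diff_distrib)
    qed
    fix \<tau> assume \<tau>: "\<tau> \<in> {t1..t2} - N"
    have "((\<lambda>\<tau>. g_approx A v F \<tau> w s) has_vector_derivative
       mexp (\<tau> *\<^sub>R A) *v chain_rate A H F (n0 A) \<tau> (h (v w s \<tau>) \<tau>) (v w s \<tau>)) (at \<tau> within {t1..t2})"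
      by (rule has_vector_derivative_within_subset[OF N(2)[of \<tau>]]) (use \<tau> s in auto)
    from bounded_linear.has_vector_derivative[OF bounded_bilinear.bounded_linear_right[OF bounded_bilinear_matrix_vector] this,
        of "mexp ((- s) *\<^sub>R A)"]
    have "(?f has_vector_derivative mexp ((\<tau> - s) *\<^sub>R A) *v chain_rate A H F (n0 A) \<tau> (h (v w s \<tau>) \<tau>) (v w s \<tau>))
        (at \<tau> within {t1..t2})"
      by (simp only: mexp_minus_mexp)
    then show "\<exists>D. norm D \<le> E * exp (- (\<eta> * (\<tau> - s))) \<and> (?f has_vector_derivative D) (at \<tau> within {t1..t2})"
      using rate[of \<tau>] \<tau> s unfolding K_def by auto
  next
    fix \<tau> assume "\<tau> \<in> {t1..t2}"
    show "(?\<phi> has_vector_derivative E * exp (- (\<eta> * (\<tau> - s)))) (at \<tau> within {t1..t2})"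
      using \<eta>(1) by (auto intro!: derivative_eq_intros simp flip: has_real_derivative_iff_has_vector_derivative)
  qed (intro continuous_intros)
  also have "\<dots> = E / \<eta> * (exp (- (\<eta> * (t1 - s))) - exp (- (\<eta> * (t2 - s))))"
    by (simp add: algebra_simps)
  finally show ?thesis by (simp add: E_def matrix_vector_mult_diff_distrib)
qed

end

section \<open>The limit mapping\<close>

lemma exp_decay_small:
  fixes a B \<delta> :: real
  assumes "a > 0" "\<delta> > 0"
  shows "\<exists>T\<ge>0. \<forall>t\<ge>T. B * exp (- (a * t)) < \<delta>"
proof (intro exI[of _ "\<bar>B\<bar> / (a * \<delta>)"] conjI allI impI)
  show "0 \<le> \<bar>B\<bar> / (a * \<delta>)" using assms by simp
  fix t assume t: "t \<ge> \<bar>B\<bar> / (a * \<delta>)"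
  then have "\<bar>B\<bar> \<le> a * t * \<delta>" using assms by (simp add: field_simps)
  moreover have "a * t * \<delta> < exp (a * t) * \<delta>"
    using exp_ge_add_one_self[of "a * t"] assms by (intro mult_strict_right_mono) linarith+
  ultimately have "B < exp (a * t) * \<delta>" by linarith
  then show "B * exp (- (a * t)) < \<delta>" by (simp add: exp_minus field_simps)
qed

lemma exp_cauchy_limit:
  fixes y :: "real \<Rightarrow> 'a::banach"
  assumes y: "\<And>t t'. s \<le> t \<Longrightarrow> t \<le> t' \<Longrightarrow> norm (y t' - y t) \<le> B * exp (- (\<eta> * (t - s)))" and \<eta>: "\<eta> > 0"
  shows "\<exists>l. (y \<longlongrightarrow> l) at_top \<and> (\<forall>t\<ge>s. norm (l - y t) \<le> B * exp (- (\<eta> * (t - s))))"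
proof -
  have small: "\<exists>T\<ge>0. \<forall>t\<ge>T. B * exp (- (\<eta> * t)) < e" if "e > 0" for e
    by (rule exp_decay_small[OF \<eta> that])
  define Y where "Y n = y (s + real n)" for n
  have "Cauchy Y"
  proof (rule CauchyI')
    fix e :: real assume "e > 0"
    then obtain T where T: "T \<ge> 0" "\<And>t. t \<ge> T \<Longrightarrow> B * exp (- (\<eta> * t)) < e" using small by blast
    obtain N where N: "T \<le> real N" using real_arch_simple by blast
    have "dist (Y m) (Y n) < e" if "m \<ge> N" "n > m" for m n
    proof -
      have "norm (Y n - Y m) \<le> B * exp (- (\<eta> * real m))"
        using y[of "s + real m" "s + real n"] that by (simp add: Y_def)
      also have "\<dots> < e" using T(2)[of "real m"] N that by simp
      finally show ?thesis by (simp add: dist_norm norm_minus_commute)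
    qed
    then show "\<exists>N. \<forall>m\<ge>N. \<forall>n>m. dist (Y m) (Y n) < e" by blast
  qed
  then obtain l where l: "Y \<longlonglongrightarrow> l" using Cauchy_convergent_iff convergent_def by blast
  have est: "norm (l - y t) \<le> B * exp (- (\<eta> * (t - s)))" if t: "t \<ge> s" for t
  proof (rule tendsto_upperbound)
    show "(\<lambda>n. norm (Y n - y t)) \<longlonglongrightarrow> norm (l - y t)" by (intro tendsto_intros l)
    obtain N where N: "t - s \<le> real N" using real_arch_simple by blast
    show "\<forall>\<^sub>F n in sequentially. norm (Y n - y t) \<le> B * exp (- (\<eta> * (t - s)))"
      unfolding eventually_sequentially
    proof (intro exI[of _ N] allI impI)
      fix n assume "n \<ge> N"
      then have "t \<le> s + real n" using N by linarith
      then show "norm (Y n - y t) \<le> B * exp (- (\<eta> * (t - s)))" unfolding Y_def by (rule y[OF t])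
    qed
  qed simp
  moreover have "(y \<longlongrightarrow> l) at_top"
  proof (rule tendstoI)
    fix e :: real assume "e > 0"
    then obtain T where T: "T \<ge> 0" "\<And>t. t \<ge> T \<Longrightarrow> B * exp (- (\<eta> * t)) < e" using small by blast
    show "\<forall>\<^sub>F t in at_top. dist (y t) l < e"
      unfolding eventually_at_top_linorder
    proof (intro exI[of _ "s + T"] allI impI)
      fix t assume t: "t \<ge> s + T"
      have "norm (l - y t) < e"
        by (rule le_less_trans[OF est T(2)]) (use t T(1) in auto)
      then show "dist (y t) l < e" by (simp add: dist_norm norm_minus_commute)
    qed
  qed
  ultimately show ?thesis by blast
qed

lemma compact_in_ball_radius:
  fixes K :: "'a::real_normed_vector set"
  assumes "compact K" "K \<subseteq> ball 0 1"
  obtains r where "0 \<le> r" "r < 1" "\<And>z. z \<in> K \<Longrightarrow> norm z \<le> r"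
proof (cases "K = {}")
  case True
  then show thesis by (intro that[of 0]) auto
next
  case False
  then obtain x where x: "x \<in> K" "\<And>z. z \<in> K \<Longrightarrow> norm z \<le> norm x"
    using continuous_attains_sup[OF assms(1) False continuous_on_norm_id] by auto
  then show thesis using assms(2) by (intro that[of "norm x"]) auto
qed

text \<open>The constants are parameters so that a single choice serves all fields, trajectories and
  coefficients with the same polynomial bound. \<open>C\<close> is to be instantiated by the
  constant of \<open>key_estimate\<close> divided by \<eta>.\<close>

locale loewner_key = loewner_chain_data A h v H F
  for A :: "complex ^ 'n ^ 'n" and h v H F +
  fixes C \<eta> c :: real and d :: nat
  assumes \<eta>: "\<eta> > 0" and C: "C \<ge> 0" and c: "c \<ge> 0"
    and bd: "\<And>k t. k \<in> {2..n0 A} \<Longrightarrow> t \<ge> 0 \<Longrightarrow> form_norm k (F k t) \<le> c * (1 + t ^ d)"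
    and key: "\<And>s t1 t2 w. 0 \<le> s \<Longrightarrow> s \<le> t1 \<Longrightarrow> t1 \<le> t2 \<Longrightarrow> norm w \<le> 1 / 4 \<Longrightarrow>
      norm (mexp ((- s) *\<^sub>R A) *v (g_approx A v F t2 w s - g_approx A v F t1 w s))
     \<le> C * (1 + s ^ d) * norm w ^ (n0 A + 1) * (exp (- (\<eta> * (t1 - s))) - exp (- (\<eta> * (t2 - s))))"
begin

abbreviation "g \<equiv> g_lim A v F"
abbreviation "ga \<equiv> g_approx A v F"

lemma ga_semigroup:
  assumes "0 \<le> s" "s \<le> u" "u \<le> t" "norm z < 1"
  shows "ga t (v z s u) u = ga t z s"
  by (simp add: g_approx_def v_semigroup[OF assms])

text \<open>The limit is taken for the mapping normalized by
  \<open>mexp ((- s) *\<^sub>R A)\<close>, the form in which \<open>key\<close> holds, and then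
  carried back by the inverse matrix.\<close>

lemma small_limit:
  assumes s: "0 \<le> s" and w: "norm w \<le> 1 / 4"
  shows "((\<lambda>t. ga t w s) \<longlongrightarrow> g w s) at_top"
    and "\<And>t. s \<le> t \<Longrightarrow> norm (mexp ((- s) *\<^sub>R A) *v (g w s - ga t w s)) \<le> C * (1 + s ^ d) * norm w ^ (n0 A + 1) * exp (- (\<eta> * (t - s)))"
proof -
  define B where "B = C * (1 + s ^ d) * norm w ^ (n0 A + 1)"
  have B: "B \<ge> 0" using C s by (simp add: B_def)
  let ?y = "\<lambda>t. mexp ((- s) *\<^sub>R A) *v ga t w s"
  have "\<exists>l. (?y \<longlongrightarrow> l) at_top \<and> (\<forall>t\<ge>s. norm (l - ?y t) \<le> B * exp (- (\<eta> * (t - s))))"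
  proof (rule exp_cauchy_limit[OF _ \<eta>])
    fix t t' assume t: "s \<le> t" "t \<le> t'"
    have "norm (?y t' - ?y t) \<le> B * (exp (- (\<eta> * (t - s))) - exp (- (\<eta> * (t' - s))))"
      using key[OF s t w] by (simp add: B_def matrix_vector_mult_diff_distrib)
    also have "\<dots> \<le> B * exp (- (\<eta> * (t - s)))" using B by (intro mult_left_mono) auto
    finally show "norm (?y t' - ?y t) \<le> B * exp (- (\<eta> * (t - s)))" .
  qed
  then obtain l where l: "(?y \<longlongrightarrow> l) at_top" "\<And>t. s \<le> t \<Longrightarrow> norm (l - ?y t) \<le> B * exp (- (\<eta> * (t - s)))"
    by blast
  have "((\<lambda>t. mexp (s *\<^sub>R A) *v ?y t) \<longlongrightarrow> mexp (s *\<^sub>R A) *v l) at_top"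
    by (rule bounded_linear.tendsto[OF bounded_bilinear.bounded_linear_right[OF bounded_bilinear_matrix_vector] l(1)])
  then have lim: "((\<lambda>t. ga t w s) \<longlongrightarrow> mexp (s *\<^sub>R A) *v l) at_top"
    by (simp only: mexp_mexp_minus)
  then have gl: "g w s = mexp (s *\<^sub>R A) *v l"
    unfolding g_lim_def by (rule tendsto_Lim[OF trivial_limit_at_top_linorder])
  show "((\<lambda>t. ga t w s) \<longlongrightarrow> g w s) at_top" unfolding gl by (rule lim)
  have "mexp ((- s) *\<^sub>R A) *v g w s = l"
    unfolding gl mexp_minus_mexp by simp
  then show "norm (mexp ((- s) *\<^sub>R A) *v (g w s - ga t w s)) \<le> C * (1 + s ^ d) * norm w ^ (n0 A + 1) * exp (- (\<eta> * (t - s)))"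
    if "s \<le> t" for t
    using l(2)[OF that] by (simp add: B_def matrix_vector_mult_diff_distrib)
qed

text \<open>The solution \<tau> of exp(-m \<tau>) / (1 - r)^2 = 1/4, where 1/4 is the radius on
  which the key estimate holds.\<close>

definition entry_time :: "real \<Rightarrow> real" where
  "entry_time r = ln (4 / (1 - r)\<^sup>2) / m_low A"

lemma entry_time_nonneg:
  assumes "0 \<le> r" "r < 1"
  shows "entry_time r \<ge> 0"
proof -
  have "(1 - r)\<^sup>2 \<le> 1" using assms by (simp add: power_le_one)
  then have "1 \<le> 4 / (1 - r)\<^sup>2" using assms by (simp add: le_divide_eq)
  then show ?thesis unfolding entry_time_def using mA by (intro divide_nonneg_nonneg ln_ge_zero) auto
qed

lemma exp_entry_time:
  assumes "r < 1"
  shows "exp (a * entry_time r) = (4 / (1 - r)\<^sup>2) powr (a / m_low A)"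
  using assms by (simp add: powr_def entry_time_def)

lemma v_small:
  assumes "0 \<le> s" "norm z \<le> r" "r < 1" "s + entry_time r \<le> t"
  shows "norm (v z s t) \<le> 1 / 4"
proof -
  have r0: "0 \<le> r" using assms(2) norm_ge_zero order_trans by blast
  have st: "s \<le> t" using entry_time_nonneg[OF r0 assms(3)] assms(4) by simp
  have "norm (v z s t) \<le> exp (- (m_low A * (t - s))) * (norm z / (1 - norm z)\<^sup>2)"
    using v_decay[OF assms(1) st] assms by simp
  also have "\<dots> \<le> exp (- (m_low A * entry_time r)) * (1 / (1 - r)\<^sup>2)"
  proof (rule mult_mono)
    show "exp (- (m_low A * (t - s))) \<le> exp (- (m_low A * entry_time r))" using assms mA by simp
    show "norm z / (1 - norm z)\<^sup>2 \<le> 1 / (1 - r)\<^sup>2"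
      using assms by (intro frac_le power_mono) auto
  qed auto
  also have "exp (- (m_low A * entry_time r)) = (1 - r)\<^sup>2 / 4"
    using assms mA by (simp add: entry_time_def exp_minus)
  also have "(1 - r)\<^sup>2 / 4 * (1 / (1 - r)\<^sup>2) = 1 / 4" using assms by simp
  finally show ?thesis .
qed

text \<open>From the entry time on, the approximations at \<open>z\<close> coincide with those at
  the small point \<open>v z s T\<close> started at \<open>T\<close>, whose limit is known.\<close>

lemma g_tendsto:
  assumes s: "0 \<le> s" and z: "norm z < 1"
  shows "((\<lambda>t. ga t z s) \<longlongrightarrow> g z s) at_top"
proof -
  define T where "T = s + entry_time (norm z)"
  have T: "s \<le> T" "0 \<le> T" using entry_time_nonneg[of "norm z"] z s by (auto simp: T_def)
  have "norm (v z s T) \<le> 1 / 4" by (rule v_small[OF s order_refl z]) (simp add: T_def)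
  from small_limit(1)[OF T(2) this]
  have "((\<lambda>t. ga t z s) \<longlongrightarrow> g (v z s T) T) at_top"
  proof (rule Lim_transform_eventually)
    show "\<forall>\<^sub>F t in at_top. ga t (v z s T) T = ga t z s"
      unfolding eventually_at_top_linorder using ga_semigroup[OF s T(1) _ z] by blast
  qed
  moreover from this have "g z s = g (v z s T) T"
    unfolding g_lim_def[of A v F z s] by (rule tendsto_Lim[OF trivial_limit_at_top_linorder])
  ultimately show ?thesis by simp
qed

lemma g_semigroup:
  assumes s: "0 \<le> s" "s \<le> u" and z: "norm z < 1"
  shows "g (v z s u) u = g z s"
proof (rule tendsto_unique[OF trivial_limit_at_top_linorder _ g_tendsto[OF s(1) z]])
  have "((\<lambda>t. ga t (v z s u) u) \<longlongrightarrow> g (v z s u) u) at_top"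
    using v_ball[OF s z] s by (intro g_tendsto) auto
  then show "((\<lambda>t. ga t z s) \<longlongrightarrow> g (v z s u) u) at_top"
  proof (rule Lim_transform_eventually)
    show "\<forall>\<^sub>F t in at_top. ga t (v z s u) u = ga t z s"
      unfolding eventually_at_top_linorder using ga_semigroup[OF s _ z] by blast
  qed
qed

text \<open>The entry time depends on a bound for the norm only, so one \<open>T\<close> serves the
  whole compact set.\<close>

lemma g_uniform_limit:
  assumes s: "0 \<le> s" and K: "compact K" "K \<subseteq> ball 0 1"
  shows "uniform_limit K (\<lambda>t z. ga t z s) (\<lambda>z. g z s) at_top"
proof -
  obtain r where r: "0 \<le> r" "r < 1" "\<And>z. z \<in> K \<Longrightarrow> norm z \<le> r"
    using compact_in_ball_radius[OF K] by blast
  define T where "T = s + entry_time r"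
  have T: "s \<le> T" "0 \<le> T" using entry_time_nonneg[OF r(1,2)] s by (auto simp: T_def)
  define B where "B = norm (mexp (T *\<^sub>R A)) * (C * (1 + T ^ d))"
  have est: "norm (g z s - ga t z s) \<le> B * exp (- (\<eta> * (t - T)))" if z: "z \<in> K" and t: "t \<ge> T" for z t
  proof -
    define w where "w = v z s T"
    have z1: "norm z < 1" using r z by force
    have w: "norm w \<le> 1 / 4" unfolding w_def by (rule v_small[OF s r(3)[OF z] r(2)]) (simp add: T_def)
    have "norm w ^ (n0 A + 1) \<le> 1" using w by (intro power_le_one) auto
    then have "C * (1 + T ^ d) * norm w ^ (n0 A + 1) * exp (- (\<eta> * (t - T))) \<le> C * (1 + T ^ d) * 1 * exp (- (\<eta> * (t - T)))"
      using C T by (intro mult_right_mono mult_left_mono) auto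
    then have e: "norm (mexp ((- T) *\<^sub>R A) *v (g w T - ga t w T)) \<le> C * (1 + T ^ d) * exp (- (\<eta> * (t - T)))"
      using small_limit(2)[OF T(2) w t] by simp
    have "g z s - ga t z s = mexp (T *\<^sub>R A) *v (mexp ((- T) *\<^sub>R A) *v (g w T - ga t w T))"
      unfolding mexp_mexp_minus w_def using g_semigroup[OF s T(1) z1] ga_semigroup[OF s T(1) t z1] by simp
    also have "norm \<dots> \<le> norm (mexp (T *\<^sub>R A)) * (C * (1 + T ^ d) * exp (- (\<eta> * (t - T))))"
      by (rule order_trans[OF norm_matrix_vector_le mult_left_mono[OF e norm_ge_zero]])
    finally show ?thesis by (simp add: B_def mult.assoc)
  qed
  show ?thesis
    unfolding uniform_limit_iff
  proof (intro allI impI)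
    fix e :: real assume "e > 0"
    then obtain T' where T': "T' \<ge> 0" "\<And>t. t \<ge> T' \<Longrightarrow> B * exp (- (\<eta> * t)) < e"
      using exp_decay_small[OF \<eta>, of e B] by blast
    show "\<forall>\<^sub>F t in at_top. \<forall>z\<in>K. dist (ga t z s) (g z s) < e"
      unfolding eventually_at_top_linorder
    proof (intro exI[of _ "T + T'"] allI impI ballI)
      fix t z assume t: "t \<ge> T + T'" and z: "z \<in> K"
      have "norm (g z s - ga t z s) < e"
        by (rule le_less_trans[OF est[OF z] T'(2)]) (use t T'(1) in auto)
      then show "dist (ga t z s) (g z s) < e" by (simp add: dist_norm norm_minus_commute)
    qed
  qed
qed

lemma ga_holo:
  assumes "0 \<le> s" "s \<le> t"
  shows "holo_on (\<lambda>z. ga t z s) (ball 0 1)"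
  unfolding g_approx_def
proof (intro holo_on_matrix holo_on_add holo_on_sum v_holo assms)
  fix k assume k: "k \<in> {2..n0 A}"
  show "holo_on (\<lambda>z. F k t (replicate k (v z s t))) (ball 0 1)"
  proof (rule holo_on_compose[OF v_holo[OF assms] hom_poly_holo_on])
    show "F k t \<in> hom_poly k" using F_hom[OF k] assms by simp
    show "1 \<le> k" using k by simp
  qed (rule subset_UNIV)
qed

lemma g_holo:
  assumes s: "0 \<le> s"
  shows "holo_on (\<lambda>z. g z s) (ball 0 1)"
proof (rule holo_on_uniform_limit[of "\<lambda>n z. ga (real n) z s"])
  obtain N where N: "s \<le> real N" using real_arch_simple by blast
  show "\<forall>\<^sub>F n in sequentially. holo_on (\<lambda>z. ga (real n) z s) (ball 0 1)"
    unfolding eventually_sequentially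
    by (intro exI[of _ N] allI impI ga_holo s) (use N in linarith)
  show "uniform_limit K (\<lambda>n z. ga (real n) z s) (\<lambda>z. g z s) sequentially" if "compact K" "K \<subseteq> ball 0 1" for K
    by (rule filterlim_compose[OF g_uniform_limit[OF s that] filterlim_real_sequentially])
qed simp

text \<open>At \<open>t = s\<close> the approximation is \<open>mexp (s *\<^sub>R A)\<close> applied
  to the polynomial with coefficients \<open>F k s\<close>, so its normalized distance from the
  limit is the remainder of order \<open>n0 A + 1\<close>. The coefficients of \<open>g\<close> are
  identified through this estimate.\<close>

lemma g_expansion_estimate:
  assumes s: "0 \<le> s" and w: "norm w \<le> 1 / 4"
  shows "norm (mexp ((- s) *\<^sub>R A) *v g w s - (w + (\<Sum>k=2..n0 A. F k s (replicate k w))))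
     \<le> C * (1 + s ^ d) * norm w ^ (n0 A + 1)"
proof -
  have w1: "norm w < 1" using w by simp
  have "mexp ((- s) *\<^sub>R A) *v ga s w s = w + (\<Sum>k=2..n0 A. F k s (replicate k w))"
    unfolding g_approx_def v_refl[OF s w1] mexp_minus_mexp by simp
  then show ?thesis
    using small_limit(2)[OF s w order_refl] by (simp add: matrix_vector_mult_diff_distrib)
qed

lemma F_sum_bound:
  assumes s: "0 \<le> s" and w: "norm w \<le> 1"
  shows "norm (\<Sum>k=2..n0 A. F k s (replicate k w)) \<le> real (n0 A) * c * (1 + s ^ d) * (norm w)\<^sup>2"
proof -
  have "norm (F k s (replicate k w)) \<le> c * (1 + s ^ d) * (norm w)\<^sup>2" if k: "k \<in> {2..n0 A}" for k
  proof -
    have "norm (F k s (replicate k w)) \<le> form_norm k (F k s) * norm w ^ k"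
      by (rule form_norm_bound_diag[OF F_hom[OF k s]])
    also have "\<dots> \<le> c * (1 + s ^ d) * norm w ^ 2"
      by (intro mult_mono bd k s power_decreasing) (use k c s w in auto)
    finally show ?thesis by simp
  qed
  then have "norm (\<Sum>k=2..n0 A. F k s (replicate k w)) \<le> (\<Sum>k=2..n0 A. c * (1 + s ^ d) * (norm w)\<^sup>2)"
    by (rule sum_norm_le)
  also have "\<dots> = real (n0 A - 1) * (c * (1 + s ^ d) * (norm w)\<^sup>2)" by simp
  also have "\<dots> \<le> real (n0 A) * (c * (1 + s ^ d) * (norm w)\<^sup>2)"
    using c s by (intro mult_right_mono) auto
  finally show ?thesis by (simp add: mult.assoc)
qed

text \<open>The remainder of order \<open>n0 A + 1\<close> is at least quadratic because
  \<open>n0 A\<close> is at least 1.\<close>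

lemma g_quadratic:
  assumes s: "0 \<le> s" and w: "norm w \<le> 1 / 4"
  shows "norm (mexp ((- s) *\<^sub>R A) *v g w s - w) \<le> (real (n0 A) * c + C) * (1 + s ^ d) * (norm w)\<^sup>2"
proof -
  let ?S = "\<Sum>k=2..n0 A. F k s (replicate k w)"
  have "norm w ^ (n0 A + 1) \<le> norm w ^ 2"
    using n0_ge_1[OF mA] w by (intro power_decreasing) auto
  then have "C * (1 + s ^ d) * norm w ^ (n0 A + 1) \<le> C * (1 + s ^ d) * (norm w)\<^sup>2"
    using C s by (intro mult_left_mono) auto
  with g_expansion_estimate[OF s w]
  have 1: "norm (mexp ((- s) *\<^sub>R A) *v g w s - (w + ?S)) \<le> C * (1 + s ^ d) * (norm w)\<^sup>2" by linarith
  have 2: "norm ?S \<le> real (n0 A) * c * (1 + s ^ d) * (norm w)\<^sup>2"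
    using w by (intro F_sum_bound s) simp
  have "norm (mexp ((- s) *\<^sub>R A) *v g w s - w) \<le> norm (mexp ((- s) *\<^sub>R A) *v g w s - (w + ?S)) + norm ?S"
  proof -
    have "norm (x - w) \<le> norm (x - (w + S)) + norm S" for x S
      using norm_triangle_ineq[of "x - (w + S)" S] by simp
    then show ?thesis .
  qed
  also have "\<dots> \<le> C * (1 + s ^ d) * (norm w)\<^sup>2 + real (n0 A) * c * (1 + s ^ d) * (norm w)\<^sup>2"
    using 1 2 by (rule add_mono)
  finally show ?thesis by (simp add: algebra_simps)
qed

text \<open>At the entry time the image point is small and \<open>g\<close> is controlled by the
  quadratic estimate; returning to \<open>z\<close> costs the matrix exponential of the elapsed
  time. The growth constants are arguments, which keeps the bound uniform in the data.\<close>

lemma g_growth: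
  assumes \<epsilon>: "\<epsilon> > 0" and s: "0 \<le> s" and z: "norm z < 1"
    and C1: "C1 > 0" "\<And>\<tau>. \<tau> \<ge> 0 \<Longrightarrow> norm (mexp (\<tau> *\<^sub>R A)) \<le> C1 * exp ((k_plus A + \<epsilon> * m_low A / 4) * \<tau>)"
    and C2: "C2 > 0" "\<And>\<tau>. \<tau> \<ge> 0 \<Longrightarrow> 1 + \<tau> ^ d \<le> C2 * exp (\<epsilon> * m_low A / 4 * \<tau>)"
  shows "norm (mexp ((- s) *\<^sub>R A) *v g z s) \<le>
     C1 * (1 + real (n0 A) * c + C) * 2 ^ d * C2 * 4 powr (k_plus A / m_low A + \<epsilon> / 2) * (1 + s ^ d) /
       (1 - norm z) powr (2 * (k_plus A / m_low A) + \<epsilon>)"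
proof -
  \<comment> \<open>Two factors exp(e \<tau>) arise, from the matrix exponential and from the
    polynomial weight. Together they add \<epsilon>/2 to the exponent of 4 / (1 - |z|)^2, that is,
    \<epsilon> to the exponent of 1 / (1 - |z|).\<close>
  define e where "e = \<epsilon> * m_low A / 4"
  define \<tau> where "\<tau> = entry_time (norm z)"
  define t where "t = s + \<tau>"
  define w where "w = v z s t"
  have \<tau>: "\<tau> \<ge> 0" using entry_time_nonneg[of "norm z"] z by (simp add: \<tau>_def)
  have t: "s \<le> t" "0 \<le> t" using \<tau> s by (auto simp: t_def)
  have w: "norm w \<le> 1 / 4" unfolding w_def by (rule v_small[OF s order_refl z]) (simp add: t_def \<tau>_def)
  have gw: "norm (mexp ((- t) *\<^sub>R A) *v g w t) \<le> (1 + real (n0 A) * c + C) * (1 + t ^ d)"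
  proof -
    have "(norm w)\<^sup>2 \<le> 1" using w by (intro power_le_one) auto
    then have "(real (n0 A) * c + C) * (1 + t ^ d) * (norm w)\<^sup>2 \<le> (real (n0 A) * c + C) * (1 + t ^ d) * 1"
      using c C t by (intro mult_left_mono) auto
    then have "norm (mexp ((- t) *\<^sub>R A) *v g w t - w) \<le> (real (n0 A) * c + C) * (1 + t ^ d)"
      using g_quadratic[OF t(2) w] by linarith
    moreover have "norm w \<le> 1 + t ^ d" using w zero_le_power[OF t(2), of d] by linarith
    moreover have "norm (mexp ((- t) *\<^sub>R A) *v g w t) \<le> norm (mexp ((- t) *\<^sub>R A) *v g w t - w) + norm w"
      using norm_triangle_ineq[of "mexp ((- t) *\<^sub>R A) *v g w t - w" w] by (simp only: diff_add_cancel)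
    ultimately show ?thesis by (simp add: distrib_right)
  qed
  have "mexp ((- s) *\<^sub>R A) *v g z s = mexp (\<tau> *\<^sub>R A) *v (mexp ((- t) *\<^sub>R A) *v g w t)"
  proof -
    have "mexp (\<tau> *\<^sub>R A) *v (mexp ((- t) *\<^sub>R A) *v x) = mexp ((- s) *\<^sub>R A) *v x" for x
      using mexp_minus_mexp[of t A "\<tau>" "x"] mexp_add[of "- t" \<tau> A] by (simp add: matrix_vector_mul_assoc t_def)
    then show ?thesis using g_semigroup[OF s t(1) z] by (simp add: w_def)
  qed
  also have "norm \<dots> \<le> norm (mexp (\<tau> *\<^sub>R A)) * norm (mexp ((- t) *\<^sub>R A) *v g w t)"
    by (rule norm_matrix_vector_le)
  also have "\<dots> \<le> (C1 * exp ((k_plus A + e) * \<tau>)) * ((1 + real (n0 A) * c + C) * (2 ^ d * (1 + s ^ d) * (C2 * exp (e * \<tau>))))"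
  proof (rule mult_mono)
    show "norm (mexp (\<tau> *\<^sub>R A)) \<le> C1 * exp ((k_plus A + e) * \<tau>)" using C1(2)[OF \<tau>] by (simp add: e_def)
    have "1 + t ^ d \<le> 2 ^ d * (1 + s ^ d) * (1 + \<tau> ^ d)" unfolding t_def by (rule one_plus_power_add_le[OF s \<tau>])
    also have "\<dots> \<le> 2 ^ d * (1 + s ^ d) * (C2 * exp (e * \<tau>))"
      using C2(2)[OF \<tau>] s by (intro mult_left_mono) (auto simp: e_def)
    finally have "(1 + real (n0 A) * c + C) * (1 + t ^ d) \<le> (1 + real (n0 A) * c + C) * (2 ^ d * (1 + s ^ d) * (C2 * exp (e * \<tau>)))"
      using c C by (intro mult_left_mono) auto
    with gw show "norm (mexp ((- t) *\<^sub>R A) *v g w t) \<le> (1 + real (n0 A) * c + C) * (2 ^ d * (1 + s ^ d) * (C2 * exp (e * \<tau>)))"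
      by linarith
  qed (use C1 in auto)
  also have "\<dots> = C1 * (1 + real (n0 A) * c + C) * 2 ^ d * C2 * (1 + s ^ d) * (exp ((k_plus A + e) * \<tau>) * exp (e * \<tau>))"
    by (simp add: mult_ac)
  also have "exp ((k_plus A + e) * \<tau>) * exp (e * \<tau>) = 4 powr (k_plus A / m_low A + \<epsilon> / 2) / (1 - norm z) powr (2 * (k_plus A / m_low A) + \<epsilon>)"
  proof -
    have "exp ((k_plus A + e) * \<tau>) * exp (e * \<tau>) = exp ((k_plus A + 2 * e) * \<tau>)"
      by (simp add: algebra_simps flip: exp_add)
    also have "\<dots> = (4 / (1 - norm z)\<^sup>2) powr ((k_plus A + 2 * e) / m_low A)"
      unfolding \<tau>_def by (rule exp_entry_time[OF z])
    also have "(k_plus A + 2 * e) / m_low A = k_plus A / m_low A + \<epsilon> / 2"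
      using mA by (simp add: e_def add_divide_distrib)
    also have "(4 / (1 - norm z)\<^sup>2) powr (k_plus A / m_low A + \<epsilon> / 2) =
       4 powr (k_plus A / m_low A + \<epsilon> / 2) / ((1 - norm z)\<^sup>2) powr (k_plus A / m_low A + \<epsilon> / 2)"
      by (rule powr_divide)
    also have "((1 - norm z)\<^sup>2) powr (k_plus A / m_low A + \<epsilon> / 2) = (1 - norm z) powr (2 * (k_plus A / m_low A) + \<epsilon>)"
    proof -
      have "(1 - norm z)\<^sup>2 = (1 - norm z) powr 2" using z by (simp add: powr_numeral)
      then show ?thesis by (simp add: powr_powr algebra_simps)
    qed
    finally show ?thesis .
  qed
  finally show ?thesis by (simp add: mult_ac)
qed

end

section \<open>The differential equation and the coefficients of the limit\<close>

lemma mult_divide_mult_cancel_pos: "x * (y / (k * x)) = y / k" if "x > 0" for x y k :: real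
  using that by simp

text \<open>The difference of the derivatives at \<open>w\<close> and \<open>z\<close> is the
  derivative at \<open>z\<close> of the function taking \<open>x\<close> to
  \<open>f (x + (w - z)) - f x\<close>. A Lipschitz estimate makes this function small, so a second
  Cauchy estimate suffices and no second derivatives are needed.\<close>

lemma holo_derivative_lipschitz:
  fixes f :: "complex ^ 'n \<Rightarrow> complex ^ 'n"
  assumes f: "holo_on f (ball 0 1)" and z: "norm z < 1"
  shows "\<exists>L\<ge>0. \<exists>\<rho>>0. \<forall>w G G' u. norm (w - z) \<le> \<rho> \<longrightarrow> (f has_derivative (\<lambda>u. G *v u)) (at w) \<longrightarrow>
     (f has_derivative (\<lambda>u. G' *v u)) (at z) \<longrightarrow> norm (G *v u - G' *v u) \<le> L * norm (w - z) * norm u"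
proof -
  \<comment> \<open>The radius \<rho> serves the last Cauchy estimate, 2\<rho> the domain after
    translation by at most \<rho>, and 3\<rho> the bound for \<open>f\<close>; all these balls lie
    in the unit ball.\<close>
  define \<rho> where "\<rho> = (1 - norm z) / 4"
  have \<rho>: "\<rho> > 0" using z by (simp add: \<rho>_def)
  have sub: "cball z (3 * \<rho>) \<subseteq> ball 0 1"
  proof
    fix x assume "x \<in> cball z (3 * \<rho>)"
    then have "norm (x - z) \<le> 3 * \<rho>" by (simp add: dist_norm norm_minus_commute)
    then have "norm x \<le> norm z + 3 * \<rho>" using norm_triangle_sub[of x z] by linarith
    then show "x \<in> ball 0 1" using z by (simp add: \<rho>_def field_simps)
  qed
  have "compact (f ` cball z (3 * \<rho>))"
    by (rule compact_continuous_image[OF continuous_on_subset[OF holo_on_imp_continuous_on[OF f] sub] compact_cball])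
  then obtain B where "\<forall>y\<in>f ` cball z (3 * \<rho>). norm y \<le> B"
    using compact_imp_bounded bounded_iff by blast
  then have B: "\<And>x. x \<in> cball z (3 * \<rho>) \<Longrightarrow> norm (f x) \<le> B" by blast
  have "z \<in> cball z (3 * \<rho>)" using \<rho> by simp
  from B[OF this] have B0: "B \<ge> 0" by (rule order_trans[OF norm_ge_zero])
  have lip: "norm (f x - f y) \<le> B / \<rho> * norm (x - y)" if "x \<in> cball z (2 * \<rho>)" "y \<in> cball z (2 * \<rho>)" for x y
    using cauchy_lipschitz[OF f sub _ B that] \<rho> by simp
  show ?thesis
  proof (rule exI[of _ "B / \<rho> / \<rho>"], rule conjI[rotated], rule exI[of _ \<rho>], intro conjI allI impI)
    show "0 \<le> B / \<rho> / \<rho>" "\<rho> > 0" using B0 \<rho> by simp_all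
    fix w u :: "complex ^ 'n" and G G' :: "complex ^ 'n ^ 'n"
    assume w: "norm (w - z) \<le> \<rho>" and G: "(f has_derivative (\<lambda>u. G *v u)) (at w)"
      and G': "(f has_derivative (\<lambda>u. G' *v u)) (at z)"
    define a where "a = w - z"
    let ?\<phi> = "\<lambda>x. f (x + a) - f x"
    have sh: "x + a \<in> cball z (q + \<rho>)" if "x \<in> cball z q" for x q
    proof -
      have "dist z (x + a) = norm ((z - x) - a)" by (simp add: dist_norm algebra_simps)
      also have "\<dots> \<le> norm (z - x) + norm a" by (rule norm_triangle_ineq4)
      finally show ?thesis using that w by (simp add: a_def dist_norm)
    qed
    have "holo_on (\<lambda>x. f (x + a)) (cball z (2 * \<rho>))"
    proof (rule holo_on_compose[OF holo_on_add[OF holo_on_id holo_on_const] f])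
      show "(\<lambda>x. x + a) ` cball z (2 * \<rho>) \<subseteq> ball 0 1"
        using sh[of _ "2 * \<rho>"] sub by (auto simp: subset_iff)
    qed
    moreover have "cball z (2 * \<rho>) \<subseteq> cball z (3 * \<rho>)" using \<rho> by (intro subset_cball) simp
    ultimately have hol: "holo_on ?\<phi> (cball z (2 * \<rho>))"
      by (intro holo_on_diff) (auto intro: holo_on_subset[OF f] dest: subsetD[OF sub])
    have "((\<lambda>x. x + a) has_derivative (\<lambda>u. u)) (at z)" by (auto intro!: derivative_eq_intros)
    moreover have "(f has_derivative (\<lambda>u. G *v u)) (at (z + a))" using G by (simp add: a_def)
    ultimately have "((\<lambda>x. f (x + a)) has_derivative (\<lambda>u. G *v u)) (at z)"
      using has_derivative_compose by blast
    from has_derivative_diff[OF this G']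
    have der: "(?\<phi> has_derivative (\<lambda>u. (G - G') *v u)) (at z)" by (simp add: matrix_vector_mult_diff_rdistrib)
    have "norm ((G - G') *v u) \<le> (B / \<rho> * norm a) / \<rho> * norm u"
    proof (rule cauchy_derivative_bound[OF hol _ \<rho> _ der])
      show "cball z \<rho> \<subseteq> cball z (2 * \<rho>)" using \<rho> by (intro subset_cball) simp
      fix x assume x: "x \<in> cball z \<rho>"
      have "x + a \<in> cball z (2 * \<rho>)" using sh[OF x] by simp
      moreover have "x \<in> cball z (2 * \<rho>)" using x \<rho> by simp
      ultimately show "norm (f (x + a) - f x) \<le> B / \<rho> * norm a" using lip[of "x + a" x] by simp
    qed
    then show "norm (G *v u - G' *v u) \<le> B / \<rho> / \<rho> * norm (w - z) * norm u"
      by (simp add: matrix_vector_mult_diff_rdistrib a_def)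
  qed
qed

context loewner_key
begin

section \<open>Bounds and normalization of the limit\<close>

lemma g_bound:
  assumes "\<epsilon> > 0"
  obtains D where "D > 0" "\<And>z t. norm z < 1 \<Longrightarrow> 0 \<le> t \<Longrightarrow>
    norm (mexp ((- t) *\<^sub>R A) *v g z t) \<le> D * (1 + t ^ d) / (1 - norm z) powr (2 * (k_plus A / m_low A) + \<epsilon>)"
proof -
  have e: "\<epsilon> * m_low A / 4 > 0" using assms mA by simp
  obtain C1 where C1: "C1 > 0" "\<And>\<tau>. \<tau> \<ge> 0 \<Longrightarrow> norm (mexp (\<tau> *\<^sub>R A)) \<le> C1 * exp ((k_plus A + \<epsilon> * m_low A / 4) * \<tau>)"
    using mexp_growth[OF e, of A] by blast
  obtain C2 where C2: "C2 > 0" "\<And>\<tau>. \<tau> \<ge> 0 \<Longrightarrow> 1 + \<tau> ^ d \<le> C2 * exp (\<epsilon> * m_low A / 4 * \<tau>)"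
    using power_exp_bound[OF e, of d] by blast
  show thesis
  proof (rule that)
    show "C1 * (1 + real (n0 A) * c + C) * 2 ^ d * C2 * 4 powr (k_plus A / m_low A + \<epsilon> / 2) > 0"
      using C1(1) C2(1) c C by (intro mult_pos_pos) (auto simp: add_pos_nonneg)
  qed (rule g_growth[OF assms _ _ C1 C2])
qed

lemma g_bound_compact:
  assumes r: "0 \<le> r" "r < 1"
  shows "\<exists>B\<ge>0. \<forall>z t. norm z \<le> r \<longrightarrow> 0 \<le> t \<longrightarrow> norm (mexp ((- t) *\<^sub>R A) *v g z t) \<le> B * (1 + t ^ d)"
proof -
  obtain D where D: "D > 0" "\<And>z t. norm z < 1 \<Longrightarrow> 0 \<le> t \<Longrightarrow>
    norm (mexp ((- t) *\<^sub>R A) *v g z t) \<le> D * (1 + t ^ d) / (1 - norm z) powr (2 * (k_plus A / m_low A) + 1)"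
    using g_bound[of 1] by auto
  define p where "p = 2 * (k_plus A / m_low A) + 1"
  have "0 \<le> k_plus A / m_low A" using m_low_le_k_plus[of A] mA by (intro divide_nonneg_pos) auto
  then have p: "p \<ge> 0" by (simp add: p_def)
  show ?thesis
  proof (intro exI[of _ "D / (1 - r) powr p"] conjI allI impI)
    show "0 \<le> D / (1 - r) powr p" using D by simp
    fix z :: "complex ^ 'n" and t :: real assume z: "norm z \<le> r" and t: "0 \<le> t"
    have "norm (mexp ((- t) *\<^sub>R A) *v g z t) \<le> D * (1 + t ^ d) / (1 - norm z) powr p"
      using D(2)[of z t] z r t by (simp add: p_def)
    also have "\<dots> \<le> D * (1 + t ^ d) / (1 - r) powr p"
    proof (rule divide_left_mono)
      show "(1 - r) powr p \<le> (1 - norm z) powr p" using z r p by (intro powr_mono2) auto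
      show "0 \<le> D * (1 + t ^ d)" using D t by simp
      show "0 < (1 - norm z) powr p * (1 - r) powr p" using z r by simp
    qed
    finally show "norm (mexp ((- t) *\<^sub>R A) *v g z t) \<le> D / (1 - r) powr p * (1 + t ^ d)" by simp
  qed
qed

lemma poly_bounded: "poly_bounded_solution A g"
  unfolding poly_bounded_solution_def
proof (intro allI impI)
  fix K :: "(complex ^ 'n) set" assume "compact K \<and> K \<subseteq> ball 0 1"
  then obtain r where r: "0 \<le> r" "r < 1" "\<And>z. z \<in> K \<Longrightarrow> norm z \<le> r"
    using compact_in_ball_radius[of K] by blast
  obtain B where B: "\<And>z t. norm z \<le> r \<Longrightarrow> 0 \<le> t \<Longrightarrow> norm (mexp ((- t) *\<^sub>R A) *v g z t) \<le> B * (1 + t ^ d)"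
    using g_bound_compact[OF r(1,2)] by blast
  show "\<exists>C (P :: real poly). \<forall>z\<in>K. \<forall>t\<ge>0. norm (mexp ((- t) *\<^sub>R A) *v g z t) \<le> C * poly P t"
    by (intro exI[of _ B] exI[of _ "1 + monom 1 d"] ballI allI impI) (use B r(3) in \<open>simp add: poly_monom\<close>)
qed

lemma g_locally_bounded:
  assumes r: "0 \<le> r" "r < 1"
  shows "\<exists>B\<ge>0. \<forall>z t. norm z \<le> r \<longrightarrow> 0 \<le> t \<longrightarrow> t \<le> T \<longrightarrow> norm (g z t) \<le> B"
proof -
  obtain B where B: "B \<ge> 0" "\<And>z t. norm z \<le> r \<Longrightarrow> 0 \<le> t \<Longrightarrow> norm (mexp ((- t) *\<^sub>R A) *v g z t) \<le> B * (1 + t ^ d)"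
    using g_bound_compact[OF r] by blast
  have "continuous_on {0..T} (\<lambda>t. mexp (t *\<^sub>R A))"
    by (rule continuous_on_vector_derivative) (rule mexp_has_vector_derivative)
  from compact_imp_bounded[OF compact_continuous_image[OF this compact_Icc]]
  obtain E where "\<forall>M\<in>(\<lambda>t. mexp (t *\<^sub>R A)) ` {0..T}. norm M \<le> E"
    unfolding bounded_iff ..
  then have E: "norm (mexp (t *\<^sub>R A)) \<le> E" if "0 \<le> t" "t \<le> T" for t using that by auto
  show ?thesis
  proof (intro exI[of _ "\<bar>E\<bar> * (B * (1 + \<bar>T\<bar> ^ d))"] conjI allI impI)
    show "0 \<le> \<bar>E\<bar> * (B * (1 + \<bar>T\<bar> ^ d))" using B(1) by simp
    fix z :: "complex ^ 'n" and t assume z: "norm z \<le> r" and t: "0 \<le> t" "t \<le> T"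
    have "norm (g z t) = norm (mexp (t *\<^sub>R A) *v (mexp ((- t) *\<^sub>R A) *v g z t))" by (simp only: mexp_mexp_minus)
    also have "\<dots> \<le> norm (mexp (t *\<^sub>R A)) * norm (mexp ((- t) *\<^sub>R A) *v g z t)" by (rule norm_matrix_vector_le)
    also have "\<dots> \<le> \<bar>E\<bar> * (B * (1 + \<bar>T\<bar> ^ d))"
    proof (rule mult_mono)
      show "norm (mexp (t *\<^sub>R A)) \<le> \<bar>E\<bar>" using E[OF t] by linarith
      have "B * (1 + t ^ d) \<le> B * (1 + \<bar>T\<bar> ^ d)" using B(1) t by (intro mult_left_mono add_left_mono power_mono) auto
      with B(2)[OF z t(1)] show "norm (mexp ((- t) *\<^sub>R A) *v g z t) \<le> B * (1 + \<bar>T\<bar> ^ d)" by linarith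
    qed auto
    finally show "norm (g z t) \<le> \<bar>E\<bar> * (B * (1 + \<bar>T\<bar> ^ d))" .
  qed
qed

lemma g_zero:
  assumes "0 \<le> t"
  shows "g 0 t = 0"
proof -
  have "norm (mexp ((- t) *\<^sub>R A) *v g 0 t) \<le> 0" using g_quadratic[OF assms, of 0] by simp
  then have "mexp ((- t) *\<^sub>R A) *v g 0 t = 0" by simp
  then show ?thesis using mexp_mexp_minus[of t A "g 0 t"] by simp
qed

lemma g_derivative_zero:
  assumes t: "0 \<le> t"
  shows "((\<lambda>z. g z t) has_derivative (\<lambda>u. mexp (t *\<^sub>R A) *v u)) (at 0)"
proof -
  let ?p = "\<lambda>z. mexp ((- t) *\<^sub>R A) *v g z t"
  define D where "D = (real (n0 A) * c + C) * (1 + t ^ d)"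
  have D: "D \<ge> 0" using c C t by (simp add: D_def)
  have "(?p has_derivative (\<lambda>u. u)) (at 0 within UNIV)"
    unfolding has_derivative_within_alt
  proof (intro conjI allI impI)
    show "bounded_linear (\<lambda>u :: complex ^ 'n. u)" by (rule bounded_linear_ident)
    fix e :: real assume e: "e > 0"
    show "\<exists>\<delta>>0. \<forall>y\<in>UNIV. norm (y - 0) < \<delta> \<longrightarrow> norm (?p y - ?p 0 - (y - 0)) \<le> e * norm (y - 0)"
    proof (intro exI[of _ "min (1 / 4) (e / (D + 1))"] conjI ballI impI)
      show "0 < min (1 / 4) (e / (D + 1))" using e D by simp
      fix y :: "complex ^ 'n" assume "norm (y - 0) < min (1 / 4) (e / (D + 1))"
      then have y: "norm y \<le> 1 / 4" "norm y \<le> e / (D + 1)" by auto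
      have "norm (?p y - y) \<le> D * (norm y)\<^sup>2" using g_quadratic[OF t y(1)] by (simp add: D_def)
      also have "\<dots> = (D * norm y) * norm y" by (simp add: power2_eq_square)
      also have "\<dots> \<le> e * norm y"
      proof (rule mult_right_mono)
        have "D * norm y \<le> (D + 1) * (e / (D + 1))" using y(2) D by (intro mult_mono) auto
        then show "D * norm y \<le> e" using D by simp
      qed simp
      finally show "norm (?p y - ?p 0 - (y - 0)) \<le> e * norm (y - 0)" by (simp add: g_zero[OF t])
    qed
  qed
  from bounded_linear.has_derivative[OF bounded_bilinear.bounded_linear_right[OF bounded_bilinear_matrix_vector] this, of "mexp (t *\<^sub>R A)"]
  show ?thesis by (simp only: mexp_mexp_minus)
qed

text \<open>By the semigroup property it suffices to separate the points \<open>v z s t\<close> for one large \<open>t\<close>; these shrink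
  exponentially, whereas the normalized \<open>g(\<cdot>, t)\<close> is a small perturbation of the identity on a ball
  whose radius decays only polynomially.\<close>

lemma g_injective:
  assumes s: "0 \<le> s"
  shows "inj_on (\<lambda>z. g z s) (ball 0 1)"
proof (rule inj_onI, rule ccontr)
  fix z z' :: "complex ^ 'n" assume z: "z \<in> ball 0 1" "z' \<in> ball 0 1" and eq: "g z s = g z' s" and ne: "z \<noteq> z'"
  define r where "r = max (norm z) (norm z')"
  have r: "0 \<le> r" "r < 1" "norm z \<le> r" "norm z' \<le> r" using z by (auto simp: r_def max_def)
  define b where "b = r / (1 - r)\<^sup>2"
  have decay: "norm (v x s t) \<le> exp (- (m_low A * (t - s))) * b" if "norm x \<le> r" "s \<le> t" for x t
  proof -
    have "norm (v x s t) \<le> exp (- (m_low A * (t - s))) * (norm x / (1 - norm x)\<^sup>2)"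
      using that r by (intro v_decay s) auto
    also have "\<dots> \<le> exp (- (m_low A * (t - s))) * b"
      unfolding b_def using that r by (intro mult_left_mono frac_le power_mono) auto
    finally show ?thesis .
  qed
  define D where "D = real (n0 A) * c + C"
  have D: "D \<ge> 0" using c C by (simp add: D_def)
  \<comment> \<open>One half of the decay rate absorbs the weight \<open>1 + t ^ d\<close>, the
    other half is left.\<close>
  have m2: "m_low A / 2 > 0" using mA by simp
  obtain C2 where C2: "C2 > 0" "\<And>\<tau>. \<tau> \<ge> 0 \<Longrightarrow> 1 + \<tau> ^ d \<le> C2 * exp (m_low A / 2 * \<tau>)"
    using power_exp_bound[OF m2, of d] by blast
  define b1 where "b1 = exp (m_low A * s) * b"
  \<comment> \<open>\<open>T1\<close> brings \<rho> below the radius 1/4 of the quadratic estimate,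
    \<open>T2\<close> makes the Lipschitz constant of the perturbation less than 1.\<close>
  obtain T1 where T1: "\<And>t. t \<ge> T1 \<Longrightarrow> (2 * b1 + 1) * exp (- (m_low A * t)) < 1 / 4"
    using exp_decay_small[OF mA, of "1 / 4"] by auto
  obtain T2 where T2: "\<And>t. t \<ge> T2 \<Longrightarrow> (2 * D * C2 * (2 * b1 + 1)) * exp (- (m_low A / 2 * t)) < 1"
    using exp_decay_small[OF m2, of 1] by auto
  define t where "t = max s (max T1 T2)"
  have t: "s \<le> t" "0 \<le> t" "T1 \<le> t" "T2 \<le> t" using s by (auto simp: t_def)
  \<comment> \<open>Twice a bound for both points, which therefore lie in the ball of radius
    \<rho>/2; the summand 1 keeps \<rho> positive.\<close>
  define \<rho> where "\<rho> = (2 * b1 + 1) * exp (- (m_low A * t))"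
  have b1: "b1 \<ge> 0" using r by (simp add: b1_def b_def)
  have \<rho>: "0 < \<rho>" "\<rho> < 1 / 4" using T1[OF t(3)] b1 by (auto simp: \<rho>_def add_nonneg_pos)
  have vs: "norm (v x s t) \<le> \<rho> / 2" if "norm x \<le> r" for x
  proof -
    have "exp (- (m_low A * (t - s))) = exp (m_low A * s) * exp (- (m_low A * t))"
      by (simp add: algebra_simps flip: exp_add)
    with decay[OF that t(1)] have "norm (v x s t) \<le> b1 * exp (- (m_low A * t))"
      by (simp add: b1_def mult_ac)
    also have "\<dots> \<le> (b1 + 1 / 2) * exp (- (m_low A * t))" by (intro mult_right_mono) auto
    also have "\<dots> = \<rho> / 2" by (simp add: \<rho>_def field_simps)
    finally show ?thesis .
  qed
  define w w' where "w = v z s t" and "w' = v z' s t"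
  \<comment> \<open>The deviation from the identity. Equal values of \<open>g\<close> turn its
    increment into \<open>w' - w\<close>, which is incompatible with a Lipschitz constant below 1
    for distinct points.\<close>
  let ?q = "\<lambda>x. mexp ((- t) *\<^sub>R A) *v g x t - x"
  have "g w t = g w' t"
    unfolding w_def w'_def using g_semigroup[OF s t(1), of z] g_semigroup[OF s t(1), of z'] eq z by simp
  then have qq: "?q w - ?q w' = w' - w" by simp
  have hq: "holo_on ?q (ball 0 1)"
    by (intro holo_on_diff holo_on_matrix g_holo t holo_on_id)
  have "norm (?q w - ?q w') \<le> (D * (1 + t ^ d) * \<rho>\<^sup>2) / (\<rho> - \<rho> / 2) * norm (w - w')"
  proof (rule cauchy_lipschitz[OF hq, of 0])
    show "cball 0 \<rho> \<subseteq> ball 0 1" "\<rho> / 2 < \<rho>" using \<rho> by auto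
    show "norm (?q x) \<le> D * (1 + t ^ d) * \<rho>\<^sup>2" if "x \<in> cball 0 \<rho>" for x
    proof -
      have "norm (?q x) \<le> D * (1 + t ^ d) * (norm x)\<^sup>2"
        unfolding D_def using that \<rho> by (intro g_quadratic t) auto
      also have "\<dots> \<le> D * (1 + t ^ d) * \<rho>\<^sup>2"
        using that D t by (intro mult_left_mono power_mono) auto
      finally show ?thesis .
    qed
    show "w \<in> cball 0 (\<rho> / 2)" "w' \<in> cball 0 (\<rho> / 2)" using vs r by (auto simp: w_def w'_def)
  qed
  also have "(D * (1 + t ^ d) * \<rho>\<^sup>2) / (\<rho> - \<rho> / 2) = 2 * D * (1 + t ^ d) * \<rho>"
    using \<rho> by (simp add: power2_eq_square field_simps)
  finally have le: "norm (w - w') \<le> 2 * D * (1 + t ^ d) * \<rho> * norm (w - w')"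
    unfolding qq by (simp add: norm_minus_commute)
  have "2 * D * (1 + t ^ d) * \<rho> \<le> 2 * D * (C2 * exp (m_low A / 2 * t)) * \<rho>"
    using C2(2)[OF t(2)] D \<rho> by (intro mult_right_mono mult_left_mono) auto
  also have "\<dots> = (2 * D * C2 * (2 * b1 + 1)) * (exp (m_low A / 2 * t) * exp (- (m_low A * t)))"
    by (simp add: \<rho>_def)
  also have "exp (m_low A / 2 * t) * exp (- (m_low A * t)) = exp (- (m_low A / 2 * t))"
    by (simp add: field_simps flip: exp_add)
  also have "(2 * D * C2 * (2 * b1 + 1)) * exp (- (m_low A / 2 * t)) < 1" by (rule T2[OF t(4)])
  finally have lt: "2 * D * (1 + t ^ d) * \<rho> < 1" .
  have "w \<noteq> w'"
    using inj_onD[OF v_inj[OF s t(1)], of z z'] z ne by (auto simp: w_def w'_def)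
  then have "2 * D * (1 + t ^ d) * \<rho> * norm (w - w') < 1 * norm (w - w')"
    using lt by (intro mult_strict_right_mono) auto
  with le show False by simp
qed

section \<open>The chain property and regularity in time\<close>

lemma g_loewner_chain: "loewner_chain g"
  unfolding loewner_chain_def univalent_on_def
proof (intro conjI allI impI)
  fix s t :: real assume st: "0 \<le> s \<and> s \<le> t"
  show "\<exists>w. holo_on w (ball 0 1) \<and> w ` ball 0 1 \<subseteq> ball 0 1 \<and> w 0 = 0 \<and> (\<forall>z\<in>ball 0 1. g z s = g (w z) t)"
  proof (intro exI[of _ "\<lambda>z. v z s t"] conjI ballI)
    show "(\<lambda>z. v z s t) ` ball 0 1 \<subseteq> ball 0 1" using st v_ball by auto
    show "g z s = g (v z s t) t" if "z \<in> ball 0 1" for z using g_semigroup[of s t z] st that by simp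
  qed (use st v_holo v_zero in auto)
qed (use g_holo g_injective in auto)

text \<open>The semigroup property turns a time increment at \<open>z\<close> into the spatial
  increment from \<open>v z s t\<close> to \<open>z\<close> at the later time; a Cauchy estimate and
  the bounded speed of trajectories finish the proof.\<close>

lemma g_time_lipschitz:
  assumes r: "0 \<le> r" "r < 1"
  shows "\<exists>\<Lambda>\<ge>0. \<forall>z s t. norm z \<le> r \<longrightarrow> 0 \<le> s \<longrightarrow> s \<le> t \<longrightarrow> t \<le> T \<longrightarrow> norm (g z t - g z s) \<le> \<Lambda> * (t - s)"
proof -
  define r' where "r' = (1 + r) / 2"
  have r': "0 \<le> r'" "r' < 1" "r < r'" using r by (auto simp: r'_def)
  obtain B where B: "B \<ge> 0" "\<And>z t. norm z \<le> r' \<Longrightarrow> 0 \<le> t \<Longrightarrow> t \<le> T \<Longrightarrow> norm (g z t) \<le> B"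
    using g_locally_bounded[OF r'(1,2), of T] by blast
  define M where "M = 8 * norm A / (1 - r)\<^sup>2"
  have M: "M \<ge> 0" using r by (simp add: M_def)
  show ?thesis
  proof (intro exI[of _ "B / (r' - r) * M"] conjI allI impI)
    show "0 \<le> B / (r' - r) * M" using B r' M by simp
    fix z :: "complex ^ 'n" and s t assume z: "norm z \<le> r" and st: "0 \<le> s" "s \<le> t" "t \<le> T"
    have z1: "norm z < 1" using z r by simp
    have "norm (g z t - g (v z s t) t) \<le> B / (r' - r) * norm (z - v z s t)"
    proof (rule cauchy_lipschitz[of "\<lambda>z. g z t" "ball 0 1" 0])
      show "holo_on (\<lambda>z. g z t) (ball 0 1)" using st by (intro g_holo) simp
      show "norm (g w t) \<le> B" if "w \<in> cball 0 r'" for w using that st by (intro B) auto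
      show "v z s t \<in> cball 0 r" using v_norm_le[OF st(1,2) z1] z by simp
    qed (use r' z in auto)
    also have "\<dots> \<le> B / (r' - r) * (M * (t - s))"
      using v_move[OF st(1) order_refl st(2) z r(2)] B r' v_refl[OF st(1) z1]
      by (intro mult_left_mono) (auto simp: M_def norm_minus_commute)
    finally show "norm (g z t - g z s) \<le> B / (r' - r) * M * (t - s)"
      using g_semigroup[OF st(1,2) z1] by (simp add: mult.assoc)
  qed
qed

lemma g_unif_loc_abs_cont:
  assumes "compact K" "K \<subseteq> ball 0 1"
  shows "unif_loc_abs_cont K (\<lambda>z s t. norm (g z t - g z s))"
  unfolding unif_loc_abs_cont_def
proof (intro allI impI)
  fix T \<epsilon> :: real assume "0 \<le> T" and e: "0 < \<epsilon>"
  obtain r where r: "0 \<le> r" "r < 1" "\<And>z. z \<in> K \<Longrightarrow> norm z \<le> r"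
    using compact_in_ball_radius[OF assms] by blast
  obtain \<Lambda> where \<Lambda>: "\<Lambda> \<ge> 0" "\<And>z s t. norm z \<le> r \<Longrightarrow> 0 \<le> s \<Longrightarrow> s \<le> t \<Longrightarrow> t \<le> T \<Longrightarrow> norm (g z t - g z s) \<le> \<Lambda> * (t - s)"
    using g_time_lipschitz[OF r(1,2), of T] by blast
  show "\<exists>\<delta>>0. \<forall>(N::nat) a b. (\<forall>i<N. 0 \<le> a i \<and> a i \<le> b i \<and> b i \<le> T) \<longrightarrow>
     (\<forall>i<N. \<forall>j<N. i \<noteq> j \<longrightarrow> {a i<..<b i} \<inter> {a j<..<b j} = {}) \<longrightarrow>
     (\<Sum>i<N. b i - a i) < \<delta> \<longrightarrow> (\<forall>z\<in>K. (\<Sum>i<N. norm (g z (b i) - g z (a i))) < \<epsilon>)"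
  proof (intro exI[of _ "\<epsilon> / (\<Lambda> + 1)"] conjI allI impI ballI)
    show "0 < \<epsilon> / (\<Lambda> + 1)" using e \<Lambda>(1) by simp
    fix N :: nat and a b :: "nat \<Rightarrow> real" and z
    assume ab: "\<forall>i<N. 0 \<le> a i \<and> a i \<le> b i \<and> b i \<le> T" and sm: "(\<Sum>i<N. b i - a i) < \<epsilon> / (\<Lambda> + 1)" and z: "z \<in> K"
    have "(\<Sum>i<N. norm (g z (b i) - g z (a i))) \<le> (\<Sum>i<N. \<Lambda> * (b i - a i))"
      by (intro sum_mono \<Lambda>(2) r(3) z) (use ab in auto)
    also have "\<dots> = \<Lambda> * (\<Sum>i<N. b i - a i)" by (rule sum_distrib_left[symmetric])
    also have "\<dots> \<le> (\<Lambda> + 1) * (\<Sum>i<N. b i - a i)"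
      using ab by (intro mult_right_mono sum_nonneg) auto
    also have "\<dots> < (\<Lambda> + 1) * (\<epsilon> / (\<Lambda> + 1))" using sm \<Lambda>(1) by (intro mult_strict_left_mono) auto
    also have "\<dots> = \<epsilon>" using \<Lambda>(1) by simp
    finally show "(\<Sum>i<N. norm (g z (b i) - g z (a i))) < \<epsilon>" .
  qed
qed

text \<open>The time increment is holomorphic in space and bounded by a multiple of |t - s|, so its
  spatial Lipschitz constant carries the same factor.\<close>

lemma g_mixed_lipschitz:
  assumes r: "0 \<le> r" "r < 1"
  shows "\<exists>L\<ge>0. \<forall>w w' s t. norm w \<le> r \<longrightarrow> norm w' \<le> r \<longrightarrow> 0 \<le> s \<longrightarrow> s \<le> T \<longrightarrow> 0 \<le> t \<longrightarrow> t \<le> T \<longrightarrow>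
     norm ((g w t - g w s) - (g w' t - g w' s)) \<le> L * \<bar>t - s\<bar> * norm (w - w')"
proof -
  define r' where "r' = (1 + r) / 2"
  have r': "0 \<le> r'" "r' < 1" "r < r'" using r by (auto simp: r'_def)
  obtain \<Lambda> where \<Lambda>: "\<Lambda> \<ge> 0" "\<And>z s t. norm z \<le> r' \<Longrightarrow> 0 \<le> s \<Longrightarrow> s \<le> t \<Longrightarrow> t \<le> T \<Longrightarrow> norm (g z t - g z s) \<le> \<Lambda> * (t - s)"
    using g_time_lipschitz[OF r'(1,2), of T] by blast
  show ?thesis
  proof (intro exI[of _ "\<Lambda> / (r' - r)"] conjI allI impI)
    show "0 \<le> \<Lambda> / (r' - r)" using \<Lambda> r' by simp
    fix w w' :: "complex ^ 'n" and s t
    assume w: "norm w \<le> r" "norm w' \<le> r" and st: "0 \<le> s" "s \<le> T" "0 \<le> t" "t \<le> T"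
    have "norm ((g w t - g w s) - (g w' t - g w' s)) \<le> (\<Lambda> * \<bar>t - s\<bar>) / (r' - r) * norm (w - w')"
    proof (rule cauchy_lipschitz[of "\<lambda>z. g z t - g z s" "ball 0 1" 0])
      show "holo_on (\<lambda>z. g z t - g z s) (ball 0 1)" by (intro holo_on_diff g_holo st)
      show "norm (g x t - g x s) \<le> \<Lambda> * \<bar>t - s\<bar>" if "x \<in> cball 0 r'" for x
      proof (cases "s \<le> t")
        case True
        then show ?thesis using \<Lambda>(2)[of x s t] that st by simp
      next
        case False
        then show ?thesis using \<Lambda>(2)[of x t s] that st by (simp add: norm_minus_commute)
      qed
    qed (use r' w in auto)
    then show "norm ((g w t - g w s) - (g w' t - g w' s)) \<le> \<Lambda> / (r' - r) * \<bar>t - s\<bar> * norm (w - w')" by simp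
  qed
qed

section \<open>The differential equation outside one null set of times\<close>

definition g_rate :: "complex ^ 'n \<Rightarrow> real \<Rightarrow> complex ^ 'n" where
  "g_rate z t = frechet_derivative (\<lambda>w. g w t) (at z) (h z t)"

lemma g_rate_eq:
  assumes "((\<lambda>w. g w t) has_derivative (\<lambda>u. G *v u)) (at z)"
  shows "g_rate z t = G *v h z t"
  unfolding g_rate_def frechet_derivative_at[OF assms, symmetric] ..

lemma g_derivative:
  assumes "0 \<le> t" "norm z < 1"
  obtains G where "((\<lambda>w. g w t) has_derivative (\<lambda>u. G *v u)) (at z)"
proof -
  have "z \<in> ball 0 1" using assms(2) by simp
  then show thesis using g_holo[OF assms(1)] that unfolding holo_on_def by blast
qed

text \<open>Lets the right side of the equation be carried from nearby points to a given
  one.\<close>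

lemma g_rate_continuous:
  assumes t: "0 \<le> t" and z: "norm z < 1" and e: "\<epsilon> > 0"
  shows "\<exists>\<delta>>0. \<forall>w. norm (w - z) < \<delta> \<longrightarrow> norm w < 1 \<longrightarrow> norm (g_rate w t - g_rate z t) < \<epsilon>"
proof -
  obtain G0 where G0: "((\<lambda>w. g w t) has_derivative (\<lambda>u. G0 *v u)) (at z)" using g_derivative[OF t z] by blast
  obtain L \<rho> where L: "L \<ge> 0" "\<rho> > 0" "\<And>w G u. norm (w - z) \<le> \<rho> \<Longrightarrow> ((\<lambda>w. g w t) has_derivative (\<lambda>u. G *v u)) (at w) \<Longrightarrow>
      norm (G *v u - G0 *v u) \<le> L * norm (w - z) * norm u"
    using holo_derivative_lipschitz[OF g_holo[OF t] z] G0 by blast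
  define r where "r = (1 + norm z) / 2"
  have r: "r < 1" "norm z \<le> r" using z by (auto simp: r_def)
  define M where "M = 8 * norm A / (1 - r)\<^sup>2"
  define M' where "M' = 64 * norm A / (1 - r) ^ 3"
  have M: "M \<ge> 0" "M' \<ge> 0" using r by (auto simp: M_def M'_def)
  define X where "X = L * M + norm G0 * M' + 1"
  have X: "X > 0" using L M by (simp add: X_def add_nonneg_pos)
  show ?thesis
  proof (intro exI[of _ "min \<rho> (min ((1 - norm z) / 2) (\<epsilon> / X))"] conjI allI impI)
    show "0 < min \<rho> (min ((1 - norm z) / 2) (\<epsilon> / X))" using L z e X by simp
    fix w assume "norm (w - z) < min \<rho> (min ((1 - norm z) / 2) (\<epsilon> / X))" and w1: "norm w < 1"
    then have w: "norm (w - z) \<le> \<rho>" "norm (w - z) < (1 - norm z) / 2" "norm (w - z) < \<epsilon> / X" by auto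
    have wr: "norm w \<le> r" using w(2) norm_triangle_sub[of w z] by (simp add: r_def)
    obtain G where G: "((\<lambda>w. g w t) has_derivative (\<lambda>u. G *v u)) (at w)" using g_derivative[OF t w1] by blast
    have "g_rate w t - g_rate z t = (G *v h w t - G0 *v h w t) + G0 *v (h w t - h z t)"
      by (simp add: g_rate_eq[OF G] g_rate_eq[OF G0] matrix_vector_mult_diff_distrib)
    then have "norm (g_rate w t - g_rate z t) \<le> norm (G *v h w t - G0 *v h w t) + norm (G0 *v (h w t - h z t))"
      by (simp only: norm_triangle_ineq)
    also have "norm (G *v h w t - G0 *v h w t) \<le> L * norm (w - z) * M"
      by (rule order_trans[OF L(3)[OF w(1) G] mult_left_mono]) (use h_bound[OF t wr r(1)] L in \<open>auto simp: M_def\<close>)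
    also have "norm (G0 *v (h w t - h z t)) \<le> norm G0 * (M' * norm (w - z))"
      by (rule order_trans[OF norm_matrix_vector_le mult_left_mono]) (use h_lipschitz[OF t wr r(2,1)] in \<open>auto simp: M'_def\<close>)
    also have "L * norm (w - z) * M + norm G0 * (M' * norm (w - z)) \<le> X * norm (w - z)"
      by (simp add: X_def algebra_simps)
    also have "\<dots> < \<epsilon>" using w(3) X by (simp add: field_simps)
    finally show "norm (g_rate w t - g_rate z t) < \<epsilon>" by simp
  qed
qed

text \<open>The exceptional null set has to be independent of \<open>z\<close>.  At a time \<open>t\<close> outside the null sets of
  countably many trajectories the equation holds at the points \<open>v z s t\<close> with \<open>z\<close> in a dense set and
  \<open>s < t\<close> rational.  Those points are dense, and the difference quotients of \<open>g\<close> in time are uniformly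
  Lipschitz in \<open>z\<close>, so the equation extends to the whole ball.\<close>

lemma pde_on_trajectory:
  assumes s: "0 \<le> s" "s < t" and z: "norm z < 1"
    and vd: "((\<lambda>\<tau>. v z s \<tau>) has_vector_derivative - h (v z s t) t) (at t within {s..})" and e: "\<epsilon> > 0"
  shows "\<exists>\<delta>>0. \<forall>\<tau>\<ge>0. \<bar>\<tau> - t\<bar> < \<delta> \<longrightarrow>
     norm (g (v z s t) \<tau> - g (v z s t) t - (\<tau> - t) *\<^sub>R g_rate (v z s t) t) \<le> \<epsilon> * \<bar>\<tau> - t\<bar>"
proof -
  define w where "w = v z s t"
  have t0: "0 \<le> t" using s by simp
  have w1: "norm w < 1" using v_ball[of s t z] s z by (simp add: w_def)
  have wz: "norm w \<le> norm z" using v_norm_le[of s t z] s z by (simp add: w_def)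
  obtain G where G: "((\<lambda>w. g w t) has_derivative (\<lambda>u. G *v u)) (at w)" using g_derivative[OF t0 w1] by blast
  obtain L where L: "L \<ge> 0" "\<And>w w' a b. norm w \<le> norm z \<Longrightarrow> norm w' \<le> norm z \<Longrightarrow> 0 \<le> a \<Longrightarrow> a \<le> t + 1 \<Longrightarrow> 0 \<le> b \<Longrightarrow> b \<le> t + 1 \<Longrightarrow>
     norm ((g w b - g w a) - (g w' b - g w' a)) \<le> L * \<bar>b - a\<bar> * norm (w - w')"
    using g_mixed_lipschitz[OF norm_ge_zero z, of "t + 1"] by blast
  obtain L' where L': "\<And>a b. s \<le> a \<Longrightarrow> s \<le> b \<Longrightarrow> norm (v z s b - v z s a) \<le> L' * \<bar>b - a\<bar>"
    using v_lipschitz[OF s(1) z] by blast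
  have "((\<lambda>\<tau>. g (v z s \<tau>) t) has_derivative (\<lambda>x. G *v (x *\<^sub>R - h w t))) (at t within {s..})"
    by (rule has_derivative_compose[OF vd[unfolded has_vector_derivative_def w_def[symmetric]]]) (use G in \<open>simp add: w_def\<close>)
  moreover have "G *v (x *\<^sub>R - h w t) = - (x *\<^sub>R g_rate w t)" for x
    by (simp add: g_rate_eq[OF G] bounded_bilinear.scaleR_right[OF bounded_bilinear_matrix_vector]
        bounded_bilinear.minus_right[OF bounded_bilinear_matrix_vector])
  ultimately have "((\<lambda>\<tau>. g (v z s \<tau>) t) has_derivative (\<lambda>x. - (x *\<^sub>R g_rate w t))) (at t within {s..})" by simp
  moreover have "\<epsilon> / 2 > 0" using e by simp
  ultimately obtain \<delta>1 where \<delta>1: "\<delta>1 > 0" "\<And>\<tau>. \<tau> \<ge> s \<Longrightarrow> \<bar>\<tau> - t\<bar> < \<delta>1 \<Longrightarrow>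
     norm (g (v z s \<tau>) t - g w t + (\<tau> - t) *\<^sub>R g_rate w t) \<le> \<epsilon> / 2 * \<bar>\<tau> - t\<bar>"
    unfolding has_derivative_within_alt w_def[symmetric] by fastforce
  define X where "X = 2 * (L * \<bar>L'\<bar> + 1)"
  have X: "X > 0" using L(1) by (simp add: X_def add_nonneg_pos)
  show ?thesis unfolding w_def[symmetric]
  \<comment> \<open>The entry \<open>t - s\<close> keeps \<tau> above \<open>s\<close>, so that the
    trajectory is available on both sides of \<open>t\<close>; this is where the strict inequality
    \<open>s < t\<close> enters.\<close>
  proof (intro exI[of _ "min (min \<delta>1 (t - s)) (min 1 (\<epsilon> / X))"] conjI allI impI)
    show "0 < min (min \<delta>1 (t - s)) (min 1 (\<epsilon> / X))" using \<delta>1 s e X by simp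
    fix \<tau> :: real assume t0': "0 \<le> \<tau>" and "\<bar>\<tau> - t\<bar> < min (min \<delta>1 (t - s)) (min 1 (\<epsilon> / X))"
    then have \<tau>: "\<bar>\<tau> - t\<bar> < \<delta>1" "\<bar>\<tau> - t\<bar> < t - s" "\<bar>\<tau> - t\<bar> < 1" "\<bar>\<tau> - t\<bar> < \<epsilon> / X" by auto
    have s\<tau>: "s \<le> \<tau>" "\<tau> \<le> t + 1" using \<tau> by auto
    define x where "x = v z s \<tau>"
    have xz: "norm x \<le> norm z" unfolding x_def by (rule v_norm_le[OF s(1) s\<tau>(1) z])
    \<comment> \<open>\<open>g\<close> is constant along trajectories. Hence the time increment at
      the fixed point \<open>w\<close> is minus a spatial increment, up to the mixed difference
      bounded next.\<close>
    have gx: "g x \<tau> = g w t"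
      unfolding x_def w_def using g_semigroup[OF s(1) s\<tau>(1) z] g_semigroup[OF s(1) less_imp_le[OF s(2)] z] by simp
    have 1: "norm ((g x \<tau> - g x t) - (g w \<tau> - g w t)) \<le> \<epsilon> / 2 * \<bar>\<tau> - t\<bar>"
    proof -
      have "norm (x - w) \<le> \<bar>L'\<bar> * \<bar>\<tau> - t\<bar>"
        unfolding x_def w_def
        by (rule order_trans[OF L' mult_right_mono[OF abs_ge_self abs_ge_zero]]) (use s s\<tau> in auto)
      then have "L * \<bar>\<tau> - t\<bar> * norm (x - w) \<le> L * \<bar>\<tau> - t\<bar> * (\<bar>L'\<bar> * \<bar>\<tau> - t\<bar>)"
        using L(1) by (intro mult_left_mono) auto
      also have "\<dots> = (L * \<bar>L'\<bar>) * \<bar>\<tau> - t\<bar> * \<bar>\<tau> - t\<bar>" by simp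
      also have "\<dots> \<le> (X / 2) * \<bar>\<tau> - t\<bar> * \<bar>\<tau> - t\<bar>" by (intro mult_right_mono) (auto simp: X_def)
      also have "\<dots> \<le> \<epsilon> / 2 * \<bar>\<tau> - t\<bar>"
        using \<tau>(4) X by (intro mult_right_mono) (auto simp: field_simps)
      finally show ?thesis
        using L(2)[OF xz wz t0 _ t0' s\<tau>(2)] by simp
    qed
    have 2: "norm (g x t - g w t + (\<tau> - t) *\<^sub>R g_rate w t) \<le> \<epsilon> / 2 * \<bar>\<tau> - t\<bar>"
      unfolding x_def by (rule \<delta>1(2)[OF s\<tau>(1) \<tau>(1)])
    have "g w \<tau> - g w t - (\<tau> - t) *\<^sub>R g_rate w t =
       - ((g x \<tau> - g x t) - (g w \<tau> - g w t)) - (g x t - g w t + (\<tau> - t) *\<^sub>R g_rate w t)"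
      by (simp add: gx)
    then have "norm (g w \<tau> - g w t - (\<tau> - t) *\<^sub>R g_rate w t) \<le>
       norm ((g x \<tau> - g x t) - (g w \<tau> - g w t)) + norm (g x t - g w t + (\<tau> - t) *\<^sub>R g_rate w t)"
      by (simp only: norm_triangle_ineq4[THEN order_trans] norm_minus_cancel order_refl)
    with 1 2 show "norm (g w \<tau> - g w t - (\<tau> - t) *\<^sub>R g_rate w t) \<le> \<epsilon> * \<bar>\<tau> - t\<bar>" by simp
  qed
qed

lemma pde_propagate:
  assumes t: "0 < t" and z0: "norm z0 < 1"
    and dense: "\<And>X. open X \<Longrightarrow> X \<noteq> {} \<Longrightarrow> \<exists>z\<in>Z. z \<in> X"
    and vd: "\<And>z s. z \<in> Z \<Longrightarrow> norm z < 1 \<Longrightarrow> s \<in> \<rat> \<Longrightarrow> 0 \<le> s \<Longrightarrow> s < t \<Longrightarrow>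
      ((\<lambda>\<tau>. v z s \<tau>) has_vector_derivative - h (v z s t) t) (at t within {s..})"
  shows "((\<lambda>\<tau>. g z0 \<tau>) has_vector_derivative g_rate z0 t) (at t within {0..})"
  unfolding has_vector_derivative_def has_derivative_within_alt
proof (intro conjI allI impI bounded_linear_scaleR_left)
  fix \<epsilon> :: real assume e: "\<epsilon> > 0"
  have t0: "0 \<le> t" using t by simp
  define r where "r = (1 + norm z0) / 2"
  have r: "0 \<le> r" "r < 1" "norm z0 \<le> r" using z0 by (auto simp: r_def)
  obtain L where L: "L \<ge> 0" "\<And>w w' a b. norm w \<le> r \<Longrightarrow> norm w' \<le> r \<Longrightarrow> 0 \<le> a \<Longrightarrow> a \<le> t + 1 \<Longrightarrow> 0 \<le> b \<Longrightarrow> b \<le> t + 1 \<Longrightarrow>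
     norm ((g w b - g w a) - (g w' b - g w' a)) \<le> L * \<bar>b - a\<bar> * norm (w - w')"
    using g_mixed_lipschitz[OF r(1,2), of "t + 1"] by blast
  have e3: "\<epsilon> / 3 > 0" using e by simp
  obtain \<delta>a where \<delta>a: "\<delta>a > 0" "\<And>w. norm (w - z0) < \<delta>a \<Longrightarrow> norm w < 1 \<Longrightarrow> norm (g_rate w t - g_rate z0 t) < \<epsilon> / 3"
    using g_rate_continuous[OF t0 z0 e3] by blast
  \<comment> \<open>Three demands: the rates at \<open>w\<close> and \<open>z0\<close> differ by
    less than \<epsilon>/3, the points stay within radius \<open>r\<close>, and the mixed difference
    contributes at most \<epsilon>/3.\<close>
  define \<delta>' where "\<delta>' = min \<delta>a (min ((1 - norm z0) / 2) (\<epsilon> / (3 * (L + 1))))"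
  have \<delta>': "\<delta>' > 0" using \<delta>a z0 e L by (simp add: \<delta>'_def)
  obtain z where z: "z \<in> Z" "norm (z - z0) < \<delta>' / 2"
    using dense[of "ball z0 (\<delta>' / 2)"] \<delta>' by (auto simp: dist_norm norm_minus_commute)
  have zr: "norm z \<le> r"
    using z(2) norm_triangle_sub[of z z0] \<delta>' by (auto simp: r_def \<delta>'_def)
  have z1: "norm z < 1" using zr r by simp
  define M where "M = 8 * norm A / (1 - r)\<^sup>2"
  have M: "M \<ge> 0" using r by (simp add: M_def)
  \<comment> \<open>The start is so shortly before \<open>t\<close> that the trajectory of
    \<open>z\<close> moves by at most \<delta>'/2 and its point at time \<open>t\<close> is still
    near \<open>z0\<close>.\<close>
  obtain s where s: "s \<in> \<rat>" "max 0 (t - \<delta>' / (2 * (M + 1))) < s" "s < t"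
    using Rats_dense_in_real[of "max 0 (t - \<delta>' / (2 * (M + 1)))" t] t \<delta>' M by auto
  define w where "w = v z s t"
  have s0: "0 \<le> s" using s by simp
  have wr: "norm w \<le> r" using v_norm_le[OF s0 less_imp_le[OF s(3)] z1] zr by (simp add: w_def)
  have w1: "norm w < 1" using wr r by simp
  have wz: "norm (w - z0) < \<delta>'"
  proof -
    have "norm (w - z) \<le> M * (t - s)"
      using v_move[OF s0 order_refl less_imp_le[OF s(3)] zr r(2)] v_refl[OF s0 z1] by (simp add: w_def M_def)
    also have "\<dots> \<le> (M + 1) * (t - s)" using s by (intro mult_right_mono) auto
    also have "\<dots> \<le> \<delta>' / 2"
    proof -
      have "t - s \<le> \<delta>' / (2 * (M + 1))" using s by simp
      then have "(M + 1) * (t - s) \<le> (M + 1) * (\<delta>' / (2 * (M + 1)))" using M by (intro mult_left_mono) auto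
      also have "\<dots> = \<delta>' / 2" using M by (intro mult_divide_mult_cancel_pos) simp
      finally show ?thesis .
    qed
    finally have "norm (w - z) \<le> \<delta>' / 2" .
    moreover have "norm (w - z0) \<le> norm (w - z) + norm (z - z0)"
      using norm_triangle_ineq[of "w - z" "z - z0"] by simp
    ultimately show ?thesis using z(2) by linarith
  qed
  have rate: "norm (g_rate w t - g_rate z0 t) < \<epsilon> / 3" using \<delta>a(2)[of w] wz w1 by (simp add: \<delta>'_def)
  have Lw: "L * norm (z0 - w) \<le> \<epsilon> / 3"
  proof -
    have "L * norm (z0 - w) \<le> (L + 1) * (\<epsilon> / (3 * (L + 1)))"
      using wz L(1) by (intro mult_mono) (auto simp: \<delta>'_def norm_minus_commute)
    also have "\<dots> = \<epsilon> / 3" using L(1) by (intro mult_divide_mult_cancel_pos) simp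
    finally show ?thesis .
  qed
  obtain \<delta> where \<delta>: "\<delta> > 0" "\<And>\<tau>. \<tau> \<ge> 0 \<Longrightarrow> \<bar>\<tau> - t\<bar> < \<delta> \<Longrightarrow> norm (g w \<tau> - g w t - (\<tau> - t) *\<^sub>R g_rate w t) \<le> \<epsilon> / 3 * \<bar>\<tau> - t\<bar>"
    using pde_on_trajectory[OF s0 s(3) z1 vd[OF z(1) z1 s(1) s0 s(3)] e3] unfolding w_def by blast
  show "\<exists>\<delta>>0. \<forall>\<tau>\<in>{0..}. norm (\<tau> - t) < \<delta> \<longrightarrow> norm (g z0 \<tau> - g z0 t - (\<tau> - t) *\<^sub>R g_rate z0 t) \<le> \<epsilon> * norm (\<tau> - t)"
  proof (intro exI[of _ "min \<delta> 1"] conjI ballI impI)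
    show "0 < min \<delta> 1" using \<delta> by simp
    fix \<tau> :: real assume \<tau>: "\<tau> \<in> {0..}" "norm (\<tau> - t) < min \<delta> 1"
    have a: "norm ((g z0 \<tau> - g z0 t) - (g w \<tau> - g w t)) \<le> \<epsilon> / 3 * \<bar>\<tau> - t\<bar>"
    proof -
      have "norm ((g z0 \<tau> - g z0 t) - (g w \<tau> - g w t)) \<le> L * \<bar>\<tau> - t\<bar> * norm (z0 - w)"
        by (rule L(2)[OF r(3) wr t0]) (use \<tau> in auto)
      also have "\<dots> = (L * norm (z0 - w)) * \<bar>\<tau> - t\<bar>" by simp
      also have "\<dots> \<le> \<epsilon> / 3 * \<bar>\<tau> - t\<bar>" by (intro mult_right_mono Lw) simp
      finally show ?thesis .
    qed
    have b: "norm (g w \<tau> - g w t - (\<tau> - t) *\<^sub>R g_rate w t) \<le> \<epsilon> / 3 * \<bar>\<tau> - t\<bar>"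
      by (rule \<delta>(2)) (use \<tau> in auto)
    have c': "norm ((\<tau> - t) *\<^sub>R (g_rate w t - g_rate z0 t)) \<le> \<epsilon> / 3 * \<bar>\<tau> - t\<bar>"
      using mult_left_mono[OF less_imp_le[OF rate] abs_ge_zero[of "\<tau> - t"]] by (simp add: mult.commute)
    have eq: "g z0 \<tau> - g z0 t - (\<tau> - t) *\<^sub>R g_rate z0 t = ((g z0 \<tau> - g z0 t) - (g w \<tau> - g w t)) +
       (g w \<tau> - g w t - (\<tau> - t) *\<^sub>R g_rate w t) + (\<tau> - t) *\<^sub>R (g_rate w t - g_rate z0 t)"
      by (simp add: scaleR_diff_right)
    have "norm (g z0 \<tau> - g z0 t - (\<tau> - t) *\<^sub>R g_rate z0 t) \<le> norm ((g z0 \<tau> - g z0 t) - (g w \<tau> - g w t)) +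
       norm (g w \<tau> - g w t - (\<tau> - t) *\<^sub>R g_rate w t) + norm ((\<tau> - t) *\<^sub>R (g_rate w t - g_rate z0 t))"
      unfolding eq by (rule norm_triangle_le[OF add_right_mono[OF norm_triangle_ineq]])
    also have "\<dots> \<le> \<epsilon> * norm (\<tau> - t)" using a b c' by simp
    finally show "norm (g z0 \<tau> - g z0 t - (\<tau> - t) *\<^sub>R g_rate z0 t) \<le> \<epsilon> * norm (\<tau> - t)" .
  qed
qed

lemma g_pde:
  "AE t in lebesgue_on {0..}. \<forall>z\<in>ball 0 1. ((\<lambda>\<tau>. g z \<tau>) has_vector_derivative
     frechet_derivative (\<lambda>w. g w t) (at z) (h z t)) (at t within {0..})"
  unfolding AE_lebesgue_on_atLeast
proof -
  obtain Z :: "(complex ^ 'n) set" where Z: "countable Z" "\<And>X. open X \<Longrightarrow> X \<noteq> {} \<Longrightarrow> \<exists>z\<in>Z. z \<in> X"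
    using countable_dense_exists by metis
  define I where "I = {z \<in> Z. norm z < 1} \<times> {s \<in> \<rat>. (0 :: real) \<le> s}"
  have "countable {s \<in> \<rat>. (0 :: real) \<le> s}" by (rule countable_subset[OF _ countable_rat]) auto
  moreover have "countable {z \<in> Z. norm z < 1}" by (rule countable_subset[OF _ Z(1)]) auto
  ultimately have I: "countable I" unfolding I_def by (rule countable_SIGMA[rotated])
  have "\<forall>p\<in>I. \<exists>N. negligible N \<and> (\<forall>t\<ge>snd p. t \<notin> N \<longrightarrow>
     ((\<lambda>\<tau>. v (fst p) (snd p) \<tau>) has_vector_derivative - h (v (fst p) (snd p) t) t) (at t within {snd p..}))"
  proof
    fix p assume "p \<in> I"
    then have "0 \<le> snd p" "norm (fst p) < 1" by (auto simp: I_def)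
    from v_derivative[OF this] show "\<exists>N. negligible N \<and> (\<forall>t\<ge>snd p. t \<notin> N \<longrightarrow>
     ((\<lambda>\<tau>. v (fst p) (snd p) \<tau>) has_vector_derivative - h (v (fst p) (snd p) t) t) (at t within {snd p..}))" by metis
  qed
  then obtain N where N: "\<And>p. p \<in> I \<Longrightarrow> negligible (N p)" "\<And>p t. p \<in> I \<Longrightarrow> snd p \<le> t \<Longrightarrow> t \<notin> N p \<Longrightarrow>
     ((\<lambda>\<tau>. v (fst p) (snd p) \<tau>) has_vector_derivative - h (v (fst p) (snd p) t) t) (at t within {snd p..})"
    by metis
  have "negligible (\<Union>(N ` I))"
    by (rule negligible_countable_Union) (use I N(1) in auto)
  then have neg: "negligible (insert 0 (\<Union>(N ` I)))" by (simp add: negligible_insert)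
  show "\<exists>N. negligible N \<and> (\<forall>t\<ge>0. t \<notin> N \<longrightarrow> (\<forall>z\<in>ball 0 1. ((\<lambda>\<tau>. g z \<tau>) has_vector_derivative
     frechet_derivative (\<lambda>w. g w t) (at z) (h z t)) (at t within {0..})))"
  proof (intro exI[of _ "insert 0 (\<Union>(N ` I))"] conjI allI impI ballI neg)
    fix t :: real and z0 :: "complex ^ 'n" assume t: "0 \<le> t" "t \<notin> insert 0 (\<Union>(N ` I))" and z0: "z0 \<in> ball 0 1"
    have t0: "0 < t" using t by auto
    have z1: "norm z0 < 1" using z0 by simp
    have "((\<lambda>\<tau>. g z0 \<tau>) has_vector_derivative g_rate z0 t) (at t within {0..})"
    proof (rule pde_propagate[OF t0 z1 Z(2)])
      fix z s assume zs: "z \<in> Z" "norm z < 1" "s \<in> \<rat>" "0 \<le> s" "s < t"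
      then have "(z, s) \<in> I" by (simp add: I_def)
      with N(2)[OF this, of t] t(2) zs show "((\<lambda>\<tau>. v z s \<tau>) has_vector_derivative - h (v z s t) t) (at t within {s..})" by auto
    qed
    then show "((\<lambda>\<tau>. g z0 \<tau>) has_vector_derivative frechet_derivative (\<lambda>w. g w t) (at z0) (h z0 t)) (at t within {0..})"
      by (simp only: g_rate_def)
  qed
qed

lemma g_loewner_solution: "loewner_solution A h g"
  unfolding loewner_solution_def
  using g_holo g_zero g_derivative_zero g_unif_loc_abs_cont g_pde by blast

text \<open>\<open>P\<close> expands the remainder \<open>f\<close> of the normalized limit, which
  is of order \<open>n0 A + 1\<close>. Cauchy estimates on spheres whose radius tends to 0
  annihilate its terms of degree at most \<open>n0 A\<close> on the diagonal, and polarization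
  recovers the forms.\<close>

lemma g_coefficients:
  assumes t: "0 \<le> t" and G: "tail_convergent G"
    and e: "\<And>z. z \<in> ball 0 1 \<Longrightarrow> g z t = mexp (t *\<^sub>R A) *v (z + tail_sum G z)"
    and k: "k \<in> {2..n0 A}" and ws: "length ws = k"
  shows "G k ws = F k t ws"
proof -
  define P where "P j = (if j \<in> {2..n0 A} then (\<lambda>ws. G j ws - F j t ws) else G j)" for j
  define f where "f z = mexp ((- t) *\<^sub>R A) *v g z t - (z + (\<Sum>j=2..n0 A. F j t (replicate j z)))" for z
  have Gh: "G j \<in> hom_poly j" if "j \<ge> 2" for j using G that by (simp add: tail_convergent_def)
  have Ph: "P j \<in> hom_poly j" if "j \<ge> 2" for j
  proof (cases "j \<in> {2..n0 A}")
    case True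
    then show ?thesis using hom_poly_diff[OF Gh[OF that] F_hom[OF True t]] by (simp only: P_def if_True)
  next
    case False
    then show ?thesis using Gh[OF that] by (simp only: P_def if_False)
  qed
  have Ps: "(\<lambda>j. P (j + 2) (replicate (j + 2) z)) sums (tail_sum G z - (\<Sum>j=2..n0 A. F j t (replicate j z)))"
    if z: "z \<in> ball 0 1" for z
  proof -
    have 1: "(\<lambda>j. G (j + 2) (replicate (j + 2) z)) sums tail_sum G z"
      unfolding tail_sum_def using G z unfolding tail_convergent_def by (intro summable_sums) blast
    have 2: "(\<lambda>j. if j \<in> {j. j + 2 \<le> n0 A} then F (j + 2) t (replicate (j + 2) z) else 0) sums
       (\<Sum>j\<in>{j. j + 2 \<le> n0 A}. F (j + 2) t (replicate (j + 2) z))"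
      by (rule sums_If_finite_set) (rule finite_subset[of _ "{..n0 A}"], auto)
    have 3: "(\<Sum>j\<in>{j. j + 2 \<le> n0 A}. F (j + 2) t (replicate (j + 2) z)) = (\<Sum>j=2..n0 A. F j t (replicate j z))"
      by (rule sum.reindex_bij_witness[where i = "\<lambda>j. j - 2" and j = "\<lambda>j. j + 2"]) auto
    have "(\<lambda>j. G (j + 2) (replicate (j + 2) z) - (if j \<in> {j. j + 2 \<le> n0 A} then F (j + 2) t (replicate (j + 2) z) else 0))
       sums (tail_sum G z - (\<Sum>j=2..n0 A. F j t (replicate j z)))"
      using sums_diff[OF 1 2] unfolding 3 .
    moreover have "(\<lambda>j. G (j + 2) (replicate (j + 2) z) - (if j \<in> {j. j + 2 \<le> n0 A} then F (j + 2) t (replicate (j + 2) z) else 0)) =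
       (\<lambda>j. P (j + 2) (replicate (j + 2) z))"
      by (rule ext) (simp add: P_def del: replicate.simps)
    ultimately show ?thesis by simp
  qed
  have P: "tail_convergent P"
    unfolding tail_convergent_def using Ph Ps sums_summable by blast
  \<comment> \<open>The zero matrix as linear part gives \<open>f\<close> the shape required by
    \<open>expansion_coeff_bound\<close>.\<close>
  have fP: "f z = 0 *v z + tail_sum P z" if z: "z \<in> ball 0 1" for z
  proof -
    have "tail_sum P z = tail_sum G z - (\<Sum>j=2..n0 A. F j t (replicate j z))"
      unfolding tail_sum_def[of P] using Ps[OF z] by (rule sums_unique[symmetric])
    moreover have "mexp ((- t) *\<^sub>R A) *v g z t = z + tail_sum G z"
      unfolding e[OF z] mexp_minus_mexp by simp
    ultimately show ?thesis by (simp add: f_def)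
  qed
  have small: "norm (P k (replicate k z)) \<le> (C * (1 + t ^ d) * norm z ^ k) * r" if r: "0 < r" "r \<le> 1 / 4" for r z
  proof -
    have "norm (P k (replicate k z)) \<le> (C * (1 + t ^ d) * r ^ (n0 A + 1)) * (norm z / r) ^ k"
    proof (rule expansion_coeff_bound[OF P fP])
      show "norm (f x) \<le> C * (1 + t ^ d) * r ^ (n0 A + 1)" if "norm x = r" for x
        unfolding f_def using g_expansion_estimate[OF t, of x] that r by simp
    qed (use r k in auto)
    also have "\<dots> = (C * (1 + t ^ d) * norm z ^ k) * (r ^ (n0 A + 1) / r ^ k)" by (simp add: power_divide)
    also have "\<dots> \<le> (C * (1 + t ^ d) * norm z ^ k) * r"
    proof (rule mult_left_mono)
      have "r ^ (n0 A + 1) \<le> r ^ (k + 1)" using r k by (intro power_decreasing) auto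
      then show "r ^ (n0 A + 1) / r ^ k \<le> r" using r by (simp add: field_simps)
    qed (use C t in simp)
    finally show ?thesis .
  qed
  have "P k (replicate k z) = 0" for z
  proof (rule ccontr)
    assume nz: "P k (replicate k z) \<noteq> 0"
    define X where "X = C * (1 + t ^ d) * norm z ^ k"
    have X: "X \<ge> 0" using C t by (simp add: X_def)
    define n where "n = norm (P k (replicate k z))"
    have n: "n > 0" using nz by (simp add: n_def)
    \<comment> \<open>So small that \<open>X * r\<close> is at most half of
      \<open>n\<close>.\<close>
    define r where "r = min (1 / 4) (n / (2 * (X + 1)))"
    have "0 < r" using n X by (simp add: r_def)
    moreover have "r \<le> 1 / 4" unfolding r_def by (rule min.cobounded1)
    moreover have "r \<le> n / (2 * (X + 1))" unfolding r_def by (rule min.cobounded2)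
    ultimately have r: "0 < r" "r \<le> 1 / 4" "r \<le> n / (2 * (X + 1))" .
    have "n \<le> X * r" using small[OF r(1,2), of z] by (simp add: n_def X_def)
    also have "\<dots> \<le> (X + 1) * (n / (2 * (X + 1)))" using r X by (intro mult_mono) auto
    also have "\<dots> = n / 2" using X by (intro mult_divide_mult_cancel_pos) simp
    finally show False using n by simp
  qed
  from hom_poly_polarization[OF Ph this ws] k have "P k ws = 0" by simp
  then show ?thesis using k by (simp add: P_def)
qed

end

text \<open>The order of quantifiers is the point: the constants depend on \<open>A\<close>,
  \<open>c\<close> and \<open>d\<close> alone, which later makes \<open>Q\<close> independent of the
  field and the coefficients.\<close>

lemma key_constants:
  fixes A :: "complex ^ 'n ^ 'n"
  assumes mA: "m_low A > 0" and c: "c \<ge> 0"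
  shows "\<exists>C \<eta>. \<forall>h v H F. loewner_chain_data A h v H F \<longrightarrow>
     (\<forall>k\<in>{2..n0 A}. \<forall>t\<ge>0. form_norm k (F k t) \<le> c * (1 + t ^ d)) \<longrightarrow> loewner_key A h v H F C \<eta> c d"
proof -
  define \<eta> where "\<eta> = ((real (n0 A) + 1) * m_low A - k_plus A) / 3"
  have \<eta>: "\<eta> > 0" "3 * \<eta> = (real (n0 A) + 1) * m_low A - k_plus A"
    using k_plus_less[OF mA] by (auto simp: \<eta>_def)
  obtain C1 where C1: "C1 > 0" "\<And>\<tau>. \<tau> \<ge> 0 \<Longrightarrow> norm (mexp (\<tau> *\<^sub>R A)) \<le> C1 * exp ((k_plus A + \<eta>) * \<tau>)"
    using mexp_growth[OF \<eta>(1), of A] by blast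
  obtain C2 where C2: "C2 > 0" "\<And>\<tau>. \<tau> \<ge> 0 \<Longrightarrow> 1 + \<tau> ^ d \<le> C2 * exp (\<eta> * \<tau>)"
    using power_exp_bound[OF \<eta>(1), of d] by blast
  define C where "C = C1 * (64 * norm A * 2 ^ (n0 A + 1) * ((1 + real (n0 A) ^ 2 * c) * (2 ^ d * C2)) * 2 ^ (n0 A + 1))"
  show ?thesis
  proof (rule exI[of _ "C / \<eta>"], rule exI[of _ \<eta>], intro allI impI)
    fix h v and H F :: "nat \<Rightarrow> real \<Rightarrow> 'n form"
    assume l: "loewner_chain_data A h v H F"
      and bd': "\<forall>k\<in>{2..n0 A}. \<forall>t\<ge>0. form_norm k (F k t) \<le> c * (1 + t ^ d)"
    then have bd: "\<And>k t. k \<in> {2..n0 A} \<Longrightarrow> t \<ge> 0 \<Longrightarrow> form_norm k (F k t) \<le> c * (1 + t ^ d)" by blast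
    interpret loewner_chain_data A h v H F by (rule l)
    show "loewner_key A h v H F (C / \<eta>) \<eta> c d"
    proof (unfold_locales)
      show "0 \<le> C / \<eta>" using \<eta> C1(1) C2(1) c by (simp add: C_def)
      show "norm (mexp ((- s) *\<^sub>R A) *v (g_approx A v F t2 w s - g_approx A v F t1 w s))
         \<le> C / \<eta> * (1 + s ^ d) * norm w ^ (n0 A + 1) * (exp (- (\<eta> * (t1 - s))) - exp (- (\<eta> * (t2 - s))))"
        if "0 \<le> s" "s \<le> t1" "t1 \<le> t2" "norm w \<le> 1 / 4" for s t1 t2 w
        unfolding C_def by (rule key_estimate[OF that c bd \<eta> C1(2,1) C2(2,1)])
    qed (use \<eta> c bd in auto)
  qed
qed

text \<open>For nonnegative \<open>t\<close> every power of degree at most \<open>d\<close> is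
  bounded by \<open>1 + t ^ d\<close>.\<close>

lemma poly_le_power:
  fixes P :: "real poly"
  assumes "degree P \<le> d"
  shows "\<exists>c\<ge>0. \<forall>t\<ge>0. poly P t \<le> c * (1 + t ^ d)"
proof (intro exI[of _ "\<Sum>i\<le>degree P. \<bar>coeff P i\<bar>"] conjI allI impI)
  show "0 \<le> (\<Sum>i\<le>degree P. \<bar>coeff P i\<bar>)" by (rule sum_nonneg) simp
  fix t :: real assume t: "t \<ge> 0"
  have "poly P t = (\<Sum>i\<le>degree P. coeff P i * t ^ i)" by (rule poly_altdef)
  also have "\<dots> \<le> (\<Sum>i\<le>degree P. \<bar>coeff P i\<bar> * (1 + t ^ d))"
  proof (rule sum_mono)
    fix i assume "i \<in> {..degree P}"
    then have i: "i \<le> d" using assms by simp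
    have "t ^ i \<le> 1 + t ^ d"
    proof (cases "t \<le> 1")
      case True
      then have "t ^ i \<le> 1" using t by (simp add: power_le_one)
      then show ?thesis using zero_le_power[OF t, of d] by linarith
    next
      case False
      then have "t ^ i \<le> t ^ d" using i by (intro power_increasing) auto
      then show ?thesis by simp
    qed
    then show "coeff P i * t ^ i \<le> \<bar>coeff P i\<bar> * (1 + t ^ d)"
      using t by (intro mult_mono) auto
  qed
  also have "\<dots> = (\<Sum>i\<le>degree P. \<bar>coeff P i\<bar>) * (1 + t ^ d)" by (rule sum_distrib_right[symmetric])
  finally show "poly P t \<le> (\<Sum>i\<le>degree P. \<bar>coeff P i\<bar>) * (1 + t ^ d)" .
qed

lemma coeffs_poly_bounded_uniform:
  assumes "coeffs_poly_bounded A F"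
  obtains c d where "c \<ge> 0" "\<And>k t. k \<in> {2..n0 A} \<Longrightarrow> t \<ge> 0 \<Longrightarrow> form_norm k (F k t) \<le> c * (1 + t ^ d)"
proof -
  obtain P :: "nat \<Rightarrow> real poly" where P: "\<And>k t. k \<in> {2..n0 A} \<Longrightarrow> t \<ge> 0 \<Longrightarrow> form_norm k (F k t) \<le> poly (P k) t"
    using assms unfolding coeffs_poly_bounded_def by metis
  define d where "d = (\<Sum>k=2..n0 A. degree (P k))"
  have "\<exists>c\<ge>0. \<forall>t\<ge>0. poly (P k) t \<le> c * (1 + t ^ d)" if "k \<in> {2..n0 A}" for k
    by (rule poly_le_power) (unfold d_def, rule member_le_sum[OF that], auto)
  then obtain c where c: "\<And>k. k \<in> {2..n0 A} \<Longrightarrow> c k \<ge> 0"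
    "\<And>k t. k \<in> {2..n0 A} \<Longrightarrow> t \<ge> 0 \<Longrightarrow> poly (P k) t \<le> c k * (1 + t ^ d)" by metis
  show thesis
  proof (rule that)
    show "0 \<le> (\<Sum>k=2..n0 A. c k)" by (rule sum_nonneg) (rule c)
    fix k and t :: real assume k: "k \<in> {2..n0 A}" and t: "t \<ge> 0"
    have "form_norm k (F k t) \<le> c k * (1 + t ^ d)" using P[OF k t] c(2)[OF k t] by linarith
    also have "\<dots> \<le> (\<Sum>k=2..n0 A. c k) * (1 + t ^ d)"
      using t by (intro mult_right_mono member_le_sum[OF k]) (use c(1) in auto)
    finally show "form_norm k (F k t) \<le> (\<Sum>k=2..n0 A. c k) * (1 + t ^ d)" .
  qed
qed

text \<open>The growth constants are chosen outside the locale, since a constant obtained inside it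
  could depend on the field.\<close>

lemma growth_constants:
  fixes A :: "complex ^ 'n ^ 'n" and P :: "real poly"
  assumes mA: "m_low A > 0" and \<epsilon>: "\<epsilon> > 0"
  shows "\<exists>D>0. \<forall>h v H F. loewner_chain_data A h v H F \<longrightarrow> coeffs_bounded_by A F P \<longrightarrow>
       (\<forall>z\<in>ball 0 1. \<forall>t\<ge>0. norm (mexp ((- t) *\<^sub>R A) *v g_lim A v F z t) \<le>
          D * (1 + t ^ degree P) / (1 - norm z) powr (2 * (k_plus A / m_low A) + \<epsilon>))"
proof -
  obtain c where c: "c \<ge> 0" "\<And>t. t \<ge> 0 \<Longrightarrow> poly P t \<le> c * (1 + t ^ degree P)"
    using poly_le_power[OF order_refl, of P] by blast
  obtain C where "\<exists>\<eta>. \<forall>h v H F. loewner_chain_data A h v H F \<longrightarrow>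
     (\<forall>k\<in>{2..n0 A}. \<forall>t\<ge>0. form_norm k (F k t) \<le> c * (1 + t ^ degree P)) \<longrightarrow> loewner_key A h v H F C \<eta> c (degree P)"
    using key_constants[OF mA c(1), of "degree P"] ..
  then obtain \<eta> where key: "\<forall>h v H F. loewner_chain_data A h v H F \<longrightarrow>
     (\<forall>k\<in>{2..n0 A}. \<forall>t\<ge>0. form_norm k (F k t) \<le> c * (1 + t ^ degree P)) \<longrightarrow> loewner_key A h v H F C \<eta> c (degree P)"
    ..
  have e: "\<epsilon> * m_low A / 4 > 0" using \<epsilon> mA by simp
  obtain C1 where C1: "C1 > 0" "\<And>\<tau>. \<tau> \<ge> 0 \<Longrightarrow> norm (mexp (\<tau> *\<^sub>R A)) \<le> C1 * exp ((k_plus A + \<epsilon> * m_low A / 4) * \<tau>)"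
    using mexp_growth[OF e, of A] by blast
  obtain C2 where C2: "C2 > 0" "\<And>\<tau>. \<tau> \<ge> 0 \<Longrightarrow> 1 + \<tau> ^ degree P \<le> C2 * exp (\<epsilon> * m_low A / 4 * \<tau>)"
    using power_exp_bound[OF e, of "degree P"] by blast
  \<comment> \<open>The sign of \<open>C\<close> is known only inside the locale, hence the absolute
    value.\<close>
  define D where "D = C1 * (1 + real (n0 A) * c + \<bar>C\<bar>) * 2 ^ degree P * C2 * 4 powr (k_plus A / m_low A + \<epsilon> / 2)"
  show ?thesis
  proof (intro exI[of _ D] conjI allI impI ballI)
    show "D > 0" unfolding D_def using C1(1) C2(1) c(1) by (intro mult_pos_pos) (auto simp: add_pos_nonneg)
    fix h v and z :: "complex ^ 'n" and t :: real and H F :: "nat \<Rightarrow> real \<Rightarrow> 'n form"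
    assume l: "loewner_chain_data A h v H F" and b: "coeffs_bounded_by A F P" and z: "z \<in> ball 0 1" and t: "t \<ge> 0"
    have "\<forall>k\<in>{2..n0 A}. \<forall>t\<ge>0. form_norm k (F k t) \<le> c * (1 + t ^ degree P)"
    proof (intro ballI allI impI)
      fix k and t :: real assume k: "k \<in> {2..n0 A}" and t: "t \<ge> 0"
      have "form_norm k (F k t) \<le> poly P t" using b k t unfolding coeffs_bounded_by_def by blast
      with c(2)[OF t] show "form_norm k (F k t) \<le> c * (1 + t ^ degree P)" by linarith
    qed
    with key l have "loewner_key A h v H F C \<eta> c (degree P)" by blast
    then interpret loewner_key A h v H F C \<eta> c "degree P" .
    have "norm z < 1" using z by simp
    from g_growth[OF \<epsilon> t this C1 C2] C
    show "norm (mexp ((- t) *\<^sub>R A) *v g_lim A v F z t) \<le> D * (1 + t ^ degree P) / (1 - norm z) powr (2 * (k_plus A / m_low A) + \<epsilon>)"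
      by (simp add: D_def)
  qed
qed

theorem theorem2p8:
  fixes A :: "complex ^ 'n ^ 'n"
  assumes mA: "m_low A > 0"
  shows
    "(\<forall>h H v F.
        h \<in> class_H A \<and> h_expansion A h H \<and> transition_mapping h v \<and>
        coeff_solutions A H F \<and> coeffs_poly_bounded A F \<longrightarrow>
          (\<forall>s\<ge>0. \<forall>K. compact K \<and> K \<subseteq> ball 0 1 \<longrightarrow>
             uniform_limit K (\<lambda>t z. g_approx A v F t z s) (\<lambda>z. g_lim A v F z s) at_top) \<and>
          loewner_chain (g_lim A v F) \<and>
          loewner_solution A h (g_lim A v F) \<and>
          poly_bounded_solution A (g_lim A v F) \<and>
          (\<forall>G. (\<forall>t\<ge>0. tail_convergent (\<lambda>k. G k t) \<and>
                   (\<forall>z\<in>ball 0 1. g_lim A v F z t = mexp (t *\<^sub>R A) *v (z + tail_sum (\<lambda>k. G k t) z)))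
               \<longrightarrow> (\<forall>k\<in>{2..n0 A}. \<forall>t\<ge>0. \<forall>ws. length ws = k \<longrightarrow> G k t ws = F k t ws)))
     \<and>
     (\<forall>(P::real poly) \<epsilon>. \<epsilon> > 0 \<longrightarrow>
        (\<exists>Q::real poly. degree Q = degree P \<and>
           (\<forall>h H v F.
              h \<in> class_H A \<and> h_expansion A h H \<and> transition_mapping h v \<and>
              coeff_solutions A H F \<and> coeffs_poly_bounded A F \<and> coeffs_bounded_by A F P \<longrightarrow>
                (\<forall>z\<in>ball 0 1. \<forall>t\<ge>0.
                   norm (mexp ((- t) *\<^sub>R A) *v g_lim A v F z t)
                     \<le> poly Q t / (1 - norm z) powr (2 * (k_plus A / m_low A) + \<epsilon>)))))"
proof -
  have data: "loewner_chain_data A h v H F"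
    if "h \<in> class_H A" "h_expansion A h H" "transition_mapping h v" "coeff_solutions A H F" for h v H F
    using that mA by unfold_locales
  show ?thesis
  proof (rule conjI; intro allI impI)
    fix h v and H F :: "nat \<Rightarrow> real \<Rightarrow> 'n form"
    assume *: "h \<in> class_H A \<and> h_expansion A h H \<and> transition_mapping h v \<and>
        coeff_solutions A H F \<and> coeffs_poly_bounded A F"
    then have l: "loewner_chain_data A h v H F" using data by blast
    obtain c d where c: "c \<ge> 0" "\<And>k t. k \<in> {2..n0 A} \<Longrightarrow> t \<ge> 0 \<Longrightarrow> form_norm k (F k t) \<le> c * (1 + t ^ d)"
      using * coeffs_poly_bounded_uniform[of A F] by blast
    obtain C where "\<exists>\<eta>. \<forall>h v H F. loewner_chain_data A h v H F \<longrightarrow>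
     (\<forall>k\<in>{2..n0 A}. \<forall>t\<ge>0. form_norm k (F k t) \<le> c * (1 + t ^ d)) \<longrightarrow> loewner_key A h v H F C \<eta> c d"
      using key_constants[OF mA c(1), of d] ..
    then obtain \<eta> where "\<forall>h v H F. loewner_chain_data A h v H F \<longrightarrow>
     (\<forall>k\<in>{2..n0 A}. \<forall>t\<ge>0. form_norm k (F k t) \<le> c * (1 + t ^ d)) \<longrightarrow> loewner_key A h v H F C \<eta> c d"
      ..
    then have "loewner_key A h v H F C \<eta> c d" using l c(2) by blast
    then interpret loewner_key A h v H F C \<eta> c d .
    have "G k t ws = F k t ws"
      if "\<forall>t\<ge>0. tail_convergent (\<lambda>k. G k t) \<and>
          (\<forall>z\<in>ball 0 1. g_lim A v F z t = mexp (t *\<^sub>R A) *v (z + tail_sum (\<lambda>k. G k t) z))"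
        "k \<in> {2..n0 A}" "0 \<le> t" "length ws = k" for G k t ws
      by (rule g_coefficients[OF that(3) _ _ that(2,4)]) (use that(1,3) in auto)
    then show "(\<forall>s\<ge>0. \<forall>K. compact K \<and> K \<subseteq> ball 0 1 \<longrightarrow>
             uniform_limit K (\<lambda>t z. g_approx A v F t z s) (\<lambda>z. g_lim A v F z s) at_top) \<and>
          loewner_chain (g_lim A v F) \<and>
          loewner_solution A h (g_lim A v F) \<and>
          poly_bounded_solution A (g_lim A v F) \<and>
          (\<forall>G. (\<forall>t\<ge>0. tail_convergent (\<lambda>k. G k t) \<and>
                   (\<forall>z\<in>ball 0 1. g_lim A v F z t = mexp (t *\<^sub>R A) *v (z + tail_sum (\<lambda>k. G k t) z)))
               \<longrightarrow> (\<forall>k\<in>{2..n0 A}. \<forall>t\<ge>0. \<forall>ws. length ws = k \<longrightarrow> G k t ws = F k t ws))"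
      using g_uniform_limit
      by (intro conjI allI impI ballI g_loewner_chain g_loewner_solution poly_bounded) simp_all
  next
    fix P :: "real poly" and \<epsilon> :: real assume \<epsilon>: "\<epsilon> > 0"
    obtain D where D: "D > 0" "\<forall>h v H F. loewner_chain_data A h v H F \<longrightarrow> coeffs_bounded_by A F P \<longrightarrow>
       (\<forall>z\<in>ball 0 1. \<forall>t\<ge>0. norm (mexp ((- t) *\<^sub>R A) *v g_lim A v F z t) \<le>
          D * (1 + t ^ degree P) / (1 - norm z) powr (2 * (k_plus A / m_low A) + \<epsilon>))"
      using growth_constants[OF mA \<epsilon>, of P] by blast
    \<comment> \<open>In degree 0 the two summands merge into the constant 2D; otherwise D is the
      leading coefficient.\<close>
    define Q where "Q = [:D:] + monom D (degree P)"
    have deg: "degree Q = degree P"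
    proof (cases "degree P = 0")
      case True
      then show ?thesis by (simp add: Q_def monom_0)
    next
      case False
      then have "degree [:D:] < degree (monom D (degree P))" using D(1) by (simp add: degree_monom_eq)
      then have "degree Q = degree (monom D (degree P))" unfolding Q_def by (rule degree_add_eq_right)
      then show ?thesis using D(1) by (simp add: degree_monom_eq)
    qed
    have "poly Q t = D * (1 + t ^ degree P)" for t
      by (simp add: Q_def poly_monom distrib_left)
    then have "\<forall>h v H F. loewner_chain_data A h v H F \<longrightarrow> coeffs_bounded_by A F P \<longrightarrow>
       (\<forall>z\<in>ball 0 1. \<forall>t\<ge>0. norm (mexp ((- t) *\<^sub>R A) *v g_lim A v F z t) \<le>
          poly Q t / (1 - norm z) powr (2 * (k_plus A / m_low A) + \<epsilon>))"
      using D(2) by simp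
    with deg data show "\<exists>Q::real poly. degree Q = degree P \<and>
           (\<forall>h H v F.
              h \<in> class_H A \<and> h_expansion A h H \<and> transition_mapping h v \<and>
              coeff_solutions A H F \<and> coeffs_poly_bounded A F \<and> coeffs_bounded_by A F P \<longrightarrow>
                (\<forall>z\<in>ball 0 1. \<forall>t\<ge>0.
                   norm (mexp ((- t) *\<^sub>R A) *v g_lim A v F z t)
                     \<le> poly Q t / (1 - norm z) powr (2 * (k_plus A / m_low A) + \<epsilon>)))"
      by (intro exI[of _ Q] conjI) blast+
  qed
qed

end
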